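(* Let $A$ be a finite set, and let $Z=(Z_n)_{n\ge1}=((X_n,K_n))_{n\ge1}$ be the regime switching process on $A\times\mathbb N_+$ with letter distributions $P_a=(p_{a,k})_{k\ge1}$, $a\in A$, whose underlying process $X=(X_n)_{n\ge1}$ is an irreducible and aperiodic Markov chain on $A$ with transition matrix $Q$, stationary distribution $\pi=(\pi_a)_{a\in A}$ and initial distribution $\eta$. Let $\alpha\in[0,1]$ and assume that $P=(p_{a,k})_{(a,k)\in A\times\mathbb N_+}\in RV_\alpha(C,\ell)$ for some slowly varying $\ell$ and some $C:A\to[0,\infty)$ not identically zero. If $\alpha=0$, assume additionally that there are a slowly varying $\ell_0$ and a function $D:A\to[0,\infty)$, not identically zero, such that for each $a\in A$ $$\lim_{\varepsilon\to0}\frac{\sum_{k\ge1}p_{a,k}\mathbf 1\{p_{a,k}\le\varepsilon\}}{\varepsilon\,\ell_0(1/\varepsilon)}=D(a).$$ Assume that $\ell$ (respectively $\ell_0$ when $\alpha=0$) is locally bounded away from $0$ and $\infty$ on $[1,\infty)$. Then for every integer $r\ge0$ $$\lim_{n\to\infty}\frac{\mathbf P_\eta\{\mathcal L_n=r\}}{h_{\alpha,r}(n)}=\sum_{a\in A}\pi_a^{\alpha}F(a,r)$$ and $$\lim_{n\to\infty}\frac{\mathbf P_\eta\{\mathcal L_n=r\}}{\mathbf E_\eta\left[\mathbf 1\{L_n>r\}h_{\alpha,r}(L_n)\right]}=\frac{\sum_{a\in A}\pi_a^{\alpha}F(a,r)}{\sum_{a\in A}\pi_a^{\alpha}}.$$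
   Context: Regime switching process: $\mathbb N_+=\{1,2,\dots\}$; for each $a\in A$, $P_a=(p_{a,k})_{k\ge1}$ is a probability distribution on $\mathbb N_+$. $Z=((X_n,K_n))_{n\ge1}$ is the Markov chain on $A\times\mathbb N_+$ with $\mathbf P_\eta\{Z_1=(a,k)\}=\eta(a)p_{a,k}$ and transition probabilities $\mathcal Q((a',k'),(a,k))=Q(a',a)p_{a,k}$. (So $X$ is a Markov chain with transition matrix $Q$ and initial distribution $\eta$.) $\mathbf P_\eta,\mathbf E_\eta$ denote probability and expectation for this process. Set $$\mathcal L_n=\sum_{i=1}^n\mathbf 1\{Z_i=Z_{n+1}\},\qquad L_n=\sum_{i=1}^n\mathbf 1\{X_i=X_{n+1}\}.$$ A measurable function $\ell:(0,\infty)\to\mathbb R$ is slowly varying (at $+\infty$) if $\lim_{x\to\infty}\ell(cx)/\ell(x)=1$ for every $c>0$. "Locally bounded away from $0$ and $\infty$ on $[1,\infty)$" means: on every compact subset of $[1,\infty)$ the function takes values between two positive finite constants. Counting functions: $\nu(a,\varepsilon)=\sum_{k\ge1}\mathbf 1\{p_{a,k}\ge\varepsilon\}$. We write $P\in RV_\alpha(C,\ell)$ if $\ell$ is slowly varying, $C:A\to[0,\infty)$ is not identically zero, and for each $a\in A$, $\lim_{\varepsilon\to0}\nu(a,\varepsilon)/(\varepsilon^{-\alpha}\ell(1/\varepsilon))=C(a)$. Normalizing function: $$h_{\alpha,r}(x)=\begin{cases}x^{-1}\ell_0(x)&\alpha=0,\\ \int_x^\infty u^{-1}\ell(u)\,du&\alpha=1,\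 r=0,\\ x^{-(1-\alpha)}\ell(x)&\text{otherwise,}\end{cases}$$ and $$F(a,r)=\begin{cases}D(a)&\alpha=0,\\ C(a)&\alpha=1,\ r=0,\\ C(a)\dfrac{\alpha\Gamma(r+1-\alpha)}{r!}&\text{otherwise,}\end{cases}$$ where $\Gamma$ is the gamma function. *)

theory Defs
  imports "HOL-Probability.Probability"
begin

text \<open>
  The finite set of regimes is a type of class \<open>finite\<close>. The transition matrix \<open>Q\<close> is given by
  its rows, so \<open>pmf (Q a) b\<close> is the probability of moving from \<open>a\<close> to \<open>b\<close>. The letter
  distributions are probability mass functions on \<open>nat\<close>; where they are used it is
  assumed that they are supported on the positive integers.
\<close>

primrec n_step :: "('a::finite \<Rightarrow> 'a pmf) \<Rightarrow> nat \<Rightarrow> 'a \<Rightarrow> 'a \<Rightarrow> real" where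
  "n_step Q 0 a b = of_bool (a = b)"
| "n_step Q (Suc n) a b = (\<Sum>c\<in>UNIV. pmf (Q a) c * n_step Q n c b)"

definition irreducible_chain :: "('a::finite \<Rightarrow> 'a pmf) \<Rightarrow> bool" where
  "irreducible_chain Q \<longleftrightarrow> (\<forall>a b. \<exists>n. n_step Q n a b > 0)"

definition aperiodic_chain :: "('a::finite \<Rightarrow> 'a pmf) \<Rightarrow> bool" where
  "aperiodic_chain Q \<longleftrightarrow> (\<forall>a. Gcd {n. n \<ge> 1 \<and> n_step Q n a a > 0} = 1)"

definition stationary_distribution :: "('a::finite \<Rightarrow> 'a pmf) \<Rightarrow> 'a pmf \<Rightarrow> bool" where
  "stationary_distribution Q \<pi> \<longleftrightarrow> (\<forall>b. (\<Sum>a\<in>UNIV. pmf \<pi> a * pmf (Q a) b) = pmf \<pi> b)"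

text \<open>Processes are indexed from 1; the value at index 0 is never used.\<close>

definition markov_chain ::
  "'w measure \<Rightarrow> (nat \<Rightarrow> 'w \<Rightarrow> 's) \<Rightarrow> ('s \<Rightarrow> real) \<Rightarrow> ('s \<Rightarrow> 's \<Rightarrow> real) \<Rightarrow> bool" where
  "markov_chain M Z init T \<longleftrightarrow>
     prob_space M \<and>
     (\<forall>n\<ge>1. Z n \<in> measurable M (count_space UNIV)) \<and>
     (\<forall>z. \<P>(\<omega> in M. Z 1 \<omega> = z) = init z) \<and>
     (\<forall>n\<ge>1. \<forall>z. \<P>(\<omega> in M. \<forall>i\<in>{1..n}. Z i \<omega> = z i) > 0 \<longrightarrow>
        \<P>(\<omega> in M. Z (n + 1) \<omega> = z (n + 1) \<bar> \<forall>i\<in>{1..n}. Z i \<omega> = z i) = T (z n) (z (n + 1)))"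

definition regime_switching_process ::
  "'w measure \<Rightarrow> (nat \<Rightarrow> 'w \<Rightarrow> 'a \<times> nat) \<Rightarrow> 'a pmf \<Rightarrow> ('a::finite \<Rightarrow> 'a pmf) \<Rightarrow> ('a \<Rightarrow> nat pmf) \<Rightarrow> bool"
  where
  "regime_switching_process M Z \<eta> Q p \<longleftrightarrow>
     (\<forall>a. set_pmf (p a) \<subseteq> {1..}) \<and>
     markov_chain M Z
       (\<lambda>(a, k). pmf \<eta> a * pmf (p a) k)
       (\<lambda>(a', k') (a, k). pmf (Q a') a * pmf (p a) k)"

text \<open>
  With \<open>Y = Z\<close> this is the number of previous occurrences of the \<open>(n+1)\<close>-st letter; with
  \<open>Y = X\<close> it is that of the \<open>(n+1)\<close>-st regime.
\<close>

definition previous_visits :: "(nat \<Rightarrow> 'w \<Rightarrow> 's) \<Rightarrow> nat \<Rightarrow> 'w \<Rightarrow> nat" where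
  "previous_visits Y n \<omega> = card {i\<in>{1..n}. Y i \<omega> = Y (n + 1) \<omega>}"

text \<open>
  Functions on \<open>(0,\<infinity>)\<close> are represented by functions on the reals whose values
  outside \<open>(0,\<infinity>)\<close> are irrelevant.
\<close>

definition slowly_varying :: "(real \<Rightarrow> real) \<Rightarrow> bool" where
  "slowly_varying l \<longleftrightarrow>
     l \<in> borel_measurable (restrict_space borel {0<..}) \<and>
     (\<forall>c>0. ((\<lambda>x. l (c * x) / l x) \<longlongrightarrow> 1) at_top)"

definition locally_bounded_away :: "(real \<Rightarrow> real) \<Rightarrow> bool" where
  "locally_bounded_away l \<longleftrightarrow>
     (\<forall>S. compact S \<and> S \<subseteq> {1..} \<longrightarrow> (\<exists>b B. 0 < b \<and> 0 < B \<and> (\<forall>x\<in>S. b \<le> l x \<and> l x \<le> B)))"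

definition counting_fun :: "('a \<Rightarrow> nat pmf) \<Rightarrow> 'a \<Rightarrow> real \<Rightarrow> nat" where
  "counting_fun p a \<epsilon> = card {k. k \<ge> 1 \<and> pmf (p a) k \<ge> \<epsilon>}"

definition RV :: "real \<Rightarrow> ('a \<Rightarrow> real) \<Rightarrow> (real \<Rightarrow> real) \<Rightarrow> ('a \<Rightarrow> nat pmf) \<Rightarrow> bool" where
  "RV \<alpha> C l p \<longleftrightarrow>
     slowly_varying l \<and> (\<forall>a. C a \<ge> 0) \<and> (\<exists>a. C a \<noteq> 0) \<and>
     (\<forall>a. ((\<lambda>\<epsilon>. real (counting_fun p a \<epsilon>) / (\<epsilon> powr (-\<alpha>) * l (1 / \<epsilon>))) \<longlongrightarrow> C a) (at_right 0))"

definition RV_zero_tail :: "('a \<Rightarrow> real) \<Rightarrow> (real \<Rightarrow> real) \<Rightarrow> ('a \<Rightarrow> nat pmf) \<Rightarrow> bool" where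
  "RV_zero_tail D l0 p \<longleftrightarrow>
     slowly_varying l0 \<and> (\<forall>a. D a \<ge> 0) \<and> (\<exists>a. D a \<noteq> 0) \<and>
     (\<forall>a. ((\<lambda>\<epsilon>. (\<Sum>\<^sub>\<infinity>k\<in>{1..}. pmf (p a) k * of_bool (pmf (p a) k \<le> \<epsilon>)) / (\<epsilon> * l0 (1 / \<epsilon>)))
        \<longlongrightarrow> D a) (at_right 0))"

definition norm_fun :: "(real \<Rightarrow> real) \<Rightarrow> (real \<Rightarrow> real) \<Rightarrow> real \<Rightarrow> nat \<Rightarrow> real \<Rightarrow> real" where
  "norm_fun l l0 \<alpha> r x =
     (if \<alpha> = 0 then l0 x / x
      else if \<alpha> = 1 \<and> r = 0 then (LBINT u:{x..}. l u / u)
      else x powr (-(1 - \<alpha>)) * l x)"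

definition limit_coeff :: "('a \<Rightarrow> real) \<Rightarrow> ('a \<Rightarrow> real) \<Rightarrow> real \<Rightarrow> 'a \<Rightarrow> nat \<Rightarrow> real" where
  "limit_coeff C D \<alpha> a r =
     (if \<alpha> = 0 then D a
      else if \<alpha> = 1 \<and> r = 0 then C a
      else C a * (\<alpha> * Gamma (real r + 1 - \<alpha>) / fact r))"

end

theory Submission
  imports Defs
begin

text \<open>
  Given the regimes, the letters are independent, so the probability that \<open>\<L>\<^sub>n = r\<close> is
  the expectation of \<open>\<phi>\<^sub>a(L\<^sub>n)\<close> at \<open>a = X\<^sub>n\<^sub>+\<^sub>1\<close>, where \<open>\<phi>\<^sub>a(m)\<close> is the corresponding probability
  \<open>\<Sum>k. p\<^sub>k * (m choose r) * p\<^sub>k\<^sup>r * (1 - p\<^sub>k)\<^sup>m\<^sup>-\<^sup>r\<close> for independent letters from \<open>P\<^sub>a\<close>. Replacing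
  \<open>(1 - p\<^sub>k)\<^sup>m\<^sup>-\<^sup>r\<close> by \<open>exp (- m * p\<^sub>k)\<close> costs a factor \<open>1 + O(1/m)\<close>, and the resulting series is an
  integral of the counting function (for \<open>\<alpha> = 0\<close>, of the mass of the small letters) against an
  explicit kernel; dominated convergence, with a
  doubling bound in place of Potter's bounds, gives \<open>\<phi>\<^sub>a(m) \<sim> F(a, r) * h(m)\<close>.

  On \<open>X\<^sub>n\<^sub>+\<^sub>1 = a\<close> the number \<open>L\<^sub>n\<close> of earlier visits to \<open>a\<close> stays within \<open>\<delta> * n\<close> of \<open>\<pi>\<^sub>a * n\<close> up
  to an exponentially small probability, by a Chernoff bound based on an approximate solution of the
  Poisson equation. As \<open>h\<close> is regularly varying of index \<open>\<alpha> - 1\<close>, each state contributes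
  \<open>\<pi>\<^sub>a * \<pi>\<^sub>a powr (\<alpha> - 1) * F(a, r) * h(n)\<close>. The same argument with \<open>h\<close> in place of \<open>\<phi>\<^sub>a\<close> gives
  the second limit.
\<close>

section \<open>Path laws\<close>

text \<open>Three obstacles shape the proof. First, \<open>h (real n)\<close> can be as small as
  order 1/n up to a slowly varying factor, so on bad paths a variance bound for the visit counts
  need not beat the factor 1/h(n); hence an exponential bound. Only a linear window is asked for, so
  an approximate solution of the Poisson equation is enough and plain convergence of the n-step
  probabilities suffices to build it. Third, the constant \<alpha> * Gamma(r + 1 - \<alpha>)
  produced by the counting function is 0 at \<alpha> = 0, and its integral diverges at \<alpha> = 1,
  r = 0. In the first case the mass of the small letters replaces the number of large ones; the
  second is obtained by integrating the case r = 1. The joint behaviour of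
  \<open>h (real m) / h (real n)\<close> is drawn from the fact that \<open>h\<close> is
  asymptotically a power times a decreasing Laplace transform.\<close>

text \<open>Paths and histories are listed with the most recent state first.\<close>

primrec path_pmf :: "'s pmf \<Rightarrow> ('s \<Rightarrow> 's pmf) \<Rightarrow> nat \<Rightarrow> 's list pmf" where
  "path_pmf i K 0 = map_pmf (\<lambda>z. [z]) i"
| "path_pmf i K (Suc n) = bind_pmf (path_pmf i K n) (\<lambda>zs. map_pmf (\<lambda>z. z # zs) (K (hd zs)))"

text \<open>The index counts transitions: the list has \<open>n + 1\<close> entries, its head being
  the state at time \<open>n + 1\<close> whose recurrence is examined and its tail the
  \<open>n\<close> states before it.\<close>

primrec history :: "(nat \<Rightarrow> 'w \<Rightarrow> 's) \<Rightarrow> nat \<Rightarrow> 'w \<Rightarrow> 's list" where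
  "history Z 0 \<omega> = [Z 1 \<omega>]"
| "history Z (Suc n) \<omega> = Z (n + 2) \<omega> # history Z n \<omega>"

lemma length_history [simp]: "length (history Z n \<omega>) = Suc n"
  by (induction n) auto

lemma rev_history: "rev (history Z n \<omega>) = map (\<lambda>i. Z i \<omega>) [1..<n + 2]"
  by (induction n) auto

lemma hd_history: "hd (history Z n \<omega>) = Z (Suc n) \<omega>"
  by (cases n) auto

lemma tl_history: "rev (tl (history Z n \<omega>)) = map (\<lambda>i. Z i \<omega>) [1..<Suc n]"
  by (cases n) (auto simp: rev_history)

text \<open>\<open>markov_chain\<close> conditions on events in which \<open>Z 1\<close>, ...,
  \<open>Z n\<close> take prescribed values; this turns such an event into a single value of
  \<open>history\<close>, so that the chain can be handled one list at a time.\<close>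

lemma history_eq_iff:
  "history Z n \<omega> = ys \<longleftrightarrow> length ys = Suc n \<and> (\<forall>i\<in>{1..Suc n}. Z i \<omega> = rev ys ! (i - 1))"
proof -
  have "history Z n \<omega> = ys \<longleftrightarrow> map (\<lambda>i. Z i \<omega>) [1..<n + 2] = rev ys"
    by (metis rev_history rev_rev_ident)
  also have "\<dots> \<longleftrightarrow> length ys = Suc n \<and> (\<forall>j<Suc n. Z (Suc j) \<omega> = rev ys ! j)"
  proof -
    have "map (\<lambda>i. Z i \<omega>) [1..<n + 2] = rev ys \<longleftrightarrow>
        length (map (\<lambda>i. Z i \<omega>) [1..<n + 2]) = length (rev ys) \<and>
        (\<forall>j<length (map (\<lambda>i. Z i \<omega>) [1..<n + 2]). map (\<lambda>i. Z i \<omega>) [1..<n + 2] ! j = rev ys ! j)"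
      by (rule list_eq_iff_nth_eq)
    thus ?thesis by (auto simp del: upt_Suc)
  qed
  also have "\<dots> \<longleftrightarrow> length ys = Suc n \<and> (\<forall>i\<in>{1..Suc n}. Z i \<omega> = rev ys ! (i - 1))"
  proof (intro conj_cong refl iffI ballI allI impI)
    fix i assume "\<forall>j<Suc n. Z (Suc j) \<omega> = rev ys ! j" "i \<in> {1..Suc n}"
    thus "Z i \<omega> = rev ys ! (i - 1)" by (cases i) auto
  next
    fix j assume "\<forall>i\<in>{1..Suc n}. Z i \<omega> = rev ys ! (i - 1)" "j < Suc n"
    thus "Z (Suc j) \<omega> = rev ys ! j" by (auto dest: bspec[of _ _ "Suc j"])
  qed
  finally show ?thesis .
qed

lemma previous_visits_history:
  "previous_visits Z n \<omega> = count_list (tl (history Z n \<omega>)) (hd (history Z n \<omega>))"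
proof -
  have "count_list (tl (history Z n \<omega>)) x = card {i\<in>{1..n}. Z i \<omega> = x}" for x
  proof -
    have "count_list (tl (history Z n \<omega>)) x = count_list (map (\<lambda>i. Z i \<omega>) [1..<Suc n]) x"
      by (simp only: tl_history[symmetric] count_list_rev)
    also have "\<dots> = length (filter (\<lambda>i. Z i \<omega> = x) [1..<Suc n])"
      by (simp add: count_list_eq_length_filter filter_map o_def eq_commute[of x] del: upt_Suc)
    also have "\<dots> = card (set (filter (\<lambda>i. Z i \<omega> = x) [1..<Suc n]))"
      by (subst distinct_card) auto
    also have "set (filter (\<lambda>i. Z i \<omega> = x) [1..<Suc n]) = {i\<in>{1..n}. Z i \<omega> = x}"
      by auto
    finally show ?thesis .
  qed
  thus ?thesis by (simp add: previous_visits_def hd_history)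
qed

text \<open>The tail of a path records where the last step came from, so only one term of the
  mixture contributes.\<close>

lemma pmf_path_Suc_Cons:
  "pmf (path_pmf i K (Suc n)) (z # zs) = pmf (path_pmf i K n) zs * pmf (K (hd zs)) z"
proof -
  have *: "pmf (map_pmf (\<lambda>z. z # ys) (K (hd ys))) (z # zs)
      = indicator {zs} ys * pmf (K (hd zs)) z" for ys
  proof (cases "ys = zs")
    case True
    have "pmf (map_pmf (\<lambda>z. z # zs) (K (hd zs))) ((\<lambda>z. z # zs) z) = pmf (K (hd zs)) z"
      by (rule pmf_map_inj') (auto simp: inj_def)
    thus ?thesis using True by simp
  next
    case False
    hence "z # zs \<notin> set_pmf (map_pmf (\<lambda>z. z # ys) (K (hd ys)))" by auto
    thus ?thesis using False by (simp add: pmf_eq_0_set_pmf)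
  qed
  show ?thesis by (simp add: pmf_bind * measure_pmf_single)
qed

lemma length_path_pmf: "zs \<in> set_pmf (path_pmf i K n) \<Longrightarrow> length zs = Suc n"
  by (induction n arbitrary: zs) auto

text \<open>Bridge from the given probability space to pmfs. The state space is countable, so the
  law of \<open>history Z n\<close> is determined by its point masses, and the Markov property
  yields these by induction on \<open>n\<close>.\<close>

lemma markov_chain_history:
  fixes Z :: "nat \<Rightarrow> 'w \<Rightarrow> 's::countable"
  assumes mc: "markov_chain M Z (pmf i) (\<lambda>z. pmf (K z))"
  shows "history Z n \<in> measurable M (count_space UNIV)"
    and "distr M (count_space UNIV) (history Z n) = measure_pmf (path_pmf i K n)"
proof -
  interpret prob_space M using mc by (simp add: markov_chain_def)
  have meas: "Z n \<in> measurable M (count_space UNIV)" if "n \<ge> 1" for n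
    using mc that by (simp add: markov_chain_def)
  have hmeas [measurable]: "history Z n \<in> measurable M (count_space UNIV)" for n
  proof (induction n)
    case 0
    thus ?case using measurable_compose[OF meas[of 1], of "\<lambda>z. [z]" "count_space UNIV"] by simp
  next
    case (Suc n)
    have [measurable]: "history Z n \<in> measurable M (count_space UNIV)" by fact
    have [measurable]: "Z (n+2) \<in> measurable M (count_space UNIV)" by (rule meas) simp
    have "(\<lambda>\<omega>. (Z (n+2) \<omega>, history Z n \<omega>)) \<in> measurable M (count_space UNIV \<Otimes>\<^sub>M count_space UNIV)"
      by measurable
    hence "(\<lambda>\<omega>. (Z (n+2) \<omega>, history Z n \<omega>)) \<in> measurable M (count_space UNIV)"
      by (simp add: pair_measure_countable)
    from measurable_compose[OF this, of "\<lambda>(z, zs). z # zs" "count_space UNIV"]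
    show ?case by simp
  qed
  show "history Z n \<in> measurable M (count_space UNIV)" by (rule hmeas)
  have single: "\<P>(\<omega> in M. history Z n \<omega> = zs) = pmf (path_pmf i K n) zs" for n zs
  proof (induction n arbitrary: zs)
    case 0
    have init: "\<P>(\<omega> in M. Z 1 \<omega> = z) = pmf i z" for z
      using mc by (simp add: markov_chain_def)
    show ?case
    proof (cases "length zs = 1")
      case True
      then obtain z where zs: "zs = [z]" by (auto simp: length_Suc_conv)
      have "pmf (map_pmf (\<lambda>z. [z]) i) ((\<lambda>z. [z]) z) = pmf i z"
        by (rule pmf_map_inj') (auto simp: inj_def)
      thus ?thesis using init[of z] by (simp add: zs)
    next
      case False
      hence "zs \<notin> set_pmf (path_pmf i K 0)" using length_path_pmf[of zs i K 0] by auto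
      moreover have "{\<omega>\<in>space M. history Z 0 \<omega> = zs} = {}" using False by auto
      ultimately show ?thesis by (metis measure_empty pmf_eq_0_set_pmf)
    qed
  next
    case (Suc n)
    show ?case
    proof (cases zs)
      case Nil
      hence "zs \<notin> set_pmf (path_pmf i K (Suc n))" using length_path_pmf[of zs i K "Suc n"] by auto
      moreover have "{\<omega>\<in>space M. history Z (Suc n) \<omega> = zs} = {}" using Nil by auto
      ultimately show ?thesis by (metis measure_empty pmf_eq_0_set_pmf)
    next
      case (Cons z ys)
      have [measurable]: "Z (n+2) \<in> measurable M (count_space UNIV)" by (rule meas) simp
      \<comment> \<open>The Markov property is silent on a history of probability zero; there both
        sides vanish.\<close>
      show ?thesis
      proof (cases "\<P>(\<omega> in M. history Z n \<omega> = ys) = 0")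
        case True
        have "\<P>(\<omega> in M. history Z (Suc n) \<omega> = zs) \<le> \<P>(\<omega> in M. history Z n \<omega> = ys)"
          by (rule finite_measure_mono) (auto simp: Cons)
        hence "\<P>(\<omega> in M. history Z (Suc n) \<omega> = zs) = 0"
          using True measure_nonneg[of M] by (metis order_antisym)
        moreover have "pmf (path_pmf i K n) ys = 0" using True Suc.IH by simp
        ultimately show ?thesis unfolding Cons by (simp only: pmf_path_Suc_Cons mult_zero_left)
      next
        case False
        hence pos: "\<P>(\<omega> in M. history Z n \<omega> = ys) > 0"
          using measure_nonneg[of M] by (metis order_less_le)
        have len: "length ys = Suc n"
        proof (rule ccontr)
          assume "length ys \<noteq> Suc n"
          hence "{\<omega>\<in>space M. history Z n \<omega> = ys} = {}" by auto
          thus False using False by (metis measure_empty)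
        qed
        \<comment> \<open>The Markov property speaks of functions of a time index starting at 1,
          hence the reversal and the shift.\<close>
        define \<zeta> where "\<zeta> i = rev (z # ys) ! (i - 1)" for i
        have ev: "(\<forall>i\<in>{1..Suc n}. Z i \<omega> = \<zeta> i) \<longleftrightarrow> history Z n \<omega> = ys" for \<omega>
          unfolding history_eq_iff using len by (auto simp: \<zeta>_def nth_append)
        have \<zeta>1: "\<zeta> (Suc n + 1) = z" using len by (simp add: \<zeta>_def nth_append)
        have "\<zeta> (Suc n) = rev ys ! n" using len by (simp add: \<zeta>_def nth_append)
        also have "\<dots> = hd ys" using len by (cases ys) (auto simp: nth_append)
        finally have \<zeta>2: "\<zeta> (Suc n) = hd ys" .
        have "\<P>(\<omega> in M. Z (Suc n + 1) \<omega> = \<zeta> (Suc n + 1) \<bar> \<forall>i\<in>{1..Suc n}. Z i \<omega> = \<zeta> i)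
            = pmf (K (\<zeta> (Suc n))) (\<zeta> (Suc n + 1))"
        proof -
          have "\<forall>n\<ge>1. \<forall>z. \<P>(\<omega> in M. \<forall>i\<in>{1..n}. Z i \<omega> = z i) > 0 \<longrightarrow>
              \<P>(\<omega> in M. Z (n + 1) \<omega> = z (n + 1) \<bar> \<forall>i\<in>{1..n}. Z i \<omega> = z i) = pmf (K (z n)) (z (n + 1))"
            using mc unfolding markov_chain_def by blast
          from this[rule_format, of "Suc n" \<zeta>] show ?thesis using pos unfolding ev by simp
        qed
        hence "\<P>(\<omega> in M. Z (n + 2) \<omega> = z \<and> history Z n \<omega> = ys)
            = pmf (K (hd ys)) z * \<P>(\<omega> in M. history Z n \<omega> = ys)"
          unfolding ev \<zeta>1 \<zeta>2 cond_prob_def using False by (simp add: field_simps)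
        thus ?thesis unfolding Cons pmf_path_Suc_Cons Suc.IH[symmetric] by simp
      qed
    qed
  qed
  show "distr M (count_space UNIV) (history Z n) = measure_pmf (path_pmf i K n)"
  proof (rule measure_eqI_countable)
    fix zs :: "'s list"
    have "history Z n -` {zs} \<inter> space M = {\<omega>\<in>space M. history Z n \<omega> = zs}" by auto
    thus "emeasure (distr M (count_space UNIV) (history Z n)) {zs} = emeasure (measure_pmf (path_pmf i K n)) {zs}"
      using single[of n zs]
      by (simp add: emeasure_distr emeasure_eq_measure emeasure_pmf_single)
  qed auto
qed

section \<open>Letters given the regimes\<close>

text \<open>The transition law reads only the regime of the previous state; this is what lets the
  regimes be generated without the letters.\<close>

definition switching_kernel :: "('a \<Rightarrow> 'a pmf) \<Rightarrow> ('a \<Rightarrow> 'b pmf) \<Rightarrow> 'a \<times> 'b \<Rightarrow> ('a \<times> 'b) pmf" where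
  "switching_kernel Q p z = bind_pmf (Q (fst z)) (\<lambda>a. map_pmf (Pair a) (p a))"

primrec letters_pmf :: "('a \<Rightarrow> 'b pmf) \<Rightarrow> 'a list \<Rightarrow> ('a \<times> 'b) list pmf" where
  "letters_pmf p [] = return_pmf []"
| "letters_pmf p (x # xs) = bind_pmf (letters_pmf p xs) (\<lambda>zs. map_pmf (\<lambda>k. (x, k) # zs) (p x))"

lemma map_fst_letters_pmf: "zs \<in> set_pmf (letters_pmf p xs) \<Longrightarrow> map fst zs = xs"
  by (induction xs arbitrary: zs) auto

lemma pmf_bind_Pair: "pmf (bind_pmf q (\<lambda>a. map_pmf (Pair a) (p a))) (a, k) = pmf q a * pmf (p a) k"
proof -
  have *: "pmf (map_pmf (Pair b) (p b)) (a, k) = indicator {a} b * pmf (p a) k" for b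
  proof (cases "b = a")
    case True
    have "pmf (map_pmf (Pair a) (p a)) (Pair a k) = pmf (p a) k"
      by (rule pmf_map_inj') (auto simp: inj_def)
    thus ?thesis using True by simp
  next
    case False
    hence "(a, k) \<notin> set_pmf (map_pmf (Pair b) (p b))" by auto
    thus ?thesis using False by (simp add: pmf_eq_0_set_pmf)
  qed
  show ?thesis by (simp add: pmf_bind * measure_pmf_single)
qed

text \<open>In the inductive step the kernel looks only at the regime \<open>hd xs\<close>, so
  drawing the next regime commutes with drawing the earlier letters; all letters can therefore be
  attached after the whole regime path is known.\<close>

lemma path_pmf_switching:
  "path_pmf (bind_pmf q (\<lambda>a. map_pmf (Pair a) (p a))) (switching_kernel Q p) n
     = bind_pmf (path_pmf q Q n) (letters_pmf p)"
proof (induction n)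
  case 0
  show ?case by (simp add: map_bind_pmf bind_map_pmf bind_return_pmf pmf.map_comp o_def)
next
  case (Suc n)
  have "path_pmf (bind_pmf q (\<lambda>a. map_pmf (Pair a) (p a))) (switching_kernel Q p) (Suc n)
      = path_pmf q Q n \<bind> (\<lambda>xs. letters_pmf p xs \<bind>
          (\<lambda>zs. map_pmf (\<lambda>z. z # zs) (switching_kernel Q p (hd zs))))"
    by (simp add: Suc.IH bind_assoc_pmf)
  also have "\<dots> = path_pmf q Q n \<bind> (\<lambda>xs. letters_pmf p xs \<bind>
          (\<lambda>zs. Q (hd xs) \<bind> (\<lambda>a. map_pmf (\<lambda>k. (a, k) # zs) (p a))))"
  proof (intro bind_pmf_cong refl)
    fix xs zs assume xs: "xs \<in> set_pmf (path_pmf q Q n)" and zs: "zs \<in> set_pmf (letters_pmf p xs)"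
    have "zs \<noteq> []" using length_path_pmf[OF xs] map_fst_letters_pmf[OF zs] by auto
    hence "fst (hd zs) = hd xs" using map_fst_letters_pmf[OF zs] hd_map[of zs fst] by simp
    thus "map_pmf (\<lambda>z. z # zs) (switching_kernel Q p (hd zs))
        = Q (hd xs) \<bind> (\<lambda>a. map_pmf (\<lambda>k. (a, k) # zs) (p a))"
      by (simp add: switching_kernel_def map_bind_pmf pmf.map_comp o_def)
  qed
  also have "\<dots> = path_pmf q Q n \<bind> (\<lambda>xs. Q (hd xs) \<bind> (\<lambda>a. letters_pmf p xs \<bind>
          (\<lambda>zs. map_pmf (\<lambda>k. (a, k) # zs) (p a))))"
    by (subst bind_commute_pmf) rule
  also have "\<dots> = path_pmf q Q (Suc n) \<bind> letters_pmf p"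
    by (simp add: bind_assoc_pmf bind_map_pmf)
  finally show ?case .
qed

lemma map_eq_bernoulli: "map_pmf (\<lambda>x. x = k) q = bernoulli_pmf (pmf q k)"
proof (rule pmf_eqI)
  fix b
  have "pmf (map_pmf (\<lambda>x. x = k) q) True = pmf q k"
    by (simp add: pmf_map vimage_def measure_pmf_single)
  moreover have "pmf (map_pmf (\<lambda>x. x = k) q) False = 1 - pmf q k"
    using measure_pmf.prob_compl[of "{k}" q]
    by (simp add: pmf_map vimage_def measure_pmf_single Compl_eq_Diff_UNIV[symmetric] Compl_eq)
  ultimately show "pmf (map_pmf (\<lambda>x. x = k) q) b = pmf (bernoulli_pmf (pmf q k)) b"
    by (cases b) (auto simp: pmf_le_1)
qed

text \<open>Only positions with regime \<open>a\<close> can carry the letter \<open>(a, k)\<close>,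
  and each of them is an independent Bernoulli trial.\<close>

lemma count_letters_binomial:
  "map_pmf (\<lambda>zs. count_list zs (a, k)) (letters_pmf p xs)
     = binomial_pmf (count_list xs a) (pmf (p a) k)"
proof (induction xs)
  case Nil
  thus ?case by (simp add: binomial_pmf_0 pmf_le_1)
next
  case (Cons x xs)
  show ?case
  proof (cases "x = a")
    case True
    have "map_pmf (\<lambda>zs. count_list zs (a, k)) (letters_pmf p (x # xs))
       = letters_pmf p xs \<bind> (\<lambda>zs. p a \<bind> (\<lambda>k'. return_pmf (of_bool (k' = k) + count_list zs (a, k))))"
      by (simp add: True map_bind_pmf pmf.map_comp o_def map_pmf_def[symmetric])
         (auto intro!: bind_pmf_cong pmf.map_cong simp: map_pmf_def[symmetric])
    also have "\<dots> = p a \<bind> (\<lambda>k'. letters_pmf p xs \<bind> (\<lambda>zs. return_pmf (of_bool (k' = k) + count_list zs (a, k))))"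
      by (rule bind_commute_pmf)
    also have "\<dots> = map_pmf (\<lambda>k'. k' = k) (p a) \<bind> (\<lambda>b. map_pmf (\<lambda>zs. count_list zs (a, k)) (letters_pmf p xs) \<bind> (\<lambda>j. return_pmf (of_bool b + j)))"
      by (simp add: bind_map_pmf)
    also have "\<dots> = binomial_pmf (Suc (count_list xs a)) (pmf (p a) k)"
      by (simp add: Cons map_eq_bernoulli binomial_pmf_Suc pmf_le_1 of_bool_def)
    finally show ?thesis using True by simp
  next
    case False
    thus ?thesis using Cons
      by (simp add: map_bind_pmf pmf.map_comp o_def map_pmf_const bind_return_pmf map_pmf_def[symmetric])
  qed
qed

section \<open>Finite Markov chains\<close>

lemma expectation_path_pmf_Suc:
  fixes K :: "'s::finite \<Rightarrow> 's pmf" and F :: "'s list \<Rightarrow> real"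
  shows "measure_pmf.expectation (path_pmf i K (Suc n)) F
    = measure_pmf.expectation (path_pmf i K n) (\<lambda>xs. \<Sum>b\<in>UNIV. pmf (K (hd xs)) b * F (b # xs))"
proof -
  have fin: "finite (set_pmf (path_pmf i K n))" by (induction n) auto
  have E: "measure_pmf.expectation (map_pmf (\<lambda>z. z # xs) (K (hd xs))) F
      = (\<Sum>b\<in>UNIV. pmf (K (hd xs)) b * F (b # xs))" for xs
    by (simp add: integral_measure_pmf_real[of UNIV] mult.commute)
  have "measure_pmf.expectation (path_pmf i K (Suc n)) F
    = (\<Sum>xs\<in>set_pmf (path_pmf i K n). pmf (path_pmf i K n) xs *\<^sub>R
        measure_pmf.expectation (map_pmf (\<lambda>z. z # xs) (K (hd xs))) F)"
    unfolding path_pmf.simps by (rule pmf_expectation_bind) (use fin in auto)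
  also have "\<dots> = measure_pmf.expectation (path_pmf i K n) (\<lambda>xs. \<Sum>b\<in>UNIV. pmf (K (hd xs)) b * F (b # xs))"
    unfolding E by (subst integral_measure_pmf_real[OF fin]) (auto simp: mult.commute)
  finally show ?thesis .
qed

lemma finite_set_path_pmf:
  fixes K :: "'s::finite \<Rightarrow> 's pmf"
  shows "finite (set_pmf (path_pmf i K n))"
  by (induction n) auto

lemma n_step_nonneg [simp]: "n_step Q n a b \<ge> 0"
  by (induction n arbitrary: a) (auto intro!: sum_nonneg)

lemma sum_pmf_UNIV [simp]: "(\<Sum>b\<in>UNIV. pmf (q :: 'a::finite pmf) b) = 1"
  by (rule sum_pmf_eq_1) auto

lemma sum_n_step: "(\<Sum>b\<in>UNIV. n_step Q n a b) = 1"
proof (induction n arbitrary: a)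
  case 0
  show ?case by (simp add: of_bool_def)
next
  case (Suc n)
  have "(\<Sum>b\<in>UNIV. n_step Q (Suc n) a b) = (\<Sum>c\<in>UNIV. pmf (Q a) c * (\<Sum>b\<in>UNIV. n_step Q n c b))"
    by (simp add: sum_distrib_left) (rule sum.swap)
  thus ?case by (simp add: Suc)
qed

lemma n_step_add: "n_step Q (m + n) a b = (\<Sum>c\<in>UNIV. n_step Q m a c * n_step Q n c b)"
proof (induction m arbitrary: a)
  case 0
  show ?case by (simp add: of_bool_def if_distrib[of "\<lambda>x. x * _"] cong: if_cong)
next
  case (Suc m)
  have "n_step Q (Suc m + n) a b = (\<Sum>d\<in>UNIV. \<Sum>c\<in>UNIV. pmf (Q a) d * (n_step Q m d c * n_step Q n c b))"
    by (simp add: Suc sum_distrib_left)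
  also have "\<dots> = (\<Sum>c\<in>UNIV. \<Sum>d\<in>UNIV. pmf (Q a) d * (n_step Q m d c * n_step Q n c b))"
    by (rule sum.swap)
  also have "\<dots> = (\<Sum>c\<in>UNIV. n_step Q (Suc m) a c * n_step Q n c b)"
    by (simp add: sum_distrib_right mult.assoc)
  finally show ?case .
qed

lemma n_step_1: "n_step Q 1 a b = pmf (Q a) b"
  by (simp add: of_bool_def if_distrib[of "\<lambda>x. _ * x"] cong: if_cong)

lemma n_step_Suc_right: "n_step Q (Suc n) a b = (\<Sum>c\<in>UNIV. n_step Q n a c * pmf (Q c) b)"
  using n_step_add[of Q n 1 a b] unfolding n_step_1 by simp

lemma n_step_pos_trans: "n_step Q m a c > 0 \<Longrightarrow> n_step Q n c b > 0 \<Longrightarrow> n_step Q (m + n) a b > 0"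
  unfolding n_step_add by (rule sum_pos2[of _ c]) auto

lemma expectation_path_pmf_hd:
  fixes K :: "'s::finite \<Rightarrow> 's pmf" and w :: "'s \<Rightarrow> real"
  shows "measure_pmf.expectation (path_pmf i K n) (\<lambda>xs. w (hd xs))
     = (\<Sum>a\<in>UNIV. pmf i a * (\<Sum>b\<in>UNIV. n_step K n a b * w b))"
proof (induction n arbitrary: w)
  case 0
  show ?case
    by (simp add: integral_measure_pmf_real[of UNIV] of_bool_def if_distrib[of "\<lambda>x. x * _"]
        mult.commute[of "w _"] cong: if_cong)
next
  case (Suc n)
  have *: "(\<Sum>b\<in>UNIV. n_step K n a b * (\<Sum>c\<in>UNIV. pmf (K b) c * w c)) = (\<Sum>c\<in>UNIV. n_step K (Suc n) a c * w c)" for a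
    unfolding n_step_Suc_right sum_distrib_left sum_distrib_right mult.assoc by (rule sum.swap)
  thus ?case by (simp only: expectation_path_pmf_Suc list.sel Suc.IH[of "\<lambda>b. \<Sum>c\<in>UNIV. pmf (K b) c * w c"] *)
qed

section \<open>Convergence of finite chains to stationarity\<close>

text \<open>
  The least positive difference of two elements of the semigroup divides all its elements,
  hence it is 1; so the semigroup contains two consecutive numbers.
\<close>

lemma eventually_mem_add_closed:
  fixes S :: "nat set"
  assumes add: "\<And>m n. m \<in> S \<Longrightarrow> n \<in> S \<Longrightarrow> m + n \<in> S" and gcd: "Gcd S = 1"
  shows "eventually (\<lambda>n. n \<in> S) sequentially"
proof -
  \<comment> \<open>Adjoining 0 allows zero multiples, and lets an element of \<open>S\<close> count
    as its own difference from 0.\<close>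
  define T where "T = insert 0 S"
  have addT: "m + n \<in> T" if "m \<in> T" "n \<in> T" for m n using that add by (auto simp: T_def)
  have mulT: "k * n \<in> T" if "n \<in> T" for k n
    by (induction k) (use that addT in \<open>auto simp: T_def\<close>)
  obtain s where s: "s \<in> S" "s > 0"
    using gcd by (metis Gcd_0_iff gr_zeroI singletonI subsetI zero_neq_one)
  define P where "P d \<longleftrightarrow> d > 0 \<and> (\<exists>x\<in>T. x + d \<in> T)" for d
  define d where "d = (LEAST d. P d)"
  have "P s" using s by (auto simp: P_def T_def intro: bexI[of _ 0])
  hence Pd: "P d" unfolding d_def by (rule LeastI)
  have dmin: "d \<le> e" if "P e" for e unfolding d_def using that by (rule Least_le)
  obtain x where x: "x \<in> T" "x + d \<in> T" and d: "d > 0" using Pd by (auto simp: P_def)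
  have "d dvd t" if t: "t \<in> S" for t
  proof (rule ccontr)
    assume "\<not> d dvd t"
    hence r: "t mod d > 0" by (simp add: dvd_eq_mod_eq_0)
    define k where "k = t div d"
    have "k * (x + d) \<in> T" using x mulT by blast
    moreover have "k * x + t \<in> T" by (rule addT[OF mulT[OF x(1)]]) (use t in \<open>simp add: T_def\<close>)
    moreover have "k * (x + d) + t mod d = k * x + t" by (simp add: k_def algebra_simps)
    ultimately have "P (t mod d)" unfolding P_def using r by metis
    thus False using dmin[of "t mod d"] d mod_less_divisor[of d t] by linarith
  qed
  hence "d dvd Gcd S" by (rule Gcd_greatest)
  hence d1: "d = 1" using gcd by simp
  \<comment> \<open>For such \<open>n\<close> the quotient \<open>a\<close> of \<open>n\<close> by
    \<open>x\<close> is at least \<open>x\<close>, hence exceeds the remainder \<open>b\<close>, and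
    \<open>n\<close> consists of \<open>a - b\<close> copies of \<open>x\<close> and
    \<open>b\<close> copies of \<open>x + 1\<close>. The extra 1 keeps \<open>n\<close> away from
    the adjoined 0.\<close>
  have "n \<in> S" if n: "n \<ge> x * x + 1" for n
  proof -
    have "n \<in> T"
    proof (cases "x = 0")
      case True
      thus ?thesis using mulT[OF x(2), of n] d1 by simp
    next
      case False
      define a b where "a = n div x" and "b = n mod x"
      have "a \<ge> x" unfolding a_def using n False
        by (metis div_le_mono div_mult_self1_is_m le_add1 le_trans neq0_conv)
      moreover have "b < x" using False by (simp add: b_def)
      ultimately have "b \<le> a" by simp
      then obtain e where e: "a = b + e" using le_Suc_ex by blast
      have "n = a * x + b" using div_mult_mod_eq[of n x] by (simp add: a_def b_def)
      hence "n = (a - b) * x + b * (x + 1)" by (simp add: e algebra_simps)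
      thus ?thesis using addT[OF mulT[OF x(1)] mulT[OF x(2)], of "a - b" b] d1 by simp
    qed
    thus ?thesis using n by (auto simp: T_def)
  qed
  thus ?thesis unfolding eventually_sequentially by blast
qed

text \<open>The positive return times to \<open>a\<close> form an additive semigroup of gcd 1, hence
  contain all large numbers; a fixed route from \<open>a\<close> to \<open>b\<close> is then
  appended. Finiteness of the state space makes the threshold uniform.\<close>

lemma primitive_chain:
  assumes irr: "irreducible_chain Q" and aper: "aperiodic_chain Q"
  shows "\<exists>N. \<forall>a b. n_step Q N a b > 0"
proof -
  have "eventually (\<lambda>n. n_step Q n a b > 0) sequentially" for a b
  proof -
    obtain k where k: "n_step Q k a b > 0" using irr by (auto simp: irreducible_chain_def)
    have "eventually (\<lambda>n. n \<in> {n. n \<ge> 1 \<and> n_step Q n a a > 0}) sequentially"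
      by (rule eventually_mem_add_closed)
         (use aper n_step_pos_trans in \<open>auto simp: aperiodic_chain_def\<close>)
    hence "eventually (\<lambda>n. n - k \<in> {n. n \<ge> 1 \<and> n_step Q n a a > 0}) sequentially"
      by (rule eventually_compose_filterlim) (rule filterlim_minus_const_nat_at_top)
    thus ?thesis using eventually_ge_at_top[of k]
      by eventually_elim (use n_step_pos_trans[of Q _ a a k b] k in force)
  qed
  hence "eventually (\<lambda>n. \<forall>a b. n_step Q n a b > 0) sequentially"
    by (simp add: eventually_all_finite)
  thus ?thesis by (auto simp: eventually_sequentially)
qed

lemma stationary_n_step:
  assumes stat: "stationary_distribution Q \<pi>"
  shows "pmf \<pi> a = (\<Sum>x\<in>UNIV. pmf \<pi> x * n_step Q n x a)"
proof (induction n)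
  case 0
  show ?case by (simp add: of_bool_def if_distrib[of "\<lambda>x. _ * x"] cong: if_cong)
next
  case (Suc n)
  have "(\<Sum>x\<in>UNIV. pmf \<pi> x * n_step Q (Suc n) x a) = (\<Sum>y\<in>UNIV. (\<Sum>x\<in>UNIV. pmf \<pi> x * pmf (Q x) y) * n_step Q n y a)"
    unfolding n_step.simps sum_distrib_left sum_distrib_right mult.assoc by (rule sum.swap)
  thus ?case using stat Suc by (simp add: stationary_distribution_def)
qed

text \<open>
  All rows of the \<open>n\<close>-step matrix stay in a common interval, and each block of \<open>N\<close> steps
  shrinks it by the factor \<open>1 - c\<close>.
\<close>

lemma n_step_tendsto_stationary:
  assumes irr: "irreducible_chain Q" and aper: "aperiodic_chain Q"
    and stat: "stationary_distribution Q \<pi>"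
  shows "(\<lambda>n. n_step Q n x a) \<longlonglongrightarrow> pmf \<pi> a"
proof -
  obtain N where N: "\<And>a b. n_step Q N a b > 0" using primitive_chain[OF irr aper] by blast
  define c where "c = Min (range (\<lambda>(a, b). n_step Q N a b))"
  have c: "c > 0" unfolding c_def by (subst Min_gr_iff) (use N in auto)
  have cle: "c \<le> n_step Q N a b" for a b unfolding c_def by (rule Min_le) auto
  have c1: "c \<le> 1"
    using cle[of undefined undefined] sum_n_step[of Q N undefined]
      member_le_sum[of undefined UNIV "n_step Q N undefined"] by simp
  have avg: "lo \<le> n_step Q (m + n) x a \<and> n_step Q (m + n) x a \<le> hi"
    if "\<forall>x. lo \<le> n_step Q n x a \<and> n_step Q n x a \<le> hi" for lo hi m n x
  proof -
    have "(\<Sum>y\<in>UNIV. n_step Q m x y * lo) \<le> n_step Q (m + n) x a"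
      unfolding n_step_add by (intro sum_mono mult_left_mono) (use that in auto)
    moreover have "n_step Q (m + n) x a \<le> (\<Sum>y\<in>UNIV. n_step Q m x y * hi)"
      unfolding n_step_add by (intro sum_mono mult_left_mono) (use that in auto)
    ultimately show ?thesis by (simp add: sum_distrib_right[symmetric] sum_n_step)
  qed
  have ival: "\<exists>lo hi. hi - lo = (1 - c) ^ k \<and> (\<forall>x. lo \<le> n_step Q (k * N) x a \<and> n_step Q (k * N) x a \<le> hi)" for k
  proof (induction k)
    case 0
    show ?case by (intro exI[of _ 0] exI[of _ 1]) auto
  next
    case (Suc k)
    then obtain lo hi where lh: "hi - lo = (1 - c) ^ k"
      "\<And>x. lo \<le> n_step Q (k * N) x a" "\<And>x. n_step Q (k * N) x a \<le> hi" by auto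
    define f where "f x = n_step Q (k * N) x a" for x
    \<comment> \<open>Doeblin's decomposition: every row of the \<open>N\<close>-step matrix has
      mass at least \<open>c\<close> at the arbitrary state \<open>y0\<close>. This common part
      contributes the same \<open>c * f y0\<close> to all rows, and only the remaining mass
      \<open>1 - c\<close> can spread them.\<close>
    define y0 :: 'a where "y0 = undefined"
    have split: "n_step Q (N + k * N) x a = (\<Sum>y\<in>UNIV. (n_step Q N x y - c * of_bool (y = y0)) * f y) + c * f y0" for x
      unfolding n_step_add f_def[symmetric]
      by (simp add: left_diff_distrib sum_subtractf of_bool_def if_distrib[of "\<lambda>x. _ * x"] if_distrib[of "\<lambda>x. x * _"] cong: if_cong)
    have tot: "(\<Sum>y\<in>UNIV. (n_step Q N x y - c * of_bool (y = y0)) * s) = (1 - c) * s" for x s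
      by (simp add: sum_distrib_right[symmetric] sum_subtractf sum_n_step of_bool_def if_distrib[of "\<lambda>x. _ * x"] cong: if_cong)
    have w: "0 \<le> n_step Q N x y - c * of_bool (y = y0)" for x y
      using cle[of x y] by (auto simp: of_bool_def)
    have "(\<Sum>y\<in>UNIV. (n_step Q N x y - c * of_bool (y = y0)) * lo) \<le> (\<Sum>y\<in>UNIV. (n_step Q N x y - c * of_bool (y = y0)) * f y)"
      "(\<Sum>y\<in>UNIV. (n_step Q N x y - c * of_bool (y = y0)) * f y) \<le> (\<Sum>y\<in>UNIV. (n_step Q N x y - c * of_bool (y = y0)) * hi)" for x
      by (intro sum_mono mult_left_mono w; simp add: f_def lh)+
    hence "(1 - c) * lo + c * f y0 \<le> n_step Q (N + k * N) x a \<and> n_step Q (N + k * N) x a \<le> (1 - c) * hi + c * f y0" for x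
      unfolding split tot by simp
    moreover have "((1 - c) * hi + c * f y0) - ((1 - c) * lo + c * f y0) = (1 - c) ^ Suc k"
      using lh(1)[symmetric] by (simp add: right_diff_distrib[symmetric])
    ultimately show ?case by (metis mult_Suc)
  qed
  have pin: "pmf \<pi> a = (\<Sum>x\<in>UNIV. pmf \<pi> x * n_step Q n x a)" for n
    by (rule stationary_n_step[OF stat])
  \<comment> \<open>\<open>pmf \<pi> a\<close> is an average of the rows, so it lies in the same
    interval and differs from each row by at most the length.\<close>
  have close: "\<bar>n_step Q n x a - pmf \<pi> a\<bar> \<le> (1 - c) ^ k" if "n \<ge> k * N" for n k x
  proof -
    obtain lo hi where lh: "hi - lo = (1 - c) ^ k"
      "\<forall>x. lo \<le> n_step Q (k * N) x a \<and> n_step Q (k * N) x a \<le> hi" using ival by blast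
    have b: "lo \<le> n_step Q n y a \<and> n_step Q n y a \<le> hi" for y
      using avg[OF lh(2), of "n - k * N" y] that by simp
    have "(\<Sum>x\<in>UNIV. pmf \<pi> x * lo) \<le> pmf \<pi> a"
      unfolding pin[of n] by (intro sum_mono mult_left_mono) (use b in auto)
    moreover have "pmf \<pi> a \<le> (\<Sum>x\<in>UNIV. pmf \<pi> x * hi)"
      unfolding pin[of n] by (intro sum_mono mult_left_mono) (use b in auto)
    ultimately show ?thesis using b[of x] lh(1)
      by (simp add: sum_distrib_right[symmetric] abs_le_iff)
  qed
  show ?thesis
  proof (rule LIMSEQ_I)
    fix e :: real assume "e > 0"
    obtain k where k: "(1 - c) ^ k < e" using \<open>e > 0\<close> c c1 real_arch_pow_inv[of e "1 - c"] by auto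
    have "norm (n_step Q n x a - pmf \<pi> a) < e" if "n \<ge> k * N" for n
      using close[OF that, of x] k by simp
    thus "\<exists>no. \<forall>n\<ge>no. norm (n_step Q n x a - pmf \<pi> a) < e" by blast
  qed
qed

lemma stationary_pos:
  assumes irr: "irreducible_chain Q" and aper: "aperiodic_chain Q"
    and stat: "stationary_distribution Q \<pi>"
  shows "pmf \<pi> a > 0"
proof -
  obtain N where N: "\<And>a b. n_step Q N a b > 0" using primitive_chain[OF irr aper] by blast
  obtain x where x: "pmf \<pi> x > 0" using set_pmf_not_empty[of \<pi>] by (auto simp: pmf_positive_iff[symmetric])
  show ?thesis unfolding stationary_n_step[OF stat, of a N]
    by (rule sum_pos2[of _ x]) (use x N in auto)
qed

section \<open>Exponential deviation bounds for visit counts\<close>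

lemma exp_le_quadratic:
  fixes t :: real assumes "\<bar>t\<bar> \<le> 1" shows "exp t \<le> 1 + t + t\<^sup>2"
proof (cases "t \<ge> 0")
  case True
  thus ?thesis using assms by (intro exp_bound) auto
next
  case False
  have "1 + (-t) \<le> exp (-t)" by (rule exp_ge_add_one_self)
  hence "exp t * (1 - t) \<le> exp t * exp (-t)" by (intro mult_left_mono) auto
  also have "\<dots> = 1" by (simp add: exp_minus)
  \<comment> \<open>The product on the right is \<open>1 - t ^ 3\<close>, which is at least 1 for
    negative \<open>t\<close>.\<close>
  also have "\<dots> \<le> (1 + t + t\<^sup>2) * (1 - t)"
  proof -
    have "t ^ 3 \<le> 0" using False by (simp add: power_le_zero_eq)
    thus ?thesis by (simp add: algebra_simps power2_eq_square power3_eq_cube)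
  qed
  finally show ?thesis using False by simp
qed

text \<open>
  If \<open>f\<close> solves the Poisson equation \<open>f = g - Qg\<close> up to \<open>e\<close>, the exponential weight
  \<open>exp (\<theta> * g)\<close> turns the sum of \<open>f\<close> along the path into a near-supermartingale.
\<close>

lemma path_pmf_exponential_bound:
  fixes Q :: "'a::finite \<Rightarrow> 'a pmf" and f g :: "'a \<Rightarrow> real"
  assumes \<theta>: "0 \<le> \<theta>" "2 * B * \<theta> \<le> 1" and B: "\<And>x. \<bar>g x\<bar> \<le> B"
    and poisson: "\<And>x. f x + (\<Sum>b\<in>UNIV. pmf (Q x) b * g b) \<le> g x + e"
  shows "measure_pmf.expectation (path_pmf i Q n)
           (\<lambda>xs. exp (\<theta> * (sum_list (map f (tl xs)) + g (hd xs))))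
         \<le> exp (\<theta> * B) * exp (real n * (4 * B\<^sup>2 * \<theta>\<^sup>2 + \<theta> * e))"
proof (induction n)
  case 0
  have "(\<Sum>x\<in>UNIV. pmf i x * exp (\<theta> * g x)) \<le> (\<Sum>x\<in>UNIV. pmf i x * exp (\<theta> * B))"
    using B \<theta> by (intro sum_mono mult_left_mono) (auto simp: abs_le_iff intro!: mult_left_mono)
  thus ?case
    by (simp add: integral_measure_pmf_real[of UNIV] sum_distrib_right[symmetric] mult.commute[of "exp _"])
next
  case (Suc n)
  define P where "P = path_pmf i Q n"
  define \<rho> where "\<rho> = 4 * B\<^sup>2 * \<theta>\<^sup>2 + \<theta> * e"
  have fin: "finite (set_pmf P)" unfolding P_def by (rule finite_set_path_pmf)
  have B0: "B \<ge> 0" using B[of undefined] by linarith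
  have step: "exp (\<theta> * f x) * (\<Sum>b\<in>UNIV. pmf (Q x) b * exp (\<theta> * g b)) \<le> exp (\<theta> * g x) * exp \<rho>" for x
  proof -
    define G where "G = (\<Sum>b\<in>UNIV. pmf (Q x) b * g b)"
    have "\<bar>G\<bar> \<le> (\<Sum>b\<in>UNIV. pmf (Q x) b * B)"
      unfolding G_def by (rule order_trans[OF sum_abs]) (auto simp: abs_mult intro!: sum_mono mult_left_mono B)
    hence G: "\<bar>G\<bar> \<le> B" by (simp add: sum_distrib_right[symmetric])
    \<comment> \<open>Centred at its mean \<open>G\<close>, \<open>g\<close> moves by at most
      \<open>2 * B\<close>, so \<open>2 * B * \<theta> \<le> 1\<close> keeps the exponent within
      reach of the quadratic bound; the linear term averages to 0 and leaves
      \<open>(\<theta> * (2 * B))\<^sup>2\<close>.\<close>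
    have tb: "\<bar>\<theta> * (g b - G)\<bar> \<le> \<theta> * (2 * B)" for b
    proof -
      have "\<bar>g b - G\<bar> \<le> 2 * B" using B[of b] G by linarith
      thus ?thesis using \<theta> by (simp add: abs_mult mult_left_mono)
    qed
    have "(\<Sum>b\<in>UNIV. pmf (Q x) b * exp (\<theta> * (g b - G)))
        \<le> (\<Sum>b\<in>UNIV. pmf (Q x) b * (1 + \<theta> * (g b - G) + (\<theta> * (2 * B))\<^sup>2))"
    proof (intro sum_mono mult_left_mono)
      fix b
      have "\<bar>\<theta> * (g b - G)\<bar> \<le> 1" using tb[of b] \<theta> by (simp add: mult.commute mult.left_commute)
      hence "exp (\<theta> * (g b - G)) \<le> 1 + \<theta> * (g b - G) + (\<theta> * (g b - G))\<^sup>2" by (rule exp_le_quadratic)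
      also have "(\<theta> * (g b - G))\<^sup>2 \<le> (\<theta> * (2 * B))\<^sup>2" using tb[of b] B0 \<theta>
        by (intro power2_le_iff_abs_le[THEN iffD2]) auto
      finally show "exp (\<theta> * (g b - G)) \<le> 1 + \<theta> * (g b - G) + (\<theta> * (2 * B))\<^sup>2" by simp
    qed auto
    also have "\<dots> = 1 + (\<theta> * (2 * B))\<^sup>2"
    proof -
      have "(\<Sum>b\<in>UNIV. pmf (Q x) b * (\<theta> * (g b - G))) = \<theta> * ((\<Sum>b\<in>UNIV. pmf (Q x) b * g b) - (\<Sum>b\<in>UNIV. pmf (Q x) b) * G)"
        unfolding sum_distrib_right sum_subtractf[symmetric] sum_distrib_left
        by (rule sum.cong) (auto simp: algebra_simps)
      also have "\<dots> = 0" by (simp add: G_def)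
      finally show ?thesis by (simp add: distrib_left sum.distrib sum_distrib_right[symmetric])
    qed
    also have "\<dots> \<le> exp ((\<theta> * (2 * B))\<^sup>2)" by (rule exp_ge_add_one_self)
    finally have 1: "(\<Sum>b\<in>UNIV. pmf (Q x) b * exp (\<theta> * (g b - G))) \<le> exp (4 * B\<^sup>2 * \<theta>\<^sup>2)"
      by (simp add: power_mult_distrib mult_ac)
    have "exp (\<theta> * f x) * (\<Sum>b\<in>UNIV. pmf (Q x) b * exp (\<theta> * g b))
       = exp (\<theta> * (f x + G)) * (\<Sum>b\<in>UNIV. pmf (Q x) b * exp (\<theta> * (g b - G)))"
      by (simp add: sum_distrib_left distrib_left right_diff_distrib exp_diff exp_add)
    also have "\<dots> \<le> exp (\<theta> * (g x + e)) * exp (4 * B\<^sup>2 * \<theta>\<^sup>2)"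
      using poisson[of x] \<theta>(1) 1 unfolding G_def[symmetric]
      by (intro mult_mono) (auto intro!: mult_left_mono sum_nonneg)
    also have "\<dots> = exp (\<theta> * g x) * exp \<rho>"
      by (simp add: \<rho>_def exp_add[symmetric] algebra_simps)
    finally show ?thesis .
  qed
  have "measure_pmf.expectation (path_pmf i Q (Suc n)) (\<lambda>xs. exp (\<theta> * (sum_list (map f (tl xs)) + g (hd xs))))
     = measure_pmf.expectation P (\<lambda>xs. \<Sum>b\<in>UNIV. pmf (Q (hd xs)) b * exp (\<theta> * (sum_list (map f xs) + g b)))"
    by (simp only: expectation_path_pmf_Suc P_def list.sel)
  also have "\<dots> \<le> measure_pmf.expectation P (\<lambda>xs. exp \<rho> * exp (\<theta> * (sum_list (map f (tl xs)) + g (hd xs))))"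
  proof (rule integral_mono_AE)
    show "AE xs in P. (\<Sum>b\<in>UNIV. pmf (Q (hd xs)) b * exp (\<theta> * (sum_list (map f xs) + g b)))
        \<le> exp \<rho> * exp (\<theta> * (sum_list (map f (tl xs)) + g (hd xs)))"
    proof (rule AE_pmfI)
      fix xs assume "xs \<in> set_pmf P"
      hence "length xs = Suc n" unfolding P_def by (rule length_path_pmf)
      then obtain x ys where xs: "xs = x # ys" by (cases xs) auto
      have "(\<Sum>b\<in>UNIV. pmf (Q x) b * exp (\<theta> * (sum_list (map f xs) + g b)))
         = exp (\<theta> * sum_list (map f ys)) * (exp (\<theta> * f x) * (\<Sum>b\<in>UNIV. pmf (Q x) b * exp (\<theta> * g b)))"
        by (simp add: xs sum_distrib_left distrib_left exp_add mult_ac)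
      also have "\<dots> \<le> exp (\<theta> * sum_list (map f ys)) * (exp (\<theta> * g x) * exp \<rho>)"
        by (intro mult_left_mono step) auto
      finally show "(\<Sum>b\<in>UNIV. pmf (Q (hd xs)) b * exp (\<theta> * (sum_list (map f xs) + g b)))
        \<le> exp \<rho> * exp (\<theta> * (sum_list (map f (tl xs)) + g (hd xs)))"
        by (simp add: xs distrib_left exp_add mult_ac)
    qed
  qed (auto intro!: integrable_measure_pmf_finite fin)
  also have "\<dots> = exp \<rho> * measure_pmf.expectation P (\<lambda>xs. exp (\<theta> * (sum_list (map f (tl xs)) + g (hd xs))))"
    by simp
  also have "\<dots> \<le> exp \<rho> * (exp (\<theta> * B) * exp (real n * \<rho>))"
    using Suc by (intro mult_left_mono) (auto simp: P_def \<rho>_def)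
  also have "\<dots> = exp (\<theta> * B) * exp (real (Suc n) * \<rho>)"
    by (simp add: exp_add[symmetric] algebra_simps)
  finally show ?case unfolding \<rho>_def .
qed

text \<open>Markov's inequality for the exponential moment. Of the available
  \<open>\<theta> * \<delta>\<close> per step, half pays for the error in the Poisson equation, a
  quarter for the quadratic term, and the last quarter remains as decay rate.\<close>

lemma path_pmf_tail:
  fixes Q :: "'a::finite \<Rightarrow> 'a pmf" and f g :: "'a \<Rightarrow> real"
  assumes \<delta>: "\<delta> > 0"
    and poisson: "\<And>x. f x + (\<Sum>b\<in>UNIV. pmf (Q x) b * g b) \<le> g x + \<delta> / 2"
  shows "\<exists>A q. 0 < q \<and> q < 1 \<and>
     (\<forall>n. measure_pmf.prob (path_pmf i Q n) {xs. sum_list (map f (tl xs)) \<ge> \<delta> * real n} \<le> A * q ^ n)"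
proof -
  \<comment> \<open>The added 1 keeps \<open>B\<close> positive even if \<open>g\<close> vanishes,
    since \<open>\<theta>\<close> divides by it.\<close>
  define B where "B = Max (range (\<lambda>x. \<bar>g x\<bar>)) + 1"
  have B: "\<bar>g x\<bar> \<le> B" for x
    unfolding B_def by (rule add_increasing2) (auto intro: Max_ge)
  have B1: "B \<ge> 1"
  proof -
    have "\<bar>g undefined\<bar> \<le> Max (range (\<lambda>x. \<bar>g x\<bar>))" by (rule Max_ge) auto
    thus ?thesis unfolding B_def by linarith
  qed
  \<comment> \<open>The first entry is the range of the exponential estimate; the second brings
    \<open>4 * B\<^sup>2 * \<theta>\<close> down to \<open>\<delta> / 4\<close>.\<close>
  define \<theta> where "\<theta> = min (1 / (2 * B)) (\<delta> / (16 * B\<^sup>2))"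
  have \<theta>: "\<theta> > 0" "2 * B * \<theta> \<le> 1" "4 * B\<^sup>2 * \<theta> \<le> \<delta> / 4"
  proof -
    show "\<theta> > 0" using \<delta> B1 by (simp add: \<theta>_def)
    have "2 * B * \<theta> \<le> 2 * B * (1 / (2 * B))" using B1 by (intro mult_left_mono) (auto simp: \<theta>_def)
    thus "2 * B * \<theta> \<le> 1" using B1 by simp
    have "4 * B\<^sup>2 * \<theta> \<le> 4 * B\<^sup>2 * (\<delta> / (16 * B\<^sup>2))" using B1 by (intro mult_left_mono) (auto simp: \<theta>_def)
    thus "4 * B\<^sup>2 * \<theta> \<le> \<delta> / 4" using B1 by simp
  qed
  define q where "q = exp (- \<theta> * \<delta> / 4)"
  have "measure_pmf.prob (path_pmf i Q n) {xs. sum_list (map f (tl xs)) \<ge> \<delta> * real n} \<le> exp (2 * \<theta> * B) * q ^ n" for n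
  proof -
    have fin: "finite (set_pmf (path_pmf i Q n))" by (rule finite_set_path_pmf)
    have "measure_pmf.prob (path_pmf i Q n) {xs. sum_list (map f (tl xs)) \<ge> \<delta> * real n}
       = measure_pmf.expectation (path_pmf i Q n) (indicator {xs. sum_list (map f (tl xs)) \<ge> \<delta> * real n})"
      by simp
    also have "\<dots> \<le> measure_pmf.expectation (path_pmf i Q n)
        (\<lambda>xs. exp (\<theta> * B - \<theta> * \<delta> * n) * exp (\<theta> * (sum_list (map f (tl xs)) + g (hd xs))))"
    proof (rule integral_mono)
      fix xs
      show "indicator {xs. sum_list (map f (tl xs)) \<ge> \<delta> * real n} xs
        \<le> exp (\<theta> * B - \<theta> * \<delta> * n) * exp (\<theta> * (sum_list (map f (tl xs)) + g (hd xs)))"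
      proof (cases "sum_list (map f (tl xs)) \<ge> \<delta> * real n")
        case True
        have "0 \<le> \<theta> * ((sum_list (map f (tl xs)) - \<delta> * n) + (g (hd xs) + B))"
          using True \<theta> B[of "hd xs"] by (intro mult_nonneg_nonneg) auto
        thus ?thesis using True by (simp add: exp_add[symmetric] algebra_simps)
      qed auto
    qed (auto intro!: integrable_measure_pmf_finite fin)
    also have "\<dots> = exp (\<theta> * B - \<theta> * \<delta> * n) * measure_pmf.expectation (path_pmf i Q n)
        (\<lambda>xs. exp (\<theta> * (sum_list (map f (tl xs)) + g (hd xs))))" by simp
    also have "\<dots> \<le> exp (\<theta> * B - \<theta> * \<delta> * n) * (exp (\<theta> * B) * exp (real n * (4 * B\<^sup>2 * \<theta>\<^sup>2 + \<theta> * (\<delta> / 2))))"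
      by (intro mult_left_mono path_pmf_exponential_bound) (use \<theta> B poisson in auto)
    also have "\<dots> \<le> exp (\<theta> * B - \<theta> * \<delta> * n) * (exp (\<theta> * B) * exp (real n * (\<theta> * (\<delta> / 4) + \<theta> * (\<delta> / 2))))"
    proof -
      have "4 * B\<^sup>2 * \<theta>\<^sup>2 \<le> \<theta> * (\<delta> / 4)"
      proof -
        have "4 * B\<^sup>2 * \<theta>\<^sup>2 = \<theta> * (4 * B\<^sup>2 * \<theta>)" by (simp add: power2_eq_square)
        also have "\<dots> \<le> \<theta> * (\<delta> / 4)" using \<theta> by (intro mult_left_mono) auto
        finally show ?thesis .
      qed
      hence "real n * (4 * B\<^sup>2 * \<theta>\<^sup>2 + \<theta> * (\<delta> / 2)) \<le> real n * (\<theta> * (\<delta> / 4) + \<theta> * (\<delta> / 2))"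
        by (intro mult_left_mono add_right_mono) auto
      thus ?thesis by simp
    qed
    also have "\<dots> = exp (2 * \<theta> * B) * exp (real n * (- \<theta> * \<delta> / 4))"
      by (simp add: exp_add[symmetric] algebra_simps)
    also have "exp (real n * (- \<theta> * \<delta> / 4)) = q ^ n" by (simp only: q_def exp_of_nat_mult)
    finally show ?thesis .
  qed
  moreover have "0 < q" "q < 1" using \<theta> \<delta> by (auto simp: q_def)
  ultimately show ?thesis by blast
qed

lemma count_list_concentration:
  fixes Q :: "'a::finite \<Rightarrow> 'a pmf"
  assumes irr: "irreducible_chain Q" and aper: "aperiodic_chain Q"
    and stat: "stationary_distribution Q \<pi>" and \<delta>: "\<delta> > 0"
  shows "\<exists>A q. 0 < q \<and> q < 1 \<and>
     (\<forall>n. measure_pmf.prob (path_pmf i Q n)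
        {xs. \<bar>real (count_list (tl xs) a) - pmf \<pi> a * real n\<bar> \<ge> \<delta> * real n} \<le> A * q ^ n)"
proof -
  have "eventually (\<lambda>n. \<bar>n_step Q n x a - pmf \<pi> a\<bar> < \<delta> / 2) sequentially" for x
    using tendstoD[OF n_step_tendsto_stationary[OF irr aper stat, of x a], of "\<delta> / 2"] \<delta>
    by (simp add: dist_real_def)
  hence "eventually (\<lambda>n. \<forall>x. \<bar>n_step Q n x a - pmf \<pi> a\<bar> < \<delta> / 2) sequentially"
    by (rule eventually_all_finite)
  then obtain N where N: "\<And>x. \<bar>n_step Q N x a - pmf \<pi> a\<bar> < \<delta> / 2"
    by (auto simp: eventually_sequentially)
  \<comment> \<open>Truncated potential of the centred indicator \<open>f\<close>: applying
    \<open>Q\<close> shifts the sum by one index, so the Poisson equation fails only by the term of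
    index \<open>N\<close>, which is below \<open>\<delta> / 2\<close> in absolute value.\<close>
  define g where "g x = (\<Sum>k<N. n_step Q k x a - pmf \<pi> a)" for x
  define f where "f x = of_bool (x = a) - pmf \<pi> a" for x
  have poisson: "f x + (\<Sum>b\<in>UNIV. pmf (Q x) b * g b) = g x + (n_step Q N x a - pmf \<pi> a)" for x
  proof -
    have "(\<Sum>b\<in>UNIV. pmf (Q x) b * g b) = (\<Sum>k<N. \<Sum>b\<in>UNIV. pmf (Q x) b * (n_step Q k b a - pmf \<pi> a))"
      unfolding g_def sum_distrib_left by (rule sum.swap)
    also have "\<dots> = (\<Sum>k<N. n_step Q (Suc k) x a - pmf \<pi> a)"
      by (simp add: right_diff_distrib sum_subtractf sum_distrib_right[symmetric])
    finally have "f x + (\<Sum>b\<in>UNIV. pmf (Q x) b * g b) = (\<Sum>k<Suc N. n_step Q k x a - pmf \<pi> a)"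
      unfolding sum.lessThan_Suc_shift by (simp add: f_def)
    thus ?thesis by (simp add: g_def)
  qed
  have sum_f: "sum_list (map f ys) = real (count_list ys a) - pmf \<pi> a * real (length ys)" for ys
    by (induction ys) (auto simp: f_def algebra_simps)
  have "f x + (\<Sum>b\<in>UNIV. pmf (Q x) b * g b) \<le> g x + \<delta> / 2" for x
    unfolding poisson using N[of x] by linarith
  from path_pmf_tail[OF \<delta> this, of i] obtain A q where 1: "0 < q" "q < 1"
    "\<And>n. measure_pmf.prob (path_pmf i Q n) {xs. sum_list (map f (tl xs)) \<ge> \<delta> * real n} \<le> A * q ^ n" by blast
  have "- f x + (\<Sum>b\<in>UNIV. pmf (Q x) b * - g b) \<le> - g x + \<delta> / 2" for x
  proof -
    have "- f x + (\<Sum>b\<in>UNIV. pmf (Q x) b * - g b) = - (f x + (\<Sum>b\<in>UNIV. pmf (Q x) b * g b))"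
      by (simp add: sum_negf)
    thus ?thesis unfolding poisson using N[of x] by linarith
  qed
  from path_pmf_tail[OF \<delta> this, of i] obtain A' q' where 2: "0 < q'" "q' < 1"
    "\<And>n. measure_pmf.prob (path_pmf i Q n) {xs. sum_list (map (\<lambda>x. - f x) (tl xs)) \<ge> \<delta> * real n} \<le> A' * q' ^ n" by blast
  have neg: "sum_list (map (\<lambda>x. - f x) ys) = - sum_list (map f ys)" for ys
    by (induction ys) auto
  have A: "A \<ge> 0" "A' \<ge> 0" using 1(3)[of 0] 2(3)[of 0] measure_nonneg order_trans by fastforce+
  have "measure_pmf.prob (path_pmf i Q n)
        {xs. \<bar>real (count_list (tl xs) a) - pmf \<pi> a * real n\<bar> \<ge> \<delta> * real n} \<le> (A + A') * (max q q') ^ n" for n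
  proof -
    have "measure_pmf.prob (path_pmf i Q n)
        {xs. \<bar>real (count_list (tl xs) a) - pmf \<pi> a * real n\<bar> \<ge> \<delta> * real n}
      \<le> measure_pmf.prob (path_pmf i Q n) ({xs. sum_list (map f (tl xs)) \<ge> \<delta> * real n} \<union> {xs. sum_list (map (\<lambda>x. - f x) (tl xs)) \<ge> \<delta> * real n})"
      by (rule measure_pmf.finite_measure_mono_AE)
         (auto simp: AE_measure_pmf_iff sum_f neg dest!: length_path_pmf)
    also have "\<dots> \<le> A * q ^ n + A' * q' ^ n"
      by (rule order_trans[OF measure_Un_le]) (auto intro: add_mono 1 2)
    also have "\<dots> \<le> A * (max q q') ^ n + A' * (max q q') ^ n"
      using A 1 2 by (intro add_mono mult_left_mono power_mono) auto
    finally show ?thesis by (simp add: distrib_right)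
  qed
  moreover have "0 < max q q'" "max q q' < 1" using 1 2 by auto
  ultimately show ?thesis by blast
qed

lemma path_pmf_hd_tendsto:
  fixes Q :: "'a::finite \<Rightarrow> 'a pmf"
  assumes irr: "irreducible_chain Q" and aper: "aperiodic_chain Q"
    and stat: "stationary_distribution Q \<pi>"
  shows "(\<lambda>n. measure_pmf.prob (path_pmf i Q n) {xs. hd xs = a}) \<longlonglongrightarrow> pmf \<pi> a"
proof -
  have "measure_pmf.prob (path_pmf i Q n) {xs. hd xs = a} = (\<Sum>x\<in>UNIV. pmf i x * n_step Q n x a)" for n
  proof -
    have "measure_pmf.prob (path_pmf i Q n) {xs. hd xs = a}
       = measure_pmf.expectation (path_pmf i Q n) (\<lambda>xs. indicator {xs. hd xs = a} xs)" by simp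
    also have "\<dots> = measure_pmf.expectation (path_pmf i Q n) (\<lambda>xs. indicator {a} (hd xs))"
      by (rule Bochner_Integration.integral_cong) (auto simp: indicator_def)
    also have "\<dots> = (\<Sum>x\<in>UNIV. pmf i x * n_step Q n x a)"
      by (subst expectation_path_pmf_hd) (simp add: indicator_def if_distrib[of "\<lambda>x. _ * x"] cong: if_cong)
    finally show ?thesis .
  qed
  moreover have "(\<lambda>n. \<Sum>x\<in>UNIV. pmf i x * n_step Q n x a) \<longlonglongrightarrow> (\<Sum>x\<in>UNIV. pmf i x * pmf \<pi> a)"
    by (intro tendsto_intros n_step_tendsto_stationary assms)
  ultimately show ?thesis by (simp add: sum_distrib_right[symmetric])
qed

section \<open>Visit probabilities\<close>

text \<open>The function \<phi> of the overview for the letter distribution \<open>q\<close>;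
  written with the binomial law it vanishes for \<open>m < r\<close> by itself.\<close>

definition visit_prob :: "'b pmf \<Rightarrow> nat \<Rightarrow> nat \<Rightarrow> real" where
  "visit_prob q r m = measure_pmf.expectation q (\<lambda>k. pmf (binomial_pmf m (pmf q k)) r)"

lemma visit_prob_nonneg: "visit_prob q r m \<ge> 0"
  unfolding visit_prob_def by (intro integral_nonneg_AE) auto

lemma visit_prob_le_1: "visit_prob q r m \<le> 1"
  unfolding visit_prob_def
  by (rule measure_pmf.integral_le_const)
     (auto intro!: measure_pmf.integrable_const_bound[of _ 1] simp: pmf_le_1 simp del: pmf_binomial)

text \<open>The last letter is independent of the earlier ones, so it may be drawn first; for a
  fixed value \<open>k\<close> the number of its earlier occurrences is binomial.\<close>

lemma pmf_count_letters:
  "pmf (map_pmf (\<lambda>zs. count_list (tl zs) (hd zs)) (letters_pmf p (x # xs))) r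
     = visit_prob (p x) r (count_list xs x)"
proof -
  have "map_pmf (\<lambda>zs. count_list (tl zs) (hd zs)) (letters_pmf p (x # xs))
      = letters_pmf p xs \<bind> (\<lambda>zs. p x \<bind> (\<lambda>k. return_pmf (count_list zs (x, k))))"
    by (simp add: map_bind_pmf pmf.map_comp o_def map_pmf_def bind_assoc_pmf bind_return_pmf)
  also have "\<dots> = p x \<bind> (\<lambda>k. letters_pmf p xs \<bind> (\<lambda>zs. return_pmf (count_list zs (x, k))))"
    by (rule bind_commute_pmf)
  also have "\<dots> = p x \<bind> (\<lambda>k. binomial_pmf (count_list xs x) (pmf (p x) k))"
    unfolding count_letters_binomial[symmetric] map_pmf_def by simp
  finally show ?thesis by (simp add: pmf_bind visit_prob_def)
qed

text \<open>From here on only the finite regime chain matters: in the first identity the letters are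
  averaged out, in the second they are projected away.\<close>

lemma regime_switching_laws:
  fixes M :: "'w measure" and Z :: "nat \<Rightarrow> 'w \<Rightarrow> 'a::finite \<times> nat"
  assumes rs: "regime_switching_process M Z \<eta> Q p"
  shows "\<P>(\<omega> in M. previous_visits Z n \<omega> = r)
      = measure_pmf.expectation (path_pmf \<eta> Q n)
          (\<lambda>xs. visit_prob (p (hd xs)) r (count_list (tl xs) (hd xs)))" (is ?A)
    and "(\<integral>\<omega>. f (previous_visits (\<lambda>i \<omega>. fst (Z i \<omega>)) n \<omega>) \<partial>M)
      = measure_pmf.expectation (path_pmf \<eta> Q n) (\<lambda>xs. f (count_list (tl xs) (hd xs)) :: real)" (is ?B)
proof -
  define I where "I = bind_pmf \<eta> (\<lambda>a. map_pmf (Pair a) (p a))"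
  define K where "K = switching_kernel Q p"
  have "(\<lambda>(a, k). pmf \<eta> a * pmf (p a) k) = pmf I"
    by (auto simp: fun_eq_iff I_def pmf_bind_Pair)
  moreover have "(\<lambda>(a', k') (a, k). pmf (Q a') a * pmf (p a) k) = (\<lambda>z. pmf (K z))"
    by (auto simp: fun_eq_iff K_def switching_kernel_def pmf_bind_Pair)
  ultimately have mc: "markov_chain M Z (pmf I) (\<lambda>z. pmf (K z))"
    using rs by (simp add: regime_switching_process_def)
  note hist = markov_chain_history[OF mc, of n]
  have path: "path_pmf I K n = bind_pmf (path_pmf \<eta> Q n) (letters_pmf p)"
    unfolding I_def K_def by (rule path_pmf_switching)
  have [measurable]: "history Z n \<in> measurable M (count_space UNIV)" by (rule hist)
  have "\<P>(\<omega> in M. previous_visits Z n \<omega> = r)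
      = measure M (history Z n -` {zs. count_list (tl zs) (hd zs) = r} \<inter> space M)"
    by (rule arg_cong[of _ _ "measure M"]) (auto simp: previous_visits_history)
  also have "\<dots> = measure (distr M (count_space UNIV) (history Z n)) {zs. count_list (tl zs) (hd zs) = r}"
    by (rule measure_distr[symmetric]) auto
  also have "\<dots> = pmf (map_pmf (\<lambda>zs. count_list (tl zs) (hd zs)) (path_pmf I K n)) r"
    by (simp add: hist(2) pmf_map vimage_def)
  also have "\<dots> = measure_pmf.expectation (path_pmf \<eta> Q n)
      (\<lambda>xs. pmf (map_pmf (\<lambda>zs. count_list (tl zs) (hd zs)) (letters_pmf p xs)) r)"
    by (simp add: path map_bind_pmf pmf_bind)
  also have "\<dots> = measure_pmf.expectation (path_pmf \<eta> Q n)
          (\<lambda>xs. visit_prob (p (hd xs)) r (count_list (tl xs) (hd xs)))"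
  proof (rule integral_cong_AE)
    show "AE xs in path_pmf \<eta> Q n. pmf (map_pmf (\<lambda>zs. count_list (tl zs) (hd zs)) (letters_pmf p xs)) r
        = visit_prob (p (hd xs)) r (count_list (tl xs) (hd xs))"
    proof (rule AE_pmfI)
      fix xs assume "xs \<in> set_pmf (path_pmf \<eta> Q n)"
      hence "length xs = Suc n" by (rule length_path_pmf)
      then obtain x ys where "xs = x # ys" by (cases xs) auto
      thus "pmf (map_pmf (\<lambda>zs. count_list (tl zs) (hd zs)) (letters_pmf p xs)) r
        = visit_prob (p (hd xs)) r (count_list (tl xs) (hd xs))"
        by (simp only: pmf_count_letters list.sel)
    qed
  qed auto
  finally show ?A .
  have hfst: "history (\<lambda>i \<omega>. fst (Z i \<omega>)) n \<omega> = map fst (history Z n \<omega>)" for \<omega>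
    by (induction n) auto
  have mapl: "map_pmf (map fst) (letters_pmf p xs) = return_pmf xs" for xs
    by (rule map_pmf_eq_return_pmf_iff[THEN iffD2]) (auto dest: map_fst_letters_pmf)
  define G where "G xs = f (count_list (tl xs) (hd xs))" for xs :: "'a list"
  have "(\<integral>\<omega>. f (previous_visits (\<lambda>i \<omega>. fst (Z i \<omega>)) n \<omega>) \<partial>M) = (\<integral>\<omega>. G (map fst (history Z n \<omega>)) \<partial>M)"
    by (simp add: previous_visits_history hfst G_def)
  also have "\<dots> = (\<integral>zs. G (map fst zs) \<partial>distr M (count_space UNIV) (history Z n))"
    by (rule integral_distr[symmetric]) auto
  also have "\<dots> = measure_pmf.expectation (map_pmf (map fst) (path_pmf I K n)) G"
    by (simp add: hist(2))
  also have "map_pmf (map fst) (path_pmf I K n) = path_pmf \<eta> Q n"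
    by (simp add: path map_bind_pmf mapl bind_return_pmf')
  finally show ?B unfolding G_def .
qed

section \<open>Scaling limits of integrals\<close>

text \<open>\<open>z\<close> lies below a power of 2 that is at most \<open>2 * z\<close>; the
  doubling inequality is iterated up to that power, and the overshoot costs the factor
  \<open>2 powr \<kappa>\<close>.\<close>

lemma doubling_bound:
  fixes f :: "real \<Rightarrow> real"
  assumes x0: "x0 > 0" and mono: "\<And>x y. x0 \<le> x \<Longrightarrow> x \<le> y \<Longrightarrow> f x \<le> f y"
    and nonneg: "\<And>x. x0 \<le> x \<Longrightarrow> 0 \<le> f x"
    and dbl: "\<And>x. x0 \<le> x \<Longrightarrow> f (2 * x) \<le> 2 powr \<kappa> * f x"
    and \<kappa>: "\<kappa> \<ge> 0" and x: "x0 \<le> x" and z: "1 \<le> z"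
  shows "f (x * z) \<le> 2 powr \<kappa> * z powr \<kappa> * f x"
proof -
  have iter: "f (2 ^ n * x) \<le> (2 powr \<kappa>) ^ n * f x" for n
  proof (induction n)
    case (Suc n)
    have "1 * x \<le> 2 ^ n * x" using x x0 by (intro mult_right_mono) auto
    hence "f (2 * (2 ^ n * x)) \<le> 2 powr \<kappa> * f (2 ^ n * x)" using x by (intro dbl) simp
    also have "\<dots> \<le> 2 powr \<kappa> * ((2 powr \<kappa>) ^ n * f x)" using Suc by (intro mult_left_mono) auto
    finally show ?case by (simp add: mult_ac)
  qed simp
  define n where "n = nat \<lceil>log 2 z\<rceil>"
  have logz: "log 2 z \<ge> 0" using z by simp
  have "log 2 z \<le> real n" "real n \<le> log 2 z + 1" unfolding n_def using logz by linarith+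
  hence "2 powr (log 2 z) \<le> 2 powr (real n)" "2 powr (real n) \<le> 2 powr (log 2 z + 1)"
    by (intro powr_mono; simp)+
  hence n: "z \<le> 2 ^ n" "2 ^ n \<le> 2 * z" using z by (auto simp: powr_realpow powr_add)
  have "x * z \<ge> x * 1" using x x0 z by (intro mult_left_mono) auto
  hence "x0 \<le> x * z" using x by simp
  moreover have "x * z \<le> 2 ^ n * x" using x x0 n by (simp add: mult.commute mult_right_mono)
  ultimately have "f (x * z) \<le> f (2 ^ n * x)" by (rule mono)
  also have "\<dots> \<le> (2 powr \<kappa>) ^ n * f x" by (rule iter)
  also have "(2 powr \<kappa>) ^ n = (2 ^ n) powr \<kappa>" by (simp add: powr_power powr_realpow[symmetric] powr_powr mult.commute)
  also have "(2 ^ n) powr \<kappa> * f x \<le> (2 * z) powr \<kappa> * f x"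
    using n \<kappa> nonneg[OF x] by (intro mult_right_mono powr_mono2) auto
  also have "(2 * z) powr \<kappa> = 2 powr \<kappa> * z powr \<kappa>" using z by (simp add: powr_mult)
  finally show ?thesis .
qed

text \<open>\<open>G (x * p k)\<close> is the integral of \<open>g\<close> over the positive
  \<open>y\<close> with \<open>y / x \<le> p k\<close>; then sum and integral are exchanged. Weights
  \<open>w = 1\<close> produce the number of large letters, \<open>w = p\<close> their mass.\<close>

lemma layer_cake_sums:
  fixes p w :: "nat \<Rightarrow> real" and g G :: "real \<Rightarrow> real"
  assumes p: "\<And>k. p k \<ge> 0" and w: "\<And>k. w k \<ge> 0" and summ: "summable (\<lambda>k. w k * p k)"
    and G: "\<And>y. (G has_field_derivative g y) (at y)" "G 0 = 0"
    and g: "\<And>y. isCont g y" "\<And>y. y \<ge> 0 \<Longrightarrow> \<bar>g y\<bar> \<le> b" and x: "x > 0"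
  shows "(\<lambda>k. w k * G (x * p k)) sums
      (\<integral>y. indicator {0<..} y * g y * (\<Sum>k. w k * of_bool (y / x \<le> p k)) \<partial>lborel)"
    and "integrable lborel (\<lambda>y. indicator {0<..} y * g y * (\<Sum>k. w k * of_bool (y / x \<le> p k)))"
proof -
  define f where "f k y = w k * (g y * indicator {0<..x * p k} y)" for k y
  have [measurable]: "g \<in> borel_measurable borel"
    using g(1) by (intro borel_measurable_continuous_onI continuous_at_imp_continuous_on) auto
  have b: "b \<ge> 0" using g(2)[of 0] by linarith
  have hbi: "has_bochner_integral lborel (f k) (w k * G (x * p k))" for k
  proof -
    have "has_bochner_integral lborel (\<lambda>y. g y * indicator {0..x * p k} y) (G (x * p k) - G 0)"
      using p[of k] x G g by (intro has_bochner_integral_FTC_Icc_real) auto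
    hence "has_bochner_integral lborel (\<lambda>y. g y * indicator {0<..x * p k} y) (G (x * p k) - G 0)"
      by (rule has_bochner_integral_discrete_difference[where X="{0}", THEN iffD1, rotated 4])
         (auto split: split_indicator)
    thus ?thesis unfolding f_def using G(2) by (intro has_bochner_integral_mult_right) simp
  qed
  have int: "integrable lborel (f k)" for k using hbi[of k] by (auto simp: has_bochner_integral_iff)
  have fsum: "summable (\<lambda>k. norm (f k y))" for y
  proof (cases "y > 0")
    case True
    \<comment> \<open>Where the term is nonzero, \<open>y \<le> x * p k\<close>; this supplies the
      factor \<open>p k\<close> that summability needs, at the price of
      \<open>x / y\<close>.\<close>
    have "norm (f k y) \<le> b * x / y * (w k * p k)" for k
    proof (cases "y \<le> x * p k")
      case yes: True
      have "w k * \<bar>g y\<bar> * y \<le> w k * b * (x * p k)"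
        using w[of k] g(2)[of y] True yes b by (intro mult_mono) auto
      thus ?thesis using True yes w[of k] by (simp add: f_def abs_mult field_simps)
    next
      case False
      thus ?thesis using b x True w[of k] p[of k] by (simp add: f_def)
    qed
    thus ?thesis by (intro summable_comparison_test'[OF summable_mult[OF summ, of "b * x / y"], of 0]) simp
  next
    case False
    thus ?thesis by (simp add: f_def)
  qed
  have nsum: "summable (\<lambda>k. \<integral>y. norm (f k y) \<partial>lborel)"
  proof (rule summable_comparison_test'[OF summable_mult[OF summ], of 0])
    fix k :: nat
    have c: "has_bochner_integral lborel (\<lambda>y. b * w k * indicator {0..x * p k} y) (b * w k * (x * p k))"
      using p[of k] x by (intro has_bochner_integral_mult_right) (auto simp: has_bochner_integral_iff)
    have "(\<integral>y. norm (f k y) \<partial>lborel) \<le> (\<integral>y. b * w k * indicator {0..x * p k} y \<partial>lborel)"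
    proof (rule integral_mono)
      fix y
      have "w k * \<bar>g y\<bar> \<le> w k * b" if "y \<ge> 0" using g(2)[OF that] w[of k] by (rule mult_left_mono)
      thus "norm (f k y) \<le> b * w k * indicator {0..x * p k} y"
        using b w[of k] by (auto simp: f_def abs_mult mult.commute split: split_indicator)
    qed (use int[of k] c in \<open>auto simp: has_bochner_integral_iff simp del: integrable_mult_right_iff\<close>)
    also have "\<dots> = b * w k * (x * p k)" using c by (simp add: has_bochner_integral_iff)
    finally show "norm (\<integral>y. norm (f k y) \<partial>lborel) \<le> b * x * (w k * p k)"
      by (simp add: mult_ac)
  qed
  have eq: "(\<Sum>k. f k y) = indicator {0<..} y * g y * (\<Sum>k. w k * of_bool (y / x \<le> p k))" for y
  proof (cases "y > 0 \<and> g y \<noteq> 0")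
    case True
    have fk: "f k y = g y * (w k * of_bool (y / x \<le> p k))" for k
      using True x by (auto simp: f_def field_simps split: split_indicator)
    have "summable (\<lambda>k. w k * of_bool (y / x \<le> p k))"
      using summable_mult[OF summable_norm_cancel[OF fsum[of y]], of "1 / g y"] True by (simp add: fk)
    from suminf_mult[OF this, of "g y"] show ?thesis using True by (simp add: fk)
  next
    case False
    thus ?thesis by (auto simp: f_def)
  qed
  have "(\<lambda>k. integral\<^sup>L lborel (f k)) sums (\<integral>y. (\<Sum>k. f k y) \<partial>lborel)"
    by (rule sums_integral[OF int _ nsum]) (use fsum in auto)
  thus "(\<lambda>k. w k * G (x * p k)) sums
      (\<integral>y. indicator {0<..} y * g y * (\<Sum>k. w k * of_bool (y / x \<le> p k)) \<partial>lborel)"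
    using hbi by (simp add: eq has_bochner_integral_iff)
  have "integrable lborel (\<lambda>y. \<Sum>k. f k y)"
    by (rule integrable_suminf[OF int _ nsum]) (use fsum in auto)
  thus "integrable lborel (\<lambda>y. indicator {0<..} y * g y * (\<Sum>k. w k * of_bool (y / x \<le> p k)))"
    by (simp add: eq)
qed

lemma has_bochner_integral_Gamma:
  assumes "real i + \<beta> + 1 > 0"
  shows "has_bochner_integral lborel (\<lambda>y. indicator {0<..} y * (y ^ i * exp (-y)) * y powr \<beta>) (Gamma (real i + \<beta> + 1))"
proof -
  have "has_bochner_integral lborel (\<lambda>t. indicator {0..} t * t powr (real i + \<beta> + 1 - 1) / exp t) (Gamma (real i + \<beta> + 1))"
    using Gamma_conv_nn_integral_real[OF assms] assms
    by (intro has_bochner_integral_nn_integral) (auto intro!: less_imp_le[OF Gamma_real_pos])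
  thus ?thesis
    by (rule has_bochner_integral_discrete_difference[where X="{0}", THEN iffD1, rotated 4])
       (auto split: split_indicator simp: powr_add powr_realpow exp_minus field_simps)
qed

text \<open>Dominated convergence. In the majorant the power \<open>- \<kappa>\<close> serves small
  \<open>y\<close> and the power \<open>\<kappa>'\<close> large \<open>y\<close>; the kernel
  \<open>g\<close> has to integrate both.\<close>

lemma scaled_integral_tendsto:
  fixes g B H :: "real \<Rightarrow> real"
  assumes [measurable]: "B \<in> borel_measurable borel" "g \<in> borel_measurable borel"
   and lim: "\<And>y. y > 0 \<Longrightarrow> ((\<lambda>x. B (y / x) / H x) \<longlongrightarrow> c * y powr \<beta>) at_top"
   and bnd: "eventually (\<lambda>x. \<forall>y>0. \<bar>B (y / x) / H x\<bar> \<le> K * (y powr (-\<kappa>) + y powr \<kappa>')) at_top"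
   and int: "integrable lborel (\<lambda>y. indicator {0<..} y * g y * y powr (-\<kappa>))"
      "integrable lborel (\<lambda>y. indicator {0<..} y * g y * y powr \<kappa>')"
   and I: "has_bochner_integral lborel (\<lambda>y. indicator {0<..} y * g y * y powr \<beta>) I"
  shows "((\<lambda>x. (\<integral>y. indicator {0<..} y * g y * B (y / x) \<partial>lborel) / H x) \<longlongrightarrow> c * I) at_top"
proof -
  have "((\<lambda>x. \<integral>y. indicator {0<..} y * g y * (B (y / x) / H x) \<partial>lborel) \<longlongrightarrow>
      (\<integral>y. c * (indicator {0<..} y * g y * y powr \<beta>) \<partial>lborel)) at_top"
  proof (rule integral_dominated_convergence_at_top)
    show "integrable lborel (\<lambda>y. K * (norm (indicator {0<..} y * g y * y powr (-\<kappa>))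
        + norm (indicator {0<..} y * g y * y powr \<kappa>')))"
      using int by (intro integrable_mult_right Bochner_Integration.integrable_add integrable_norm)
    show "AE y in lborel. ((\<lambda>x. indicator {0<..} y * g y * (B (y / x) / H x)) \<longlongrightarrow>
        c * (indicator {0<..} y * g y * y powr \<beta>)) at_top"
    proof (rule AE_I2)
      fix y :: real
      show "((\<lambda>x. indicator {0<..} y * g y * (B (y / x) / H x)) \<longlongrightarrow>
        c * (indicator {0<..} y * g y * y powr \<beta>)) at_top"
        using tendsto_mult_left[OF lim[of y], of "g y"] by (cases "y > 0") (auto simp: mult_ac)
    qed
    show "\<forall>\<^sub>F x in at_top. AE y in lborel. norm (indicator {0<..} y * g y * (B (y / x) / H x))
        \<le> K * (norm (indicator {0<..} y * g y * y powr (-\<kappa>)) + norm (indicator {0<..} y * g y * y powr \<kappa>'))"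
      using bnd
    proof eventually_elim
      case (elim x)
      show ?case
      proof (rule AE_I2)
        fix y :: real
        show "norm (indicator {0<..} y * g y * (B (y / x) / H x))
          \<le> K * (norm (indicator {0<..} y * g y * y powr (-\<kappa>)) + norm (indicator {0<..} y * g y * y powr \<kappa>'))"
        proof (cases "y > 0")
          case True
          have "\<bar>g y\<bar> * \<bar>B (y / x) / H x\<bar> \<le> \<bar>g y\<bar> * (K * (y powr (-\<kappa>) + y powr \<kappa>'))"
            using elim True by (intro mult_left_mono) auto
          thus ?thesis using True by (simp add: abs_mult algebra_simps)
        qed auto
      qed
    qed
  qed auto
  moreover have "(\<integral>y. indicator {0<..} y * g y * (B (y / x) / H x) \<partial>lborel)
      = (\<integral>y. indicator {0<..} y * g y * B (y / x) \<partial>lborel) / H x" for x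
    by (subst integral_divide_zero[symmetric]) (simp add: mult_ac)
  ultimately show ?thesis using I by (simp add: has_bochner_integral_iff)
qed

section \<open>Laplace transforms of letter distributions\<close>

lemma pmf_nat_sums: "(\<lambda>k. pmf (q :: nat pmf) k) sums 1"
proof -
  have "(\<lambda>k. measure_pmf.prob q {k}) sums measure_pmf.prob q (\<Union>k. {k})"
    by (rule measure_pmf.finite_measure_UNION) (auto simp: disjoint_family_on_def)
  thus ?thesis by (simp add: measure_pmf_single)
qed

lemma power_exp_le_fact: "y \<ge> 0 \<Longrightarrow> y ^ i * exp (-y) \<le> (fact i :: real)"
proof -
  assume y: "y \<ge> 0"
  have "sum (\<lambda>n. y ^ n /\<^sub>R fact n) {i} \<le> exp y"
    unfolding exp_def by (rule sum_le_suminf[OF summable_exp_generic]) (use y in auto)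
  thus ?thesis by (simp add: exp_minus field_simps)
qed

text \<open>For \<open>s = r + 1\<close>, this times \<open>x ^ r / fact r\<close> is the
  Poissonized \<open>visit_prob\<close>, with the binomial law replaced by a Poisson law of mean
  \<open>x * pmf q k\<close>.\<close>

definition laplace :: "nat pmf \<Rightarrow> nat \<Rightarrow> real \<Rightarrow> real" where
  "laplace q s x = (\<Sum>k. pmf q k ^ s * exp (- x * pmf q k))"

text \<open>Series counterpart of \<open>counting_fun\<close>, taken over all indices so that
  measurability in \<open>t\<close> is immediate; under the support assumption index 0 contributes
  nothing for positive \<open>t\<close>. \<open>small_mass\<close> plays the same role for the
  numerator in \<open>RV_zero_tail\<close>.\<close>

definition large_count :: "nat pmf \<Rightarrow> real \<Rightarrow> real" where
  "large_count q t = (\<Sum>k. of_bool (t \<le> pmf q k))"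

definition small_mass :: "nat pmf \<Rightarrow> real \<Rightarrow> real" where
  "small_mass q t = (\<Sum>k. pmf q k * of_bool (pmf q k \<le> t))"

lemma summable_laplace:
  assumes "s \<ge> 1" "x \<ge> 0"
  shows "summable (\<lambda>k. pmf (q :: nat pmf) k ^ s * exp (- x * pmf q k))"
proof (rule summable_comparison_test'[OF sums_summable[OF pmf_nat_sums[of q]], of 0])
  fix k
  have "pmf q k ^ s * exp (- x * pmf q k) \<le> pmf q k ^ 1 * 1"
    using assms by (intro mult_mono power_decreasing) (auto simp: pmf_le_1)
  thus "norm (pmf q k ^ s * exp (- x * pmf q k)) \<le> pmf q k" by simp
qed

lemma finite_pmf_ge: "t > 0 \<Longrightarrow> finite {k. t \<le> pmf (q :: nat pmf) k}"
proof -
  assume t: "t > 0"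
  have "eventually (\<lambda>k. pmf q k < t) sequentially"
    using order_tendstoD(2)[OF summable_LIMSEQ_zero[OF sums_summable[OF pmf_nat_sums]] t] .
  then obtain N where "\<And>k. k \<ge> N \<Longrightarrow> pmf q k < t" by (auto simp: eventually_sequentially)
  hence "{k. t \<le> pmf q k} \<subseteq> {..<N}" by (auto simp: not_le[symmetric])
  thus ?thesis by (rule finite_subset) simp
qed

lemma summable_large_count: "t > 0 \<Longrightarrow> summable (\<lambda>k. of_bool (t \<le> pmf (q :: nat pmf) k) :: real)"
  by (rule summable_finite[OF finite_pmf_ge]) auto

lemma summable_small_mass: "summable (\<lambda>k. pmf (q :: nat pmf) k * of_bool (pmf q k \<le> t))"
  by (rule summable_comparison_test'[OF sums_summable[OF pmf_nat_sums[of q]], of 0]) auto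

lemma borel_measurable_large_count [measurable]: "large_count q \<in> borel_measurable borel"
  unfolding large_count_def[abs_def] by measurable

lemma borel_measurable_small_mass [measurable]: "small_mass q \<in> borel_measurable borel"
  unfolding small_mass_def[abs_def] by measurable

lemma large_count_antimono: "0 < s \<Longrightarrow> s \<le> t \<Longrightarrow> large_count q t \<le> large_count q s"
  unfolding large_count_def by (intro suminf_le summable_large_count) auto

lemma large_count_nonneg: "0 < t \<Longrightarrow> large_count q t \<ge> 0"
  unfolding large_count_def by (intro suminf_nonneg summable_large_count) auto

lemma small_mass_mono: "s \<le> t \<Longrightarrow> small_mass q s \<le> small_mass q t"
  unfolding small_mass_def by (intro suminf_le summable_small_mass) (auto intro!: mult_left_mono)

lemma small_mass_nonneg: "small_mass q t \<ge> 0"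
  unfolding small_mass_def by (intro suminf_nonneg summable_small_mass) auto

lemma small_mass_le_1: "small_mass q t \<le> 1"
proof -
  have "small_mass q t \<le> (\<Sum>k. pmf q k)"
    unfolding small_mass_def by (intro suminf_le summable_small_mass sums_summable[OF pmf_nat_sums]) auto
  thus ?thesis using sums_unique[OF pmf_nat_sums[of q]] by simp
qed

lemma counting_fun_eq_large_count:
  assumes "set_pmf (p a) \<subseteq> {1..}" "\<epsilon> > 0"
  shows "real (counting_fun p a \<epsilon>) = large_count (p a) \<epsilon>"
proof -
  have "pmf (p a) 0 = 0" using assms by (auto simp: set_pmf_eq)
  hence "{k. k \<ge> 1 \<and> pmf (p a) k \<ge> \<epsilon>} = {k. \<epsilon> \<le> pmf (p a) k}"
    using assms(2) by (auto simp: Suc_le_eq intro: gr0I)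
  moreover have "large_count (p a) \<epsilon> = (\<Sum>k\<in>{k. \<epsilon> \<le> pmf (p a) k}. 1)"
    unfolding large_count_def by (subst suminf_finite[OF finite_pmf_ge[OF assms(2), of "p a"]]) (auto intro!: sum.cong)
  ultimately show ?thesis by (simp add: counting_fun_def)
qed

lemma infsum_eq_small_mass:
  assumes "set_pmf (p a) \<subseteq> {1..}"
  shows "(\<Sum>\<^sub>\<infinity>k\<in>{1..}. pmf (p a) k * of_bool (pmf (p a) k \<le> \<epsilon>)) = small_mass (p a) \<epsilon>"
proof -
  have 0: "pmf (p a) 0 = 0" using assms by (auto simp: set_pmf_eq)
  have "((\<lambda>k. pmf (p a) k * of_bool (pmf (p a) k \<le> \<epsilon>)) has_sum small_mass (p a) \<epsilon>) UNIV"
    unfolding small_mass_def using summable_small_mass[of "p a" \<epsilon>]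
    by (intro norm_summable_imp_has_sum summable_sums) auto
  hence "small_mass (p a) \<epsilon> = (\<Sum>\<^sub>\<infinity>k. pmf (p a) k * of_bool (pmf (p a) k \<le> \<epsilon>))"
    by (simp add: infsumI)
  also have "\<dots> = (\<Sum>\<^sub>\<infinity>k\<in>{1..}. pmf (p a) k * of_bool (pmf (p a) k \<le> \<epsilon>))"
    by (rule infsum_cong_neutral) (auto simp: 0 Suc_le_eq intro: gr0I)
  finally show ?thesis by simp
qed

text \<open>Layer-cake formula with unit weights for \<open>G y = y ^ Suc r * exp (-y)\<close>,
  whose sum over the letters is the rescaled Laplace transform. The constant is the moment of order
  \<open>- \<alpha>\<close> of the derivative of \<open>G\<close>, evaluated by the functional
  equation of the gamma function; \<open>\<alpha> < real r + 1\<close> makes it converge at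
  0.\<close>

lemma laplace_via_large_count:
  assumes lim: "\<And>y. y > 0 \<Longrightarrow> ((\<lambda>x. large_count q (y / x) / H x) \<longlongrightarrow> c * y powr (-\<alpha>)) at_top"
    and bnd: "eventually (\<lambda>x. \<forall>y>0. \<bar>large_count q (y / x) / H x\<bar> \<le> K * (y powr (-\<kappa>) + y powr 0)) at_top"
    and \<alpha>: "\<alpha> < real r + 1" and \<kappa>: "\<kappa> < real r + 1"
  shows "((\<lambda>x. x ^ Suc r * laplace q (Suc r) x / H x) \<longlongrightarrow> c * (\<alpha> * Gamma (real r + 1 - \<alpha>))) at_top"
proof -
  define g :: "real \<Rightarrow> real" where "g y = real (Suc r) * (y ^ r * exp (-y)) - y ^ Suc r * exp (-y)" for y
  define G :: "real \<Rightarrow> real" where "G y = y ^ Suc r * exp (-y)" for y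
  have [measurable]: "g \<in> borel_measurable borel" unfolding g_def[abs_def] by measurable
  have mom: "has_bochner_integral lborel (\<lambda>y. indicator {0<..} y * g y * y powr \<beta>)
      (real (Suc r) * Gamma (real r + \<beta> + 1) - Gamma (real (Suc r) + \<beta> + 1))" if "real r + \<beta> + 1 > 0" for \<beta>
  proof -
    have "has_bochner_integral lborel (\<lambda>y. real (Suc r) * (indicator {0<..} y * (y ^ r * exp (-y)) * y powr \<beta>)
        - indicator {0<..} y * (y ^ Suc r * exp (-y)) * y powr \<beta>)
      (real (Suc r) * Gamma (real r + \<beta> + 1) - Gamma (real (Suc r) + \<beta> + 1))"
      using that by (intro has_bochner_integral_diff has_bochner_integral_mult_right has_bochner_integral_Gamma) auto
    thus ?thesis by (simp add: g_def algebra_simps)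
  qed
  have "((\<lambda>x. (\<integral>y. indicator {0<..} y * g y * large_count q (y / x) \<partial>lborel) / H x)
      \<longlongrightarrow> c * (real (Suc r) * Gamma (real r + -\<alpha> + 1) - Gamma (real (Suc r) + -\<alpha> + 1))) at_top"
    using mom[of "-\<alpha>"] mom[of "-\<kappa>"] mom[of 0] \<alpha> \<kappa>
    by (intro scaled_integral_tendsto[OF _ _ lim bnd]) (auto simp: has_bochner_integral_iff)
  also have "real (Suc r) * Gamma (real r + -\<alpha> + 1) - Gamma (real (Suc r) + -\<alpha> + 1) = \<alpha> * Gamma (real r + 1 - \<alpha>)"
  proof -
    have "real r + 1 - \<alpha> \<notin> \<int>\<^sub>\<le>\<^sub>0" using \<alpha> by (auto simp: nonpos_Ints_def)
    hence "Gamma (real r + 1 - \<alpha> + 1) = (real r + 1 - \<alpha>) * Gamma (real r + 1 - \<alpha>)"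
      by (rule Gamma_plus1)
    moreover have "real (Suc r) + -\<alpha> + 1 = real r + 1 - \<alpha> + 1" "real r + -\<alpha> + 1 = real r + 1 - \<alpha>" by auto
    ultimately show ?thesis by (simp add: algebra_simps)
  qed
  finally have *: "((\<lambda>x. (\<integral>y. indicator {0<..} y * g y * large_count q (y / x) \<partial>lborel) / H x)
      \<longlongrightarrow> c * (\<alpha> * Gamma (real r + 1 - \<alpha>))) at_top" .
  show ?thesis
  proof (rule Lim_transform_eventually[OF *])
    show "\<forall>\<^sub>F x in at_top. (\<integral>y. indicator {0<..} y * g y * large_count q (y / x) \<partial>lborel) / H x
        = x ^ Suc r * laplace q (Suc r) x / H x"
      using eventually_gt_at_top[of 0]
    proof eventually_elim
      case (elim x)
      have gb: "\<bar>g y\<bar> \<le> real (Suc r) * fact r + fact (Suc r)" if "y \<ge> 0" for y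
      proof -
        have "\<bar>g y\<bar> \<le> real (Suc r) * (y ^ r * exp (-y)) + y ^ Suc r * exp (-y)"
          unfolding g_def using that by (intro order_trans[OF abs_triangle_ineq4]) simp
        also have "\<dots> \<le> real (Suc r) * fact r + fact (Suc r)"
          using that by (intro add_mono mult_left_mono power_exp_le_fact) auto
        finally show ?thesis .
      qed
      have "(\<lambda>k. 1 * G (x * pmf q k)) sums
        (\<integral>y. indicator {0<..} y * g y * (\<Sum>k. 1 * of_bool (y / x \<le> pmf q k)) \<partial>lborel)"
      proof (rule layer_cake_sums(1))
        show "(G has_field_derivative g y) (at y)" for y
          unfolding G_def g_def by (auto intro!: derivative_eq_intros simp: algebra_simps simp del: power_Suc)
        show "isCont g y" for y unfolding g_def[abs_def] by (intro continuous_intros)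
        show "summable (\<lambda>k. 1 * pmf q k)" using sums_summable[OF pmf_nat_sums[of q]] by simp
      qed (use gb elim in \<open>auto simp: G_def\<close>)
      hence "(\<integral>y. indicator {0<..} y * g y * large_count q (y / x) \<partial>lborel) = (\<Sum>k. G (x * pmf q k))"
        by (simp add: sums_iff large_count_def)
      also have "\<dots> = (\<Sum>k. x ^ Suc r * (pmf q k ^ Suc r * exp (- x * pmf q k)))"
        by (simp add: G_def power_mult_distrib mult_ac)
      also have "\<dots> = x ^ Suc r * laplace q (Suc r) x"
        unfolding laplace_def using elim by (intro suminf_mult summable_laplace) auto
      finally show ?case by simp
    qed
  qed
qed

text \<open>Needed when the number of large letters only gives the constant 0. With weights
  \<open>pmf q k\<close> the layer-cake formula yields the mass of the letters of probability at
  least \<open>y / x\<close>, which is 1 minus \<open>small_mass\<close> except at countably many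
  \<open>y\<close>. The constant 1 integrates to \<open>- of_bool (r = 0)\<close> and cancels the
  constant subtracted in \<open>G\<close>.\<close>

lemma laplace_via_small_mass:
  assumes lim: "\<And>y. y > 0 \<Longrightarrow> ((\<lambda>x. small_mass q (y / x) / H x) \<longlongrightarrow> c * y powr 1) at_top"
    and bnd: "eventually (\<lambda>x. \<forall>y>0. \<bar>small_mass q (y / x) / H x\<bar> \<le> K * (y powr (-0) + y powr 2)) at_top"
  shows "((\<lambda>x. x ^ r * laplace q (Suc r) x / H x) \<longlongrightarrow> c * fact r) at_top"
proof -
  \<comment> \<open>At \<open>r = 0\<close> the truncated exponent \<open>r - 1\<close> is
    multiplied by 0, and the constant in \<open>G\<close> makes \<open>G 0 = 0\<close>, as the
    layer-cake formula demands.\<close>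
  define g :: "real \<Rightarrow> real" where "g y = real r * (y ^ (r - 1) * exp (-y)) - y ^ r * exp (-y)" for y
  define G :: "real \<Rightarrow> real" where "G y = y ^ r * exp (-y) - of_bool (r = 0)" for y
  have [measurable]: "g \<in> borel_measurable borel" unfolding g_def[abs_def] by measurable
  have mom: "has_bochner_integral lborel (\<lambda>y. indicator {0<..} y * g y * y powr \<beta>)
      (real r * Gamma (real (r - 1) + \<beta> + 1) - Gamma (real r + \<beta> + 1))" if "\<beta> \<ge> 0" for \<beta>
  proof -
    have "has_bochner_integral lborel (\<lambda>y. real r * (indicator {0<..} y * (y ^ (r - 1) * exp (-y)) * y powr \<beta>)
        - indicator {0<..} y * (y ^ r * exp (-y)) * y powr \<beta>)
      (real r * Gamma (real (r - 1) + \<beta> + 1) - Gamma (real r + \<beta> + 1))"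
      using that by (intro has_bochner_integral_diff has_bochner_integral_mult_right has_bochner_integral_Gamma) auto
    thus ?thesis by (simp add: g_def algebra_simps)
  qed
  have Gf: "Gamma (real n + 1) = fact n" for n using Gamma_fact[of n, where ?'a = real] by (simp add: add.commute)
  have I1: "real r * Gamma (real (r - 1) + 1 + 1) - Gamma (real r + 1 + 1) = - fact r"
  proof -
    have "real r * Gamma (real (r - 1) + 1 + 1) = real r * fact r"
      using Gf[of r] by (cases r) auto
    moreover have "Gamma (real r + 1 + 1) = (real r + 1) * fact r"
      using Gf[of "Suc r"] by (simp add: add.commute)
    ultimately show ?thesis by (simp add: algebra_simps)
  qed
  have I0: "real r * Gamma (real (r - 1) + 0 + 1) - Gamma (real r + 0 + 1) = - of_bool (r = 0)"
    using Gf[of r] Gf[of "r - 1"] by (cases r) (auto simp: add.commute)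
  have g0: "integrable lborel (\<lambda>y. indicator {0<..} y * g y)" "(\<integral>y. indicator {0<..} y * g y \<partial>lborel) = - of_bool (r = 0)"
  proof -
    have "has_bochner_integral lborel (\<lambda>y. indicator {0<..} y * g y) (- of_bool (r = 0))"
      using mom[of 0] unfolding I0
      by (rule has_bochner_integral_cong[THEN iffD1, rotated 3]) (auto split: split_indicator)
    thus "integrable lborel (\<lambda>y. indicator {0<..} y * g y)" "(\<integral>y. indicator {0<..} y * g y \<partial>lborel) = - of_bool (r = 0)"
      by (auto simp: has_bochner_integral_iff)
  qed
  have "((\<lambda>x. (\<integral>y. indicator {0<..} y * g y * small_mass q (y / x) \<partial>lborel) / H x)
      \<longlongrightarrow> c * (- fact r)) at_top"
    using mom[of 0] mom[of 2] mom[of 1] I1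
    by (intro scaled_integral_tendsto[OF _ _ lim bnd]) (auto simp: has_bochner_integral_iff)
  from tendsto_minus[OF this]
  have *: "((\<lambda>x. - ((\<integral>y. indicator {0<..} y * g y * small_mass q (y / x) \<partial>lborel) / H x)) \<longlongrightarrow> c * fact r) at_top"
    by simp
  show ?thesis
  proof (rule Lim_transform_eventually[OF *])
    show "\<forall>\<^sub>F x in at_top. - ((\<integral>y. indicator {0<..} y * g y * small_mass q (y / x) \<partial>lborel) / H x)
        = x ^ r * laplace q (Suc r) x / H x"
      using eventually_gt_at_top[of 0]
    proof eventually_elim
      case (elim x)
      have gb: "\<bar>g y\<bar> \<le> real r * fact (r - 1) + fact r" if "y \<ge> 0" for y
      proof -
        have "\<bar>g y\<bar> \<le> real r * (y ^ (r - 1) * exp (-y)) + y ^ r * exp (-y)"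
          unfolding g_def using that by (intro order_trans[OF abs_triangle_ineq4]) simp
        also have "\<dots> \<le> real r * fact (r - 1) + fact r"
          using that by (intro add_mono mult_left_mono power_exp_le_fact) auto
        finally show ?thesis .
      qed
      define J where "J y = (\<Sum>k. pmf q k * of_bool (y / x \<le> pmf q k))" for y
      have sums: "(\<lambda>k. pmf q k * G (x * pmf q k)) sums (\<integral>y. indicator {0<..} y * g y * J y \<partial>lborel)"
        and intJ: "integrable lborel (\<lambda>y. indicator {0<..} y * g y * J y)"
      proof -
        have 1: "(G has_field_derivative g y) (at y)" for y
          unfolding G_def g_def by (auto intro!: derivative_eq_intros simp: algebra_simps)
        have 2: "isCont g y" for y unfolding g_def[abs_def] by (intro continuous_intros)
        have 3: "summable (\<lambda>k. pmf q k * pmf q k)"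
          by (rule summable_comparison_test'[OF sums_summable[OF pmf_nat_sums[of q]], of 0])
             (auto simp: mult_left_le pmf_le_1)
        have 4: "G 0 = 0" by (auto simp: G_def)
        show "(\<lambda>k. pmf q k * G (x * pmf q k)) sums (\<integral>y. indicator {0<..} y * g y * J y \<partial>lborel)"
          "integrable lborel (\<lambda>y. indicator {0<..} y * g y * J y)"
          unfolding J_def by (rule layer_cake_sums[OF _ _ 3 1 4 2 gb elim]; simp)+
      qed
      have Jeq: "J y = 1 - small_mass q (y / x)" if "y \<notin> range (\<lambda>k. x * pmf q k)" for y
      proof -
        have "of_bool (y / x \<le> pmf q k) = (1 - of_bool (pmf q k \<le> y / x) :: real)" for k
        proof -
          have "y / x \<noteq> pmf q k" using that elim by (auto simp: field_simps)
          thus ?thesis by auto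
        qed
        hence "J y = (\<Sum>k. pmf q k - pmf q k * of_bool (pmf q k \<le> y / x))"
          by (simp add: J_def right_diff_distrib)
        also have "\<dots> = (\<Sum>k. pmf q k) - small_mass q (y / x)"
          unfolding small_mass_def
          by (rule suminf_diff[symmetric]) (intro sums_summable[OF pmf_nat_sums] summable_small_mass)+
        finally show ?thesis using sums_unique[OF pmf_nat_sums[of q]] by simp
      qed
      have [measurable]: "J \<in> borel_measurable borel" unfolding J_def[abs_def] by measurable
      have intS: "integrable lborel (\<lambda>y. indicator {0<..} y * g y * small_mass q (y / x))"
      proof (rule Bochner_Integration.integrable_bound[OF g0(1)])
        show "AE y in lborel. norm (indicator {0<..} y * g y * small_mass q (y / x)) \<le> norm (indicator {0<..} y * g y)"
          by (rule AE_I2) (auto simp: abs_mult mult_left_le small_mass_le_1 small_mass_nonneg)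
      qed measurable
      have "(\<integral>y. indicator {0<..} y * g y * J y \<partial>lborel)
        = (\<integral>y. indicator {0<..} y * g y - indicator {0<..} y * g y * small_mass q (y / x) \<partial>lborel)"
      proof (rule integral_cong_AE)
        have "AE y in lborel. y \<notin> range (\<lambda>k. x * pmf q k)"
          by (rule AE_not_in) (intro countable_imp_null_set_lborel countable_image countableI_type)
        thus "AE y in lborel. indicator {0<..} y * g y * J y
            = indicator {0<..} y * g y - indicator {0<..} y * g y * small_mass q (y / x)"
          by eventually_elim (simp add: Jeq right_diff_distrib)
      qed measurable
      also have "\<dots> = - of_bool (r = 0) - (\<integral>y. indicator {0<..} y * g y * small_mass q (y / x) \<partial>lborel)"
        using g0 intS by simp
      finally have "- (\<integral>y. indicator {0<..} y * g y * small_mass q (y / x) \<partial>lborel)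
          = (\<Sum>k. pmf q k * G (x * pmf q k)) + of_bool (r = 0)"
        using sums by (simp add: sums_iff)
      also have "\<dots> = (\<Sum>k. pmf q k * G (x * pmf q k)) + (\<Sum>k. of_bool (r = 0) * pmf q k)"
        using sums_unique[OF sums_mult[OF pmf_nat_sums[of q], of "of_bool (r = 0)"]] by simp
      also have "\<dots> = (\<Sum>k. pmf q k * G (x * pmf q k) + of_bool (r = 0) * pmf q k)"
        using sums by (intro suminf_add) (auto simp: sums_iff intro!: summable_mult sums_summable[OF pmf_nat_sums])
      also have "\<dots> = (\<Sum>k. x ^ r * (pmf q k ^ Suc r * exp (- x * pmf q k)))"
        by (simp add: G_def power_mult_distrib algebra_simps)
      also have "\<dots> = x ^ r * laplace q (Suc r) x"
        unfolding laplace_def using elim by (intro suminf_mult summable_laplace) auto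
      finally show ?case by (simp only: minus_divide_left)
    qed
  qed
qed

section \<open>Scaling limits and majorants under regular variation\<close>

lemma scaled_ratio_tendsto:
  fixes B H :: "real \<Rightarrow> real"
  assumes B: "((\<lambda>x. B (1 / x) / H x) \<longlongrightarrow> c) at_top"
    and H: "((\<lambda>x. H (1 / y * x) / H x) \<longlongrightarrow> (1 / y) powr \<gamma>) at_top"
    and pos: "eventually (\<lambda>x. H x > 0) at_top" and y: "y > 0"
  shows "((\<lambda>x. B (y / x) / H x) \<longlongrightarrow> c * y powr (-\<gamma>)) at_top"
proof -
  have fl: "filterlim (\<lambda>x. 1 / y * x) at_top at_top"
    using y by (intro filterlim_tendsto_pos_mult_at_top[OF tendsto_const]) (auto simp: filterlim_ident)
  have "((\<lambda>x. B (1 / (1 / y * x)) / H (1 / y * x) * (H (1 / y * x) / H x)) \<longlongrightarrow> c * (1 / y) powr \<gamma>) at_top"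
    by (intro tendsto_mult H filterlim_compose[OF B fl])
  moreover have "\<forall>\<^sub>F x in at_top. B (1 / (1 / y * x)) / H (1 / y * x) * (H (1 / y * x) / H x) = B (y / x) / H x"
    using eventually_compose_filterlim[OF pos fl] by eventually_elim auto
  ultimately have "((\<lambda>x. B (y / x) / H x) \<longlongrightarrow> c * (1 / y) powr \<gamma>) at_top"
    by (rule Lim_transform_eventually)
  thus ?thesis using y by (simp add: powr_minus powr_divide field_simps)
qed

text \<open>Slow variation does not see the sign of a function; positivity of a normalizer is read
  off from a nonnegative quantity whose ratio to it has a positive limit.\<close>

lemma eventually_pos_of_ratio:
  fixes f H :: "real \<Rightarrow> real"
  assumes "((\<lambda>x. f x / H x) \<longlongrightarrow> c) at_top" "c > 0" "eventually (\<lambda>x. f x \<ge> 0) at_top"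
  shows "eventually (\<lambda>x. H x > 0) at_top"
  using order_tendstoD(1)[OF assms(1,2)] assms(3) by eventually_elim (auto simp: zero_less_divide_iff)

text \<open>\<open>H\<close> need not be monotone and single \<open>C a\<close> may be 0, so
  doubling is established for the sum \<open>T\<close> over all states. It is monotone,
  \<open>T (1 / x)\<close> is asymptotic to \<open>S * H x\<close> with \<open>S > 0\<close>, and so
  \<open>T (1 / (2 * x)) / T (1 / x)\<close> tends to \<open>2 powr \<alpha>\<close>, strictly below
  \<open>2 powr \<kappa>\<close>. Doubling covers \<open>y \<le> 1\<close>, monotonicity alone
  \<open>y > 1\<close>.\<close>

lemma antimono_scaling_bound:
  fixes N :: "'a::finite \<Rightarrow> real \<Rightarrow> real"
  assumes anti: "\<And>a s t. 0 < s \<Longrightarrow> s \<le> t \<Longrightarrow> N a t \<le> N a s"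
    and nonneg: "\<And>a t. 0 < t \<Longrightarrow> N a t \<ge> 0"
    and lim: "\<And>a. ((\<lambda>x. N a (1 / x) / H x) \<longlongrightarrow> C a) at_top"
    and C: "\<And>a. C a \<ge> 0" "C a0 > 0"
    and pos: "eventually (\<lambda>x. H x > 0) at_top"
    and H: "((\<lambda>x. H (2 * x) / H x) \<longlongrightarrow> 2 powr \<alpha>) at_top" and \<kappa>: "\<alpha> < \<kappa>" "0 \<le> \<kappa>"
  shows "\<exists>K. eventually (\<lambda>x. \<forall>a. \<forall>y>0. \<bar>N a (y / x) / H x\<bar> \<le> K * (y powr (-\<kappa>) + y powr 0)) at_top"
proof -
  define T where "T t = (\<Sum>a\<in>UNIV. N a t)" for t
  define S where "S = (\<Sum>a\<in>UNIV. C a)"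
  have S: "S > 0" unfolding S_def by (rule sum_pos2[of _ a0]) (use C in auto)
  have anti_T: "T t \<le> T s" if "0 < s" "s \<le> t" for s t
    unfolding T_def by (intro sum_mono anti that)
  have T0: "T t \<ge> 0" if "0 < t" for t unfolding T_def by (intro sum_nonneg nonneg that)
  have NT: "N a t \<le> T t" if "0 < t" for a t
    unfolding T_def by (rule member_le_sum) (auto intro: nonneg that)
  have limT: "((\<lambda>x. T (1 / x) / H x) \<longlongrightarrow> S) at_top"
    unfolding T_def S_def sum_divide_distrib by (intro tendsto_sum lim)
  have fl: "filterlim (\<lambda>x. 2 * x) at_top (at_top :: real filter)"
    by (intro filterlim_tendsto_pos_mult_at_top[OF tendsto_const]) (auto simp: filterlim_ident)
  have "((\<lambda>x. T (1 / (2 * x)) / H (2 * x) * (H (2 * x) / H x) / (T (1 / x) / H x)) \<longlongrightarrow> S * 2 powr \<alpha> / S) at_top"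
    using S by (intro tendsto_divide tendsto_mult H limT filterlim_compose[OF limT fl]) auto
  moreover have "S * 2 powr \<alpha> / S < 2 powr \<kappa>" using S \<kappa> by simp
  ultimately have "eventually (\<lambda>x. T (1 / (2 * x)) / H (2 * x) * (H (2 * x) / H x) / (T (1 / x) / H x) < 2 powr \<kappa>) at_top"
    by (rule order_tendstoD)
  moreover have "eventually (\<lambda>x. T (1 / x) / H x > 0) at_top"
    using order_tendstoD(1)[OF limT S] .
  ultimately have "eventually (\<lambda>x. x > 0 \<and> T (1 / (2 * x)) \<le> 2 powr \<kappa> * T (1 / x)) at_top"
    using pos eventually_compose_filterlim[OF pos fl] eventually_gt_at_top[of 0]
  proof eventually_elim
    case (elim x)
    hence "T (1 / (2 * x)) / T (1 / x) < 2 powr \<kappa>" "T (1 / x) > 0" by (auto simp: zero_less_divide_iff)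
    thus ?case using elim by (simp add: field_simps)
  qed
  then obtain x1 where x1: "\<And>x. x \<ge> x1 \<Longrightarrow> x > 0 \<and> T (1 / (2 * x)) \<le> 2 powr \<kappa> * T (1 / x)"
    by (auto simp: eventually_at_top_linorder)
  have x1_pos: "x1 > 0" using x1[of x1] by simp
  have dom: "T (y / x) \<le> 2 powr \<kappa> * (y powr (-\<kappa>) + y powr 0) * T (1 / x)" if "x \<ge> x1" "y > 0" for x y
  proof (cases "y \<le> 1")
    case True
    have "T (1 / (x * (1 / y))) \<le> 2 powr \<kappa> * (1 / y) powr \<kappa> * T (1 / x)"
    proof (rule doubling_bound[of x1 "\<lambda>x. T (1 / x)"])
      fix u v assume "x1 \<le> u" "u \<le> v"
      thus "T (1 / u) \<le> T (1 / v)" using x1_pos by (intro anti_T) (auto simp: field_simps)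
    qed (use x1_pos x1 \<kappa> that True in \<open>auto intro!: T0\<close>)
    also have "1 / (x * (1 / y)) = y / x" by simp
    also have "(1 / y) powr \<kappa> = y powr (-\<kappa>)" using that by (simp add: powr_divide powr_minus field_simps)
    also have "2 powr \<kappa> * y powr (-\<kappa>) * T (1 / x) \<le> 2 powr \<kappa> * (y powr (-\<kappa>) + y powr 0) * T (1 / x)"
      using T0[of "1 / x"] that x1_pos by (intro mult_right_mono mult_left_mono) auto
    finally show ?thesis .
  next
    case False
    have "T (y / x) \<le> T (1 / x)" using False that x1_pos by (intro anti_T) (auto simp: field_simps)
    also have "\<dots> = 1 * 1 * T (1 / x)" by simp
    also have "\<dots> \<le> 2 powr \<kappa> * (y powr (-\<kappa>) + y powr 0) * T (1 / x)"
      using T0[of "1 / x"] that x1_pos \<kappa> by (intro mult_mono) (auto intro: ge_one_powr_ge_zero)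
    finally show ?thesis .
  qed
  have "eventually (\<lambda>x. T (1 / x) / H x < S + 1) at_top" using order_tendstoD(2)[OF limT, of "S + 1"] by simp
  hence "eventually (\<lambda>x. \<forall>a. \<forall>y>0. \<bar>N a (y / x) / H x\<bar> \<le> (2 powr \<kappa> * (S + 1)) * (y powr (-\<kappa>) + y powr 0)) at_top"
    using pos eventually_ge_at_top[of x1]
  proof eventually_elim
    case (elim x)
    show ?case
    proof (intro allI impI)
      fix a y assume y: "y > (0::real)"
      have x: "x > 0" using elim x1_pos by linarith
      have "\<bar>N a (y / x) / H x\<bar> = N a (y / x) / H x" using elim x y nonneg[of "y / x" a] by simp
      also have "\<dots> \<le> T (y / x) / H x" using elim x y by (intro divide_right_mono NT) auto
      also have "\<dots> \<le> 2 powr \<kappa> * (y powr (-\<kappa>) + y powr 0) * T (1 / x) / H x"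
        using elim y by (intro divide_right_mono dom) auto
      also have "\<dots> = 2 powr \<kappa> * (y powr (-\<kappa>) + y powr 0) * (T (1 / x) / H x)" by simp
      also have "\<dots> \<le> 2 powr \<kappa> * (y powr (-\<kappa>) + y powr 0) * (S + 1)"
        using elim by (intro mult_left_mono) auto
      finally show "\<bar>N a (y / x) / H x\<bar> \<le> (2 powr \<kappa> * (S + 1)) * (y powr (-\<kappa>) + y powr 0)"
        by (simp add: mult_ac)
    qed
  qed
  thus ?thesis by blast
qed

text \<open>The doubling bound is applied to the reciprocal of the sum of all \<open>N a\<close>.\<close>

lemma mono_scaling_bound:
  fixes N :: "'a::finite \<Rightarrow> real \<Rightarrow> real"
  assumes mono: "\<And>a s t. s \<le> t \<Longrightarrow> N a s \<le> N a t"
    and nonneg: "\<And>a t. N a t \<ge> 0" and le_1: "\<And>a t. N a t \<le> 1"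
    and lim: "\<And>a. ((\<lambda>x. N a (1 / x) / H x) \<longlongrightarrow> C a) at_top"
    and C: "\<And>a. C a \<ge> 0" "C a0 > 0"
    and pos: "eventually (\<lambda>x. H x > 0) at_top"
    and H: "((\<lambda>x. H (2 * x) / H x) \<longlongrightarrow> 1 / 2) at_top"
  shows "\<exists>K. eventually (\<lambda>x. \<forall>a. \<forall>y>0. \<bar>N a (y / x) / H x\<bar> \<le> K * (y powr (-0) + y powr 2)) at_top"
proof -
  define T where "T t = (\<Sum>a\<in>UNIV. N a t)" for t
  define S where "S = (\<Sum>a\<in>UNIV. C a)"
  define n where "n = real (card (UNIV :: 'a set))"
  have S: "S > 0" unfolding S_def by (rule sum_pos2[of _ a0]) (use C in auto)
  have mono_T: "T s \<le> T t" if "s \<le> t" for s t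
    unfolding T_def by (intro sum_mono mono that)
  have T0: "T t \<ge> 0" for t unfolding T_def by (intro sum_nonneg nonneg)
  have Tn: "T t \<le> n" for t unfolding T_def n_def using sum_bounded_above[of UNIV "\<lambda>a. N a t" 1] le_1 by simp
  have NT: "N a t \<le> T t" for a t
    unfolding T_def by (rule member_le_sum) (auto intro: nonneg)
  have limT: "((\<lambda>x. T (1 / x) / H x) \<longlongrightarrow> S) at_top"
    unfolding T_def S_def sum_divide_distrib by (intro tendsto_sum lim)
  have fl: "filterlim (\<lambda>x. 2 * x) at_top (at_top :: real filter)"
    by (intro filterlim_tendsto_pos_mult_at_top[OF tendsto_const]) (auto simp: filterlim_ident)
  have "((\<lambda>x. T (1 / (2 * x)) / H (2 * x) * (H (2 * x) / H x) / (T (1 / x) / H x)) \<longlongrightarrow> S * (1 / 2) / S) at_top"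
    using S by (intro tendsto_divide tendsto_mult H limT filterlim_compose[OF limT fl]) auto
  \<comment> \<open>The ratio tends to 1/2; the weaker bound 1/4 amounts to doubling with exponent 2
    for the reciprocal.\<close>
  moreover have "1 / 4 < S * (1 / 2) / S" using S by simp
  ultimately have "eventually (\<lambda>x. 1 / 4 < T (1 / (2 * x)) / H (2 * x) * (H (2 * x) / H x) / (T (1 / x) / H x)) at_top"
    by (rule order_tendstoD)
  moreover have "eventually (\<lambda>x. T (1 / x) / H x > 0) at_top"
    using order_tendstoD(1)[OF limT S] .
  ultimately have "eventually (\<lambda>x. x > 0 \<and> T (1 / x) > 0 \<and> T (1 / x) \<le> 4 * T (1 / (2 * x))) at_top"
    using pos eventually_compose_filterlim[OF pos fl] eventually_gt_at_top[of 0]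
  proof eventually_elim
    case (elim x)
    hence "1 / 4 < T (1 / (2 * x)) / T (1 / x)" "T (1 / x) > 0" by (auto simp: zero_less_divide_iff)
    thus ?case using elim by (simp add: field_simps)
  qed
  then obtain x1 where x1: "\<And>x. x \<ge> x1 \<Longrightarrow> x > 0 \<and> T (1 / x) > 0 \<and> T (1 / x) \<le> 4 * T (1 / (2 * x))"
    by (auto simp: eventually_at_top_linorder)
  have x1_pos: "x1 > 0" and Tx1: "T (1 / x1) > 0" using x1[of x1] by auto
  have dbl: "T (1 / x) \<le> 4 * z\<^sup>2 * T (1 / (x * z))" if "x \<ge> x1" "z \<ge> 1" for x z
  proof -
    have "1 / T (1 / (x * z)) \<le> 2 powr 2 * z powr 2 * (1 / T (1 / x))"
    proof (rule doubling_bound[of x1 "\<lambda>x. 1 / T (1 / x)"])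
      fix u v assume uv: "x1 \<le> u" "u \<le> v"
      hence "T (1 / v) \<le> T (1 / u)" using x1_pos by (intro mono_T) (auto simp: field_simps)
      thus "1 / T (1 / u) \<le> 1 / T (1 / v)" using uv x1[of v] by (intro divide_left_mono) auto
    next
      fix u assume u: "x1 \<le> u"
      thus "1 / T (1 / (2 * u)) \<le> 2 powr 2 * (1 / T (1 / u))"
        using x1[of u] x1[of "2 * u"] x1_pos by (simp add: field_simps)
    qed (use x1_pos that T0 in \<open>auto\<close>)
    moreover have "x * 1 \<le> x * z" using that x1_pos by (intro mult_left_mono) auto
    hence "x1 \<le> x * z" using that by simp
    ultimately show ?thesis using x1[of "x * z"] x1[of x] that by (simp add: field_simps)
  qed
  define K where "K = 4 + n * 4 / T (1 / x1)"
  have n0: "n \<ge> 0" by (simp add: n_def)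
  have K: "K \<ge> 4" "K \<ge> n * 4 / T (1 / x1)" unfolding K_def using n0 Tx1 x1_pos by (auto simp: field_simps)
  have dom: "T (y / x) \<le> K * (y powr (-0) + y powr 2) * T (1 / x)" if xy: "x \<ge> x1" "y > 0" for x y
  proof -
    have Tx: "T (1 / x) > 0" using x1[of x] xy by simp
    have x0: "x > 0" using xy x1_pos by simp
    \<comment> \<open>In the last range \<open>x / y\<close> falls below the point \<open>x1\<close>
      from which doubling holds. There \<open>T \<le> n\<close> is used, while doubling from
      \<open>x1\<close> to \<open>x\<close> shows that \<open>T (1 / x)\<close> is at least a
      positive constant over \<open>y\<^sup>2\<close>. The second summand of \<open>K\<close> is
      made for this range.\<close>
    consider "y \<le> 1" | "y > 1" "x / y \<ge> x1" | "y > 1" "x / y < x1" by linarith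
    thus ?thesis
    proof cases
      case 1
      have "T (y / x) \<le> T (1 / x)" using 1 xy x0 by (intro mono_T) (auto simp: field_simps)
      also have "\<dots> = 1 * 1 * T (1 / x)" by simp
      also have "\<dots> \<le> K * (y powr (-0) + y powr 2) * T (1 / x)"
        using Tx K xy by (intro mult_mono) auto
      finally show ?thesis .
    next
      case 2
      have "T (1 / (x / y)) \<le> 4 * y\<^sup>2 * T (1 / (x / y * y))" using 2 by (intro dbl) auto
      also have "x / y * y = x" using xy by simp
      also have "4 * y\<^sup>2 * T (1 / x) \<le> K * (y powr (-0) + y powr 2) * T (1 / x)"
        using Tx K xy by (intro mult_right_mono mult_mono) auto
      finally show ?thesis by simp
    next
      case 3
      have "T (1 / x1) \<le> 4 * (x / x1)\<^sup>2 * T (1 / (x1 * (x / x1)))" using x1_pos xy by (intro dbl) auto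
      also have "x1 * (x / x1) = x" using x1_pos by simp
      also have "4 * (x / x1)\<^sup>2 * T (1 / x) \<le> 4 * y\<^sup>2 * T (1 / x)"
        using 3 xy x1_pos Tx x0 by (intro mult_right_mono mult_left_mono power_mono) (auto simp: field_simps)
      finally have "1 \<le> 4 / T (1 / x1) * y\<^sup>2 * T (1 / x)" using Tx1 by (simp add: field_simps)
      hence "n * 1 \<le> n * (4 / T (1 / x1) * y\<^sup>2 * T (1 / x))" using n0 by (intro mult_left_mono) auto
      hence "T (y / x) \<le> n * 4 / T (1 / x1) * y\<^sup>2 * T (1 / x)" using Tn[of "y / x"] by (simp add: mult_ac)
      also have "\<dots> \<le> K * (y powr (-0) + y powr 2) * T (1 / x)"
        using Tx K xy n0 Tx1 by (intro mult_right_mono mult_mono) auto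
      finally show ?thesis .
    qed
  qed
  have "eventually (\<lambda>x. T (1 / x) / H x < S + 1) at_top" using order_tendstoD(2)[OF limT, of "S + 1"] by simp
  hence "eventually (\<lambda>x. \<forall>a. \<forall>y>0. \<bar>N a (y / x) / H x\<bar> \<le> (K * (S + 1)) * (y powr (-0) + y powr 2)) at_top"
    using pos eventually_ge_at_top[of x1]
  proof eventually_elim
    case (elim x)
    show ?case
    proof (intro allI impI)
      fix a y assume y: "y > (0::real)"
      have x: "x > 0" using elim x1_pos by linarith
      have "\<bar>N a (y / x) / H x\<bar> = N a (y / x) / H x" using elim x y nonneg[of a "y / x"] by simp
      also have "\<dots> \<le> T (y / x) / H x" using elim x y by (intro divide_right_mono NT) auto
      also have "\<dots> \<le> K * (y powr (-0) + y powr 2) * T (1 / x) / H x"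
        using elim y by (intro divide_right_mono dom) auto
      also have "\<dots> = K * (y powr (-0) + y powr 2) * (T (1 / x) / H x)" by simp
      also have "\<dots> \<le> K * (y powr (-0) + y powr 2) * (S + 1)"
        using elim K by (intro mult_left_mono) auto
      finally show "\<bar>N a (y / x) / H x\<bar> \<le> (K * (S + 1)) * (y powr (-0) + y powr 2)"
        by (simp only: mult_ac)
    qed
  qed
  thus ?thesis by blast
qed

section \<open>Laplace asymptotics of regularly varying letter distributions\<close>

lemma large_count_RV:
  assumes rv: "RV \<alpha> C l p" and supp: "set_pmf (p a) \<subseteq> {1..}"
  shows "((\<lambda>x. large_count (p a) (1 / x) / (x powr \<alpha> * l x)) \<longlongrightarrow> C a) at_top"
proof -
  have "((\<lambda>\<epsilon>. real (counting_fun p a \<epsilon>) / (\<epsilon> powr (-\<alpha>) * l (1 / \<epsilon>))) \<longlongrightarrow> C a) (at_right 0)"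
    using rv by (simp add: RV_def)
  hence "((\<lambda>x. real (counting_fun p a (inverse x)) / (inverse x powr (-\<alpha>) * l (1 / inverse x))) \<longlongrightarrow> C a) at_top"
    by (simp add: filterlim_at_right_to_top)
  moreover have "\<forall>\<^sub>F x in at_top. real (counting_fun p a (inverse x)) / (inverse x powr (-\<alpha>) * l (1 / inverse x))
      = large_count (p a) (1 / x) / (x powr \<alpha> * l x)"
    using eventually_gt_at_top[of 0]
    by eventually_elim (simp add: counting_fun_eq_large_count[where p = p and a = a, OF supp] powr_minus_divide powr_divide inverse_eq_divide)
  ultimately show ?thesis by (rule Lim_transform_eventually)
qed

lemma small_mass_RV:
  assumes rv: "RV_zero_tail D l0 p" and supp: "set_pmf (p a) \<subseteq> {1..}"
  shows "((\<lambda>x. small_mass (p a) (1 / x) / (l0 x / x)) \<longlongrightarrow> D a) at_top"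
proof -
  have "((\<lambda>\<epsilon>. small_mass (p a) \<epsilon> / (\<epsilon> * l0 (1 / \<epsilon>))) \<longlongrightarrow> D a) (at_right 0)"
    using rv by (simp only: RV_zero_tail_def infsum_eq_small_mass[where p = p and a = a, OF supp, symmetric])
  hence "((\<lambda>x. small_mass (p a) (inverse x) / (inverse x * l0 (1 / inverse x))) \<longlongrightarrow> D a) at_top"
    by (simp add: filterlim_at_right_to_top)
  thus ?thesis by (simp add: field_simps)
qed

lemma powr_slowly_varying_scaling:
  assumes "slowly_varying l" "z > 0"
  shows "((\<lambda>x. ((z * x) powr \<gamma> * l (z * x)) / (x powr \<gamma> * l x)) \<longlongrightarrow> z powr \<gamma>) at_top"
proof -
  have "((\<lambda>x. z powr \<gamma> * (l (z * x) / l x)) \<longlongrightarrow> z powr \<gamma> * 1) at_top"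
    using assms by (intro tendsto_mult tendsto_const) (auto simp: slowly_varying_def)
  moreover have "\<forall>\<^sub>F x in at_top. z powr \<gamma> * (l (z * x) / l x) = ((z * x) powr \<gamma> * l (z * x)) / (x powr \<gamma> * l x)"
    using eventually_gt_at_top[of 0] by eventually_elim (use assms in \<open>simp add: powr_mult\<close>)
  ultimately show ?thesis by (simp add: Lim_transform_eventually)
qed

lemma RV_normalizer_pos:
  assumes rv: "RV \<alpha> C l p" and supp: "\<And>a. set_pmf (p a) \<subseteq> {1..}"
  shows "eventually (\<lambda>x. x powr \<alpha> * l x > 0) at_top"
proof -
  obtain a where "C a > 0" using rv by (auto simp: RV_def order_less_le)
  thus ?thesis
    by (rule eventually_pos_of_ratio[OF large_count_RV[OF rv supp]])
       (use eventually_gt_at_top[of 0] in eventually_elim, simp add: large_count_nonneg)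
qed

lemma laplace_RV:
  fixes p :: "'a::finite \<Rightarrow> nat pmf"
  assumes rv: "RV \<alpha> C l p" and supp: "\<And>a. set_pmf (p a) \<subseteq> {1..}"
    and \<alpha>: "0 \<le> \<alpha>" "\<alpha> < real r + 1"
  shows "((\<lambda>x. x ^ Suc r * laplace (p a) (Suc r) x / (x powr \<alpha> * l x)) \<longlongrightarrow> C a * (\<alpha> * Gamma (real r + 1 - \<alpha>))) at_top"
proof -
  define H where "H x = x powr \<alpha> * l x" for x
  obtain a0 where C: "C a0 > 0" "\<And>a. C a \<ge> 0" using rv by (auto simp: RV_def order_less_le)
  have sv: "slowly_varying l" using rv by (simp add: RV_def)
  have pos: "eventually (\<lambda>x. H x > 0) at_top" unfolding H_def by (rule RV_normalizer_pos[OF rv supp])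
  have lim: "((\<lambda>x. large_count (p a) (1 / x) / H x) \<longlongrightarrow> C a) at_top" for a
    unfolding H_def by (rule large_count_RV[OF rv supp])
  have scale: "((\<lambda>x. H (z * x) / H x) \<longlongrightarrow> z powr \<alpha>) at_top" if "z > 0" for z
    unfolding H_def by (rule powr_slowly_varying_scaling[OF sv that])
  \<comment> \<open>Any exponent strictly in between works: above \<open>\<alpha>\<close> for the
    doubling bound, below \<open>real r + 1\<close> for integrability at 0.\<close>
  define \<kappa> where "\<kappa> = (\<alpha> + (real r + 1)) / 2"
  have \<kappa>: "\<alpha> < \<kappa>" "0 \<le> \<kappa>" "\<kappa> < real r + 1" using \<alpha> by (auto simp: \<kappa>_def)
  obtain K where K: "eventually (\<lambda>x. \<forall>a. \<forall>y>0. \<bar>large_count (p a) (y / x) / H x\<bar> \<le> K * (y powr (-\<kappa>) + y powr 0)) at_top"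
    using antimono_scaling_bound[of "\<lambda>a. large_count (p a)" H C a0 \<alpha> \<kappa>] large_count_antimono large_count_nonneg
      lim C pos scale[of 2] \<kappa> by auto
  have "((\<lambda>x. x ^ Suc r * laplace (p a) (Suc r) x / H x) \<longlongrightarrow> C a * (\<alpha> * Gamma (real r + 1 - \<alpha>))) at_top"
  proof (rule laplace_via_large_count[OF _ _ \<alpha>(2) \<kappa>(3)])
    fix y :: real assume "y > 0"
    thus "((\<lambda>x. large_count (p a) (y / x) / H x) \<longlongrightarrow> C a * y powr (-\<alpha>)) at_top"
      by (intro scaled_ratio_tendsto lim pos scale) auto
  next
    show "eventually (\<lambda>x. \<forall>y>0. \<bar>large_count (p a) (y / x) / H x\<bar> \<le> K * (y powr (-\<kappa>) + y powr 0)) at_top"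
      using K by eventually_elim auto
  qed
  thus ?thesis by (simp only: H_def)
qed

lemma laplace_RV_zero_tail:
  fixes p :: "'a::finite \<Rightarrow> nat pmf"
  assumes rv: "RV_zero_tail D l0 p" and supp: "\<And>a. set_pmf (p a) \<subseteq> {1..}"
  shows "eventually (\<lambda>x. l0 x / x > 0) at_top"
    and "z > 0 \<Longrightarrow> ((\<lambda>x. (l0 (z * x) / (z * x)) / (l0 x / x)) \<longlongrightarrow> z powr (-1)) at_top"
    and "((\<lambda>x. x ^ r * laplace (p a) (Suc r) x / (l0 x / x)) \<longlongrightarrow> D a * fact r) at_top"
proof -
  define H where "H x = l0 x / x" for x
  obtain a0 where D: "D a0 > 0" "\<And>a. D a \<ge> 0" using rv by (auto simp: RV_zero_tail_def order_less_le)
  have sv: "slowly_varying l0" using rv by (simp add: RV_zero_tail_def)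
  have lim: "((\<lambda>x. small_mass (p a) (1 / x) / H x) \<longlongrightarrow> D a) at_top" for a
    unfolding H_def by (rule small_mass_RV[OF rv supp])
  have pos: "eventually (\<lambda>x. H x > 0) at_top"
    by (rule eventually_pos_of_ratio[OF lim D(1)]) (simp add: small_mass_nonneg)
  have scale: "((\<lambda>x. H (z * x) / H x) \<longlongrightarrow> z powr (-1)) at_top" if "z > 0" for z
  proof (rule Lim_transform_eventually[OF powr_slowly_varying_scaling[OF sv that, of "-1"]])
    show "\<forall>\<^sub>F x in at_top. (z * x) powr -1 * l0 (z * x) / (x powr -1 * l0 x) = H (z * x) / H x"
      using eventually_gt_at_top[of 0]
      by eventually_elim (use that in \<open>simp add: H_def powr_minus_divide field_simps\<close>)
  qed
  obtain K where K: "eventually (\<lambda>x. \<forall>a. \<forall>y>0. \<bar>small_mass (p a) (y / x) / H x\<bar> \<le> K * (y powr (-0) + y powr 2)) at_top"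
    using mono_scaling_bound[of "\<lambda>a. small_mass (p a)" H D a0] small_mass_mono small_mass_nonneg small_mass_le_1
      lim D pos scale[of 2] by (auto simp: powr_minus_divide)
  have "((\<lambda>x. x ^ r * laplace (p a) (Suc r) x / H x) \<longlongrightarrow> D a * fact r) at_top"
  proof (rule laplace_via_small_mass)
    fix y :: real assume "y > 0"
    thus "((\<lambda>x. small_mass (p a) (y / x) / H x) \<longlongrightarrow> D a * y powr 1) at_top"
      using scaled_ratio_tendsto[OF lim[of a] scale[of "1 / y"] pos] by simp
  next
    show "eventually (\<lambda>x. \<forall>y>0. \<bar>small_mass (p a) (y / x) / H x\<bar> \<le> K * (y powr (-0) + y powr 2)) at_top"
      using K by eventually_elim auto
  qed
  thus "((\<lambda>x. x ^ r * laplace (p a) (Suc r) x / (l0 x / x)) \<longlongrightarrow> D a * fact r) at_top" by (simp only: H_def)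
  show "eventually (\<lambda>x. l0 x / x > 0) at_top" using pos by (simp only: H_def)
  show "z > 0 \<Longrightarrow> ((\<lambda>x. (l0 (z * x) / (z * x)) / (l0 x / x)) \<longlongrightarrow> z powr (-1)) at_top"
    using scale by (simp only: H_def)
qed

section \<open>The boundary case \<alpha> = 1, r = 0\<close>

text \<open>Integral form of l'Hopital's rule: beyond some point \<open>f\<close> differs from
  \<open>c * g\<close> by at most a small multiple of \<open>g\<close>, and this survives
  integration over \<open>{x..}\<close>.\<close>

lemma tail_integral_ratio:
  fixes f g :: "real \<Rightarrow> real"
  assumes f: "eventually (\<lambda>x. set_integrable lborel {x..} f) at_top"
    and g: "eventually (\<lambda>x. set_integrable lborel {x..} g) at_top"
    and pos: "eventually (\<lambda>x. g x > 0) at_top"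
    and lim: "((\<lambda>x. f x / g x) \<longlongrightarrow> c) at_top"
  shows "eventually (\<lambda>x. (LBINT u:{x..}. g u) > 0) at_top"
    and "((\<lambda>x. (LBINT u:{x..}. f u) / (LBINT u:{x..}. g u)) \<longlongrightarrow> c) at_top"
proof -
  have ball: "eventually (\<lambda>x. \<forall>u\<ge>x. P u) at_top" if "eventually P at_top" for P :: "real \<Rightarrow> bool"
    using that unfolding eventually_at_top_linorder by (meson order_trans)
  show gpos: "eventually (\<lambda>x. (LBINT u:{x..}. g u) > 0) at_top"
    using ball[OF pos] g
  proof eventually_elim
    case (elim x)
    have "(LBINT u:{x..}. g u) \<ge> 0"
      unfolding set_lebesgue_integral_def using elim(1)
      by (intro Bochner_Integration.integral_nonneg) (auto split: split_indicator intro: less_imp_le)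
    moreover have "(LBINT u:{x..}. g u) \<noteq> 0"
    proof
      assume "(LBINT u:{x..}. g u) = 0"
      hence "AE u in lborel. indicator {x..} u *\<^sub>R g u = 0"
        using elim unfolding set_lebesgue_integral_def set_integrable_def
        by (subst (asm) integral_nonneg_eq_0_iff_AE) (auto split: split_indicator intro: less_imp_le)
      hence "AE u in lborel. u \<notin> {x..x+1}"
        by eventually_elim (use elim(1) in \<open>force split: split_indicator_asm\<close>)
      hence "emeasure lborel {x..x+1} = 0"
        by (subst (asm) AE_iff_measurable[of "{x..x+1}"]) auto
      thus False by simp
    qed
    ultimately show ?case by simp
  qed
  show "((\<lambda>x. (LBINT u:{x..}. f u) / (LBINT u:{x..}. g u)) \<longlongrightarrow> c) at_top"
  proof (rule tendstoI)
    fix e :: real assume e: "e > 0"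
    have "eventually (\<lambda>x. dist (f x / g x) c < e / 2) at_top" using lim e by (intro tendstoD) auto
    hence "eventually (\<lambda>x. \<bar>f x - c * g x\<bar> \<le> e / 2 * g x) at_top"
      using pos
    proof eventually_elim
      case (elim x)
      have "\<bar>f x / g x - c\<bar> * g x \<le> e / 2 * g x"
        using elim by (intro mult_right_mono) (auto simp: dist_real_def)
      also have "\<bar>f x / g x - c\<bar> * g x = \<bar>(f x / g x - c) * g x\<bar>" using elim by (simp add: abs_mult)
      also have "(f x / g x - c) * g x = f x - c * g x" using elim by (simp add: field_simps)
      finally show ?case .
    qed
    from ball[OF this] show "eventually (\<lambda>x. dist ((LBINT u:{x..}. f u) / (LBINT u:{x..}. g u)) c < e) at_top"
      using f g gpos
    proof eventually_elim
      case (elim x)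
      define I where "I = (LBINT u:{x..}. g u)"
      have I: "I > 0" using elim by (simp add: I_def)
      have "(LBINT u:{x..}. f u) - c * I = (LBINT u:{x..}. f u - c * g u)"
        unfolding I_def using elim by (subst set_integral_diff) (auto intro: set_integrable_mult_right)
      hence "\<bar>(LBINT u:{x..}. f u) - c * I\<bar> = norm (LBINT u:{x..}. f u - c * g u)" by simp
      also have "\<dots> \<le> (LBINT u:{x..}. norm (f u - c * g u))"
        unfolding set_lebesgue_integral_def
        by (rule order_trans[OF integral_norm_bound]) (auto intro!: eq_refl Bochner_Integration.integral_cong simp: abs_mult)
      also have "\<dots> \<le> (LBINT u:{x..}. e / 2 * g u)"
        using elim by (intro set_integral_mono set_integrable_norm set_integral_diff set_integrable_mult_right) auto
      also have "\<dots> = e / 2 * I" by (simp add: I_def)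
      finally have "\<bar>(LBINT u:{x..}. f u) / I - c\<bar> \<le> e / 2"
        using I by (simp add: abs_le_iff field_simps)
      thus ?case using e by (simp add: dist_real_def I_def)
    qed
  qed
qed

text \<open>Integration term by term; all terms are nonnegative and their integrals sum to
  \<open>laplace q 1 x\<close>, which justifies the exchange.\<close>

lemma laplace_tail_integral:
  assumes x: "x > 0"
  shows "set_integrable lborel {x..} (laplace q 2)"
    and "(LBINT u:{x..}. laplace q 2 u) = laplace q 1 x"
proof -
  define f where "f k u = indicator {x..} u * (pmf q k ^ 2 * exp (- u * pmf q k))" for k u
  have hbi: "has_bochner_integral lborel (f k) (pmf q k ^ 1 * exp (- x * pmf q k))" for k
  proof (cases "pmf q k = 0")
    case True
    thus ?thesis by (simp add: f_def[abs_def] has_bochner_integral_zero)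
  next
    case False
    hence p: "pmf q k > 0" using pmf_nonneg[of q k] by linarith
    have lim: "((\<lambda>u. - pmf q k * exp (- u * pmf q k)) \<longlongrightarrow> 0) at_top"
    proof -
      have "filterlim (\<lambda>u. u * pmf q k) at_top at_top"
        using p by (intro filterlim_at_top_mult_tendsto_pos[OF tendsto_const]) (auto simp: filterlim_ident)
      hence "filterlim (\<lambda>u. - (u * pmf q k)) at_bot at_top"
        by (simp add: filterlim_uminus_at_bot)
      from tendsto_mult_left[OF filterlim_compose[OF exp_at_bot this], of "- pmf q k"] show ?thesis
        by simp
    qed
    have "(\<integral>\<^sup>+u. ennreal (pmf q k ^ 2 * exp (- u * pmf q k)) * indicator {x..} u \<partial>lborel)
        = 0 - (- pmf q k * exp (- x * pmf q k))"
      by (rule nn_integral_FTC_atLeast[OF _ _ _ lim])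
         (auto intro!: derivative_eq_intros simp: power2_eq_square)
    hence "(\<integral>\<^sup>+u. ennreal (f k u) \<partial>lborel) = ennreal (pmf q k ^ 1 * exp (- x * pmf q k))"
      by (simp add: f_def nn_integral_set_ennreal mult.commute)
         (simp add: mult.commute[of "indicator _ _"] ennreal_mult ennreal_indicator mult.assoc)
    thus ?thesis by (intro has_bochner_integral_nn_integral) (auto simp: f_def[abs_def])
  qed
  have int: "integrable lborel (f k)" for k using hbi[of k] by (auto simp: has_bochner_integral_iff)
  have fsum: "summable (\<lambda>k. norm (f k u))" for u
    using summable_laplace[of 2 u q] x by (cases "u \<ge> x") (auto simp: f_def abs_mult)
  have nsum: "summable (\<lambda>k. \<integral>u. norm (f k u) \<partial>lborel)"
  proof -
    have "(\<integral>u. norm (f k u) \<partial>lborel) = pmf q k ^ 1 * exp (- x * pmf q k)" for k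
    proof -
      have "(\<integral>u. norm (f k u) \<partial>lborel) = (\<integral>u. f k u \<partial>lborel)"
        by (rule Bochner_Integration.integral_cong) (auto simp: f_def abs_mult)
      thus ?thesis using hbi[of k] by (simp add: has_bochner_integral_iff)
    qed
    thus ?thesis using summable_laplace[of 1 x q] x by simp
  qed
  have eq: "(\<Sum>k. f k u) = indicator {x..} u *\<^sub>R laplace q 2 u" for u
    by (cases "u \<ge> x") (auto simp: f_def laplace_def)
  have "integrable lborel (\<lambda>u. \<Sum>k. f k u)"
    by (rule integrable_suminf[OF int _ nsum]) (use fsum in auto)
  thus "set_integrable lborel {x..} (laplace q 2)" by (simp add: set_integrable_def eq)
  have "(\<lambda>k. integral\<^sup>L lborel (f k)) sums (\<integral>u. (\<Sum>k. f k u) \<partial>lborel)"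
    by (rule sums_integral[OF int _ nsum]) (use fsum in auto)
  hence "(\<lambda>k. pmf q k ^ 1 * exp (- x * pmf q k)) sums (LBINT u:{x..}. laplace q 2 u)"
    using hbi by (simp add: has_bochner_integral_iff eq set_lebesgue_integral_def)
  thus "(LBINT u:{x..}. laplace q 2 u) = laplace q 1 x" by (simp add: sums_iff laplace_def)
qed

lemma laplace_pos:
  assumes s: "s \<ge> 1" and x: "x \<ge> 0"
  shows "laplace q s x > 0"
proof -
  obtain k where "k \<in> set_pmf q" using set_pmf_not_empty[of q] by blast
  hence "pmf q k > 0" by (simp add: pmf_positive)
  thus ?thesis unfolding laplace_def
    by (intro suminf_pos2[of _ k] summable_laplace s x) auto
qed

text \<open>
  The case \<open>\<alpha> = 1\<close>, \<open>r = 0\<close> is the integral over \<open>{x..}\<close> of the case \<open>\<alpha> = 1\<close>, \<open>r = 1\<close>, since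
  \<open>laplace q 2\<close> is minus the derivative of \<open>laplace q 1\<close>.
\<close>

lemma laplace_RV_one:
  fixes p :: "'a::finite \<Rightarrow> nat pmf"
  assumes rv: "RV 1 C l p" and supp: "\<And>a. set_pmf (p a) \<subseteq> {1..}"
  shows "eventually (\<lambda>x. (LBINT u:{x..}. l u / u) > 0) at_top"
    and "z > 0 \<Longrightarrow> ((\<lambda>x. (LBINT u:{z * x..}. l u / u) / (LBINT u:{x..}. l u / u)) \<longlongrightarrow> 1) at_top"
    and "((\<lambda>x. laplace (p a) 1 x / (LBINT u:{x..}. l u / u)) \<longlongrightarrow> C a) at_top"
proof -
  define f where "f u = l u / u" for u
  obtain a0 where C: "C a0 > 0" using rv by (auto simp: RV_def order_less_le)
  have sv: "slowly_varying l" using rv by (simp add: RV_def)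
  have fpos: "eventually (\<lambda>x. f x > 0) at_top"
    using RV_normalizer_pos[OF rv supp] eventually_gt_at_top[of 0]
    by eventually_elim (auto simp: f_def zero_less_mult_iff)
  have W2: "((\<lambda>x. laplace (p a) 2 x / f x) \<longlongrightarrow> C a) at_top" for a
  proof -
    have "((\<lambda>x. x ^ Suc 1 * laplace (p a) (Suc 1) x / (x powr 1 * l x)) \<longlongrightarrow> C a * (1 * Gamma (real 1 + 1 - 1))) at_top"
      by (rule laplace_RV[OF rv supp]) auto
    moreover have "\<forall>\<^sub>F x in at_top. x ^ Suc 1 * laplace (p a) (Suc 1) x / (x powr 1 * l x) = laplace (p a) 2 x / f x"
      using eventually_gt_at_top[of 0] by eventually_elim (simp add: f_def numeral_2_eq_2)
    ultimately show ?thesis by (simp add: Lim_transform_eventually)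
  qed
  have intW: "eventually (\<lambda>x. set_integrable lborel {x..} (laplace (p a) 2)) at_top" for a
    using eventually_gt_at_top[of 0] by eventually_elim (rule laplace_tail_integral)
  have meas: "set_borel_measurable lborel {x..} f" if "x > 0" for x
  proof -
    have "(\<lambda>u. indicator {0<..} u *\<^sub>R l u) \<in> borel_measurable borel"
      using sv by (simp add: slowly_varying_def borel_measurable_restrict_space_iff)
    hence [measurable]: "(\<lambda>u. indicator {0<..} u * l u) \<in> borel_measurable borel" by simp
    have "(\<lambda>u. indicator {x..} u * ((indicator {0<..} u * l u) / u)) \<in> borel_measurable borel" by measurable
    also have "(\<lambda>u. indicator {x..} u * ((indicator {0<..} u * l u) / u)) = (\<lambda>u. indicator {x..} u *\<^sub>R f u)"
      using that by (auto simp: fun_eq_iff f_def split: split_indicator)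
    finally show ?thesis by (simp add: set_borel_measurable_def)
  qed
  \<comment> \<open>Integrability of \<open>l u / u\<close> at infinity has to be derived:
    \<open>laplace (p a0) 2\<close> is integrable there and asymptotic to \<open>C a0\<close> times
    this function, with \<open>C a0 > 0\<close>.\<close>
  have intf: "eventually (\<lambda>x. set_integrable lborel {x..} f) at_top"
  proof -
    have "eventually (\<lambda>x. C a0 / 2 < laplace (p a0) 2 x / f x) at_top"
      using C by (intro order_tendstoD(1)[OF W2]) simp
    hence "eventually (\<lambda>x. x > 0 \<and> norm (f x) \<le> norm (2 / C a0 * laplace (p a0) 2 x)) at_top"
      using fpos eventually_gt_at_top[of 0]
    proof eventually_elim
      case (elim x)
      hence "f x \<le> 2 / C a0 * laplace (p a0) 2 x" using C by (simp add: field_simps)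
      hence "f x \<le> norm (2 / C a0 * laplace (p a0) 2 x)" by (rule order_trans) (simp only: real_norm_def abs_ge_self)
      thus ?case using elim by simp
    qed
    then obtain x0 where x0: "\<And>x. x \<ge> x0 \<Longrightarrow> x > 0 \<and> norm (f x) \<le> norm (2 / C a0 * laplace (p a0) 2 x)"
      by (auto simp: eventually_at_top_linorder)
    show ?thesis using eventually_ge_at_top[of x0]
    proof eventually_elim
      case (elim x)
      have x: "x > 0" using x0[OF elim] by simp
      have "set_integrable lborel {x..} (\<lambda>u. 2 / C a0 * laplace (p a0) 2 u)"
        by (intro set_integrable_mult_right laplace_tail_integral x)
      thus ?case
        by (rule set_integrable_bound[OF _ meas[OF x]]) (use x0 elim in \<open>auto intro!: AE_I2\<close>)
    qed
  qed
  from tail_integral_ratio[OF intW[of a] intf fpos W2]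
  have pos: "eventually (\<lambda>x. (LBINT u:{x..}. f u) > 0) at_top"
    and lim: "((\<lambda>x. (LBINT u:{x..}. laplace (p a) 2 u) / (LBINT u:{x..}. f u)) \<longlongrightarrow> C a) at_top" by auto
  show "eventually (\<lambda>x. (LBINT u:{x..}. l u / u) > 0) at_top" using pos by (simp only: f_def)
  show "((\<lambda>x. laplace (p a) 1 x / (LBINT u:{x..}. l u / u)) \<longlongrightarrow> C a) at_top"
    by (rule Lim_transform_eventually[OF lim])
       (use eventually_gt_at_top[of 0] in eventually_elim, simp add: laplace_tail_integral f_def)
  assume z: "z > 0"
  have fl: "filterlim (\<lambda>x. z * x) at_top at_top"
    using z by (intro filterlim_tendsto_pos_mult_at_top[OF tendsto_const]) (auto simp: filterlim_ident)
  \<comment> \<open>Substituting \<open>z * u\<close> for \<open>u\<close> turns the integral from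
    \<open>z * x\<close> into one from \<open>x\<close>, so that the integrands can again be
    compared pointwise.\<close>
  have ind: "indicator {z * x..} (0 + z * u) = (indicator {x..} u :: real)" for x u
    using z by (auto split: split_indicator)
  have intz: "eventually (\<lambda>x. set_integrable lborel {x..} (\<lambda>u. z * f (z * u))) at_top"
    using eventually_compose_filterlim[OF intf fl]
  proof eventually_elim
    case (elim x)
    hence "integrable lborel (\<lambda>u. indicator {z * x..} (0 + z * u) *\<^sub>R f (0 + z * u))"
      unfolding set_integrable_def using z by (intro lborel_integrable_real_affine) auto
    thus ?case unfolding ind by (intro set_integrable_mult_right) (simp add: set_integrable_def)
  qed
  have eqz: "(LBINT u:{z * x..}. f u) = (LBINT u:{x..}. z * f (z * u))" for x
    unfolding set_integral_mult_right set_lebesgue_integral_def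
    using z by (subst lborel_integral_real_affine[of z _ 0]) (auto simp: ind[simplified])
  have "((\<lambda>x. (z * f (z * x)) / f x) \<longlongrightarrow> 1) at_top"
  proof (rule Lim_transform_eventually)
    show "((\<lambda>x. l (z * x) / l x) \<longlongrightarrow> 1) at_top" using sv z by (simp add: slowly_varying_def)
    show "\<forall>\<^sub>F x in at_top. l (z * x) / l x = (z * f (z * x)) / f x"
      using eventually_gt_at_top[of 0] by eventually_elim (use z in \<open>simp add: f_def\<close>)
  qed
  from tail_integral_ratio(2)[OF intz intf fpos this]
  show "((\<lambda>x. (LBINT u:{z * x..}. l u / u) / (LBINT u:{x..}. l u / u)) \<longlongrightarrow> 1) at_top"
    unfolding eqz[symmetric] unfolding f_def .
qed

text \<open>The only facts about \<open>norm_fun\<close> used afterwards: whichever of its three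
  formulas applies, it is eventually positive, regularly varying of index
  \<open>\<alpha> - 1\<close> and matched to the Laplace transforms.\<close>

lemma norm_fun_asymptotics:
  fixes p :: "'a::finite \<Rightarrow> nat pmf"
  assumes supp: "\<And>a. set_pmf (p a) \<subseteq> {1..}" and \<alpha>: "0 \<le> \<alpha>" "\<alpha> \<le> 1"
    and rv: "RV \<alpha> C l p" and rv0: "\<alpha> = 0 \<Longrightarrow> RV_zero_tail D l0 p"
  shows "eventually (\<lambda>x. norm_fun l l0 \<alpha> r x > 0) at_top"
    and "z > 0 \<Longrightarrow> ((\<lambda>x. norm_fun l l0 \<alpha> r (z * x) / norm_fun l l0 \<alpha> r x) \<longlongrightarrow> z powr (\<alpha> - 1)) at_top"
    and "((\<lambda>x. x ^ r * laplace (p a) (Suc r) x / norm_fun l l0 \<alpha> r x) \<longlongrightarrow> fact r * limit_coeff C D \<alpha> a r) at_top"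
    and "limit_coeff C D \<alpha> a r \<ge> 0"
    and "\<exists>a. limit_coeff C D \<alpha> a r > 0"
proof -
  consider "\<alpha> = 0" | "\<alpha> = 1" "r = 0" | "\<alpha> \<noteq> 0" "\<not> (\<alpha> = 1 \<and> r = 0)" by blast
  hence "eventually (\<lambda>x. norm_fun l l0 \<alpha> r x > 0) at_top \<and>
    (z > 0 \<longrightarrow> ((\<lambda>x. norm_fun l l0 \<alpha> r (z * x) / norm_fun l l0 \<alpha> r x) \<longlongrightarrow> z powr (\<alpha> - 1)) at_top) \<and>
    ((\<lambda>x. x ^ r * laplace (p a) (Suc r) x / norm_fun l l0 \<alpha> r x) \<longlongrightarrow> fact r * limit_coeff C D \<alpha> a r) at_top \<and>
    limit_coeff C D \<alpha> a r \<ge> 0 \<and> (\<exists>a. limit_coeff C D \<alpha> a r > 0)"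
  proof cases
    case 1
    obtain a0 where "D a0 > 0" "D a \<ge> 0" using rv0[OF 1] by (auto simp: RV_zero_tail_def order_less_le)
    moreover have "norm_fun l l0 \<alpha> r = (\<lambda>x. l0 x / x)" "limit_coeff C D \<alpha> = (\<lambda>a r. D a)" "\<alpha> - 1 = - 1"
      using 1 by (auto simp: norm_fun_def limit_coeff_def fun_eq_iff)
    ultimately show ?thesis using laplace_RV_zero_tail[OF rv0[OF 1] supp]
      by (simp only: mult.commute[of "fact r"]) blast
  next
    case 2
    obtain a0 where "C a0 > 0" "C a \<ge> 0" using rv by (auto simp: RV_def order_less_le)
    thus ?thesis using laplace_RV_one[OF rv[unfolded 2(1)] supp] 2
      by (auto simp: norm_fun_def limit_coeff_def)
  next
    case 3
    obtain a0 where C: "C a0 > 0" "C a \<ge> 0" using rv by (auto simp: RV_def order_less_le)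
    \<comment> \<open>For \<open>\<alpha> \<le> 1\<close> this could fail only at
      \<open>\<alpha> = 1\<close>, \<open>r = 0\<close>, the case split off above.\<close>
    have ar: "\<alpha> < real r + 1" using 3 \<alpha> by (cases r) auto
    have G: "\<alpha> * Gamma (real r + 1 - \<alpha>) / fact r > 0" using 3 \<alpha> ar by simp
    have sv: "slowly_varying l" using rv by (simp add: RV_def)
    have nf: "norm_fun l l0 \<alpha> r x = x powr (\<alpha> - 1) * l x" for x using 3 by (auto simp: norm_fun_def)
    have lc: "limit_coeff C D \<alpha> a r = C a * (\<alpha> * Gamma (real r + 1 - \<alpha>) / fact r)" for a
      using 3 by (auto simp: limit_coeff_def)
    have "eventually (\<lambda>x. x powr (\<alpha> - 1) * l x > 0) at_top"
      using RV_normalizer_pos[OF rv supp] eventually_gt_at_top[of 0]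
      by eventually_elim (auto simp: zero_less_mult_iff)
    moreover have "((\<lambda>x. x ^ r * laplace (p a) (Suc r) x / (x powr (\<alpha> - 1) * l x)) \<longlongrightarrow> fact r * limit_coeff C D \<alpha> a r) at_top"
    proof (rule Lim_transform_eventually)
      show "((\<lambda>x. x ^ Suc r * laplace (p a) (Suc r) x / (x powr \<alpha> * l x)) \<longlongrightarrow> fact r * limit_coeff C D \<alpha> a r) at_top"
        using laplace_RV[OF rv supp \<alpha>(1) ar, of a] by (simp add: lc)
      show "\<forall>\<^sub>F x in at_top. x ^ Suc r * laplace (p a) (Suc r) x / (x powr \<alpha> * l x)
          = x ^ r * laplace (p a) (Suc r) x / (x powr (\<alpha> - 1) * l x)"
        using eventually_gt_at_top[of 0] by eventually_elim (simp add: powr_diff)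
    qed
    ultimately show ?thesis
      using powr_slowly_varying_scaling[OF sv, of z "\<alpha> - 1"]
        mult_nonneg_nonneg[OF C(2) less_imp_le[OF G]] mult_pos_pos[OF C(1) G]
      unfolding nf lc by blast
  qed
  thus "eventually (\<lambda>x. norm_fun l l0 \<alpha> r x > 0) at_top"
    and "z > 0 \<Longrightarrow> ((\<lambda>x. norm_fun l l0 \<alpha> r (z * x) / norm_fun l l0 \<alpha> r x) \<longlongrightarrow> z powr (\<alpha> - 1)) at_top"
    and "((\<lambda>x. x ^ r * laplace (p a) (Suc r) x / norm_fun l l0 \<alpha> r x) \<longlongrightarrow> fact r * limit_coeff C D \<alpha> a r) at_top"
    and "limit_coeff C D \<alpha> a r \<ge> 0"
    and "\<exists>a. limit_coeff C D \<alpha> a r > 0" by auto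
qed

section \<open>Asymptotics of the visit probabilities\<close>

lemma binomial_ratio_tendsto: "(\<lambda>m. real (m choose r) / real m ^ r) \<longlonglongrightarrow> 1 / fact r"
proof (induction r)
  case (Suc r)
  have "(\<lambda>m. real (m choose r) / real m ^ r * (1 - real r / real m) / real (Suc r)) \<longlonglongrightarrow> 1 / fact r * (1 - 0) / real (Suc r)"
    by (intro tendsto_intros Suc lim_const_over_n) auto
  moreover have "\<forall>\<^sub>F m in sequentially. real (m choose r) / real m ^ r * (1 - real r / real m) / real (Suc r)
      = real (m choose Suc r) / real m ^ Suc r"
    using eventually_gt_at_top[of 0]
  proof eventually_elim
    case (elim m)
    have "real (m choose r) * real m = real r * real (m choose r) + real (Suc r) * real (m choose Suc r)"
      using gbinomial_mult_1'[of "real m" r] by (simp add: binomial_gbinomial)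
    hence "real (m choose Suc r) = real (m choose r) * (real m - real r) / real (Suc r)"
      by (simp add: field_simps)
    moreover have "1 - real r / real m = (real m - real r) / real m"
      using elim by (simp add: diff_divide_distrib)
    ultimately show ?case by (simp only: power_Suc times_divide_times_eq divide_divide_eq_left mult_ac)
  qed
  ultimately show ?case by (auto dest: Lim_transform_eventually simp: mult.commute)
qed auto

lemma expectation_nat_sums:
  fixes f :: "nat \<Rightarrow> real"
  assumes "\<And>k. \<bar>f k\<bar> \<le> B"
  shows "(\<lambda>k. pmf q k * f k) sums measure_pmf.expectation q f"
proof -
  have "integrable (measure_pmf q) f"
    by (rule measure_pmf.integrable_const_bound[of _ B]) (use assms in auto)
  hence "integrable (count_space UNIV) (\<lambda>k. pmf q k * f k)"
    by (simp add: measure_pmf_eq_density integrable_density)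
  moreover have "measure_pmf.expectation q f = (\<integral>k. pmf q k * f k \<partial>count_space UNIV)"
    by (simp add: measure_pmf_eq_density integral_density)
  ultimately show ?thesis by (simp add: sums_integral_count_space_nat)
qed

text \<open>
  Both estimates reduce to \<open>z * exp (- z) \<le> 1\<close> and \<open>z\<^sup>2 * exp (- z) \<le> 2\<close> at \<open>z = m * t / 2\<close>;
  the lower one starts from \<open>(1 - t\<^sup>2) * exp (- t) \<le> 1 - t\<close> and Bernoulli's inequality.
\<close>

lemma power_exp_approx:
  assumes t: "0 \<le> t" "t \<le> 1" and m: "m \<ge> 1" "m \<ge> r"
  shows "\<bar>(1 - t) ^ (m - r) - exp (- real m * t)\<bar> \<le> (2 * real r * exp (real r) + 8) / real m * exp (- (real m / 2) * t)"
proof -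
  define z where "z = real m * t / 2"
  have z: "z \<ge> 0" using t by (simp add: z_def)
  \<comment> \<open>Half of the exponent is kept; the other half, \<open>exp (- z)\<close>, absorbs
    the powers of \<open>z\<close> created by the estimates.\<close>
  have split: "exp (- real m * t) = exp (- (real m / 2) * t) * exp (- z)"
    by (simp add: z_def exp_add[symmetric])
  have E: "exp (- (real m / 2) * t) > 0" by simp
  have upper: "(1 - t) ^ (m - r) - exp (- real m * t) \<le> 2 * real r * exp (real r) / real m * exp (- (real m / 2) * t)"
  proof -
    have "1 + (-t) \<le> exp (-t)" by (rule exp_ge_add_one_self)
    hence "(1 - t) ^ (m - r) \<le> exp (-t) ^ (m - r)" using t by (intro power_mono) auto
    also have "\<dots> = exp (- real m * t) * exp (real r * t)"
      using m by (simp add: exp_of_nat_mult[symmetric] exp_add[symmetric] of_nat_diff algebra_simps)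
    finally have "(1 - t) ^ (m - r) - exp (- real m * t) \<le> exp (- real m * t) * (exp (real r * t) - 1)"
      by (simp add: algebra_simps)
    also have "\<dots> \<le> exp (- real m * t) * (real r * t * exp (real r))"
    proof (intro mult_left_mono)
      have "1 + - (real r * t) \<le> exp (- (real r * t))" by (rule exp_ge_add_one_self)
      hence "exp (real r * t) * (1 - real r * t) \<le> exp (real r * t) * exp (- (real r * t))"
        by (intro mult_left_mono) auto
      hence "exp (real r * t) - 1 \<le> real r * t * exp (real r * t)"
        by (simp add: exp_minus algebra_simps)
      also have "\<dots> \<le> real r * t * exp (real r)"
        using t by (intro mult_left_mono) (auto simp: mult_left_le)
      finally show "exp (real r * t) - 1 \<le> real r * t * exp (real r)" .
    qed auto
    also have "\<dots> = 2 * real r * exp (real r) / real m * exp (- (real m / 2) * t) * (z ^ 1 * exp (- z))"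
      unfolding split using m by (simp add: z_def field_simps)
    also have "\<dots> \<le> 2 * real r * exp (real r) / real m * exp (- (real m / 2) * t) * fact 1"
      using z by (intro mult_left_mono power_exp_le_fact) auto
    finally show ?thesis by simp
  qed
  have lower: "exp (- real m * t) - (1 - t) ^ (m - r) \<le> 8 / real m * exp (- (real m / 2) * t)"
  proof -
    have "(1 - t) ^ m \<le> (1 - t) ^ (m - r)" using t by (intro power_decreasing) auto
    moreover have "exp (- real m * t) * (1 - real m * t\<^sup>2) \<le> (1 - t) ^ m"
    proof -
      have "1 + real m * (- t\<^sup>2) \<le> (1 + - t\<^sup>2) ^ m"
        using t by (intro Bernoulli_inequality) (auto simp: power_le_one_iff abs_le_square_iff[symmetric])
      hence "exp (- real m * t) * (1 - real m * t\<^sup>2) \<le> exp (- real m * t) * (1 - t\<^sup>2) ^ m"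
        by (intro mult_left_mono) auto
      also have "\<dots> = (exp (-t) * (1 - t\<^sup>2)) ^ m"
        by (simp add: power_mult_distrib exp_of_nat_mult[symmetric])
      also have "\<dots> \<le> (1 - t) ^ m"
      proof (intro power_mono)
        have "1 + t \<le> exp t" by (rule exp_ge_add_one_self)
        hence "(1 + t) * exp (-t) \<le> exp t * exp (-t)" by (intro mult_right_mono) auto
        hence "(1 - t) * ((1 + t) * exp (-t)) \<le> (1 - t) * 1"
          using t by (intro mult_left_mono) (auto simp: exp_minus)
        thus "exp (-t) * (1 - t\<^sup>2) \<le> 1 - t" by (simp add: algebra_simps power2_eq_square)
        show "0 \<le> exp (-t) * (1 - t\<^sup>2)" using t by (auto simp: power_le_one)
      qed
      finally show ?thesis .
    qed
    ultimately have "exp (- real m * t) - (1 - t) ^ (m - r) \<le> exp (- real m * t) * (real m * t\<^sup>2)"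
      by (simp add: algebra_simps)
    also have "\<dots> = 4 / real m * exp (- (real m / 2) * t) * (z ^ 2 * exp (- z))"
      unfolding split using m by (simp add: z_def field_simps power2_eq_square)
    also have "\<dots> \<le> 4 / real m * exp (- (real m / 2) * t) * fact 2"
      using z by (intro mult_left_mono power_exp_le_fact) auto
    finally show ?thesis by (simp add: fact_2)
  qed
  have "2 * real r * exp (real r) / real m * exp (- (real m / 2) * t) \<le> (2 * real r * exp (real r) + 8) / real m * exp (- (real m / 2) * t)"
    "8 / real m * exp (- (real m / 2) * t) \<le> (2 * real r * exp (real r) + 8) / real m * exp (- (real m / 2) * t)"
    by (intro mult_right_mono divide_right_mono; simp)+
  with upper lower show ?thesis by (simp only: abs_le_iff) linarith
qed

lemma visit_prob_laplace_diff:
  assumes m: "m \<ge> 1" "m \<ge> r"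
  shows "\<bar>visit_prob q r m - real (m choose r) * laplace q (Suc r) (real m)\<bar>
    \<le> real (m choose r) * ((2 * real r * exp (real r) + 8) / real m * laplace q (Suc r) (real m / 2))"
proof -
  define K where "K = 2 * real r * exp (real r) + 8"
  define d where "d k = pmf q k ^ Suc r * ((1 - pmf q k) ^ (m - r) - exp (- real m * pmf q k))" for k
  have dk: "norm (d k) \<le> K / real m * (pmf q k ^ Suc r * exp (- (real m / 2) * pmf q k))" for k
  proof -
    have "norm (d k) = pmf q k ^ Suc r * \<bar>(1 - pmf q k) ^ (m - r) - exp (- real m * pmf q k)\<bar>"
      by (simp add: d_def abs_mult)
    also have "\<dots> \<le> pmf q k ^ Suc r * (K / real m * exp (- (real m / 2) * pmf q k))"
      unfolding K_def by (intro mult_left_mono power_exp_approx m) (auto simp: pmf_le_1)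
    finally show ?thesis by (simp add: mult_ac)
  qed
  have sl: "summable (\<lambda>k. K / real m * (pmf q k ^ Suc r * exp (- (real m / 2) * pmf q k)))"
    by (intro summable_mult summable_laplace) auto
  have sd: "summable (\<lambda>k. norm (d k))"
    by (rule summable_comparison_test'[OF sl, of 0]) (use dk in auto)
  have "(\<lambda>k. pmf q k * pmf (binomial_pmf m (pmf q k)) r) sums visit_prob q r m"
    unfolding visit_prob_def by (rule expectation_nat_sums[of _ 1]) (auto simp: pmf_le_1 simp del: pmf_binomial)
  moreover have "pmf q k * pmf (binomial_pmf m (pmf q k)) r
      = real (m choose r) * (d k + pmf q k ^ Suc r * exp (- real m * pmf q k))" for k
    by (simp add: pmf_le_1 d_def algebra_simps)
  ultimately have "visit_prob q r m = (\<Sum>k. real (m choose r) * (d k + pmf q k ^ Suc r * exp (- real m * pmf q k)))"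
    by (simp add: sums_iff)
  also have "\<dots> = real (m choose r) * (\<Sum>k. d k + pmf q k ^ Suc r * exp (- real m * pmf q k))"
    by (intro suminf_mult summable_add summable_norm_cancel[OF sd] summable_laplace) auto
  also have "(\<Sum>k. d k + pmf q k ^ Suc r * exp (- real m * pmf q k)) = (\<Sum>k. d k) + laplace q (Suc r) (real m)"
    unfolding laplace_def by (intro suminf_add[symmetric] summable_norm_cancel[OF sd] summable_laplace) auto
  finally have "visit_prob q r m - real (m choose r) * laplace q (Suc r) (real m) = real (m choose r) * (\<Sum>k. d k)"
    by (simp add: algebra_simps)
  moreover have "\<bar>\<Sum>k. d k\<bar> \<le> K / real m * laplace q (Suc r) (real m / 2)"
  proof -
    have "norm (\<Sum>k. d k) \<le> (\<Sum>k. norm (d k))" by (rule summable_norm[OF sd])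
    also have "\<dots> \<le> (\<Sum>k. K / real m * (pmf q k ^ Suc r * exp (- (real m / 2) * pmf q k)))"
      by (rule suminf_le[OF dk sd sl])
    also have "\<dots> = K / real m * laplace q (Suc r) (real m / 2)"
      unfolding laplace_def by (intro suminf_mult summable_laplace) auto
    finally show ?thesis by simp
  qed
  hence "real (m choose r) * \<bar>\<Sum>k. d k\<bar> \<le> real (m choose r) * (K / real m * laplace q (Suc r) (real m / 2))"
    by (rule mult_left_mono) simp
  ultimately show ?thesis unfolding K_def by (simp only: abs_mult abs_of_nat)
qed

text \<open>The error of the exponential approximation is of order \<open>1 / m\<close> times a
  Laplace transform at \<open>m / 2\<close>. The limit \<open>s\<close> makes
  \<open>h (m / 2)\<close> comparable to \<open>h m\<close>, so the factor \<open>1 / m\<close>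
  decides; the value of \<open>s\<close> does not enter.\<close>

lemma visit_prob_tendsto:
  assumes pos: "eventually (\<lambda>x. h x > 0) at_top"
    and scale: "((\<lambda>x. h (1 / 2 * x) / h x) \<longlongrightarrow> s) at_top"
    and lim: "((\<lambda>x. x ^ r * laplace q (Suc r) x / h x) \<longlongrightarrow> fact r * F) at_top"
  shows "(\<lambda>m. visit_prob q r m / h (real m)) \<longlonglongrightarrow> F"
proof -
  define K where "K = 2 * real r * exp (real r) + 8"
  define W where "W = laplace q (Suc r)"
  have lim': "(\<lambda>m. real m ^ r * W (real m) / h (real m)) \<longlonglongrightarrow> fact r * F"
    unfolding W_def by (rule filterlim_compose[OF lim filterlim_real_sequentially])
  have half: "filterlim (\<lambda>x. 1 / 2 * x) at_top (at_top :: real filter)"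
    by (intro filterlim_tendsto_pos_mult_at_top[OF tendsto_const]) (auto simp: filterlim_ident)
  have hpos: "eventually (\<lambda>x. h (1 / 2 * x) > 0) at_top"
    by (rule eventually_compose_filterlim[OF pos half])
  have main: "(\<lambda>m. real (m choose r) / real m ^ r * (real m ^ r * W (real m) / h (real m))) \<longlonglongrightarrow> 1 / fact r * (fact r * F)"
    by (intro tendsto_mult binomial_ratio_tendsto lim')
  have err_real: "((\<lambda>x. 2 ^ r * ((1 / 2 * x) ^ r * W (1 / 2 * x) / h (1 / 2 * x)) * (h (1 / 2 * x) / h x) * (K / x)) \<longlongrightarrow> 2 ^ r * (fact r * F) * s * 0) at_top"
    unfolding W_def
    by (intro tendsto_mult tendsto_const scale filterlim_compose[OF lim half] tendsto_divide_0[OF tendsto_const]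
          filterlim_at_top_imp_at_infinity filterlim_ident)
  have err: "(\<lambda>m. real (m choose r) / real m ^ r *
      (2 ^ r * ((1 / 2 * real m) ^ r * W (1 / 2 * real m) / h (1 / 2 * real m)) * (h (1 / 2 * real m) / h (real m)) * (K / real m))) \<longlonglongrightarrow> 1 / fact r * (2 ^ r * (fact r * F) * s * 0)"
    by (intro tendsto_mult[OF binomial_ratio_tendsto] filterlim_compose[OF err_real filterlim_real_sequentially])
  have "(\<lambda>m. visit_prob q r m / h (real m) - real (m choose r) / real m ^ r * (real m ^ r * W (real m) / h (real m))) \<longlonglongrightarrow> 0"
  proof (rule Lim_null_comparison)
    show "(\<lambda>m. real (m choose r) / real m ^ r *
      (2 ^ r * ((1 / 2 * real m) ^ r * W (1 / 2 * real m) / h (1 / 2 * real m)) * (h (1 / 2 * real m) / h (real m)) * (K / real m))) \<longlonglongrightarrow> 0"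
      using err by simp
    show "\<forall>\<^sub>F m in sequentially. norm (visit_prob q r m / h (real m) - real (m choose r) / real m ^ r * (real m ^ r * W (real m) / h (real m)))
      \<le> real (m choose r) / real m ^ r *
      (2 ^ r * ((1 / 2 * real m) ^ r * W (1 / 2 * real m) / h (1 / 2 * real m)) * (h (1 / 2 * real m) / h (real m)) * (K / real m))"
      using eventually_compose_filterlim[OF pos filterlim_real_sequentially]
        eventually_compose_filterlim[OF hpos filterlim_real_sequentially]
        eventually_ge_at_top[of 1] eventually_ge_at_top[of r]
    proof eventually_elim
      case (elim m)
      have "norm (visit_prob q r m / h (real m) - real (m choose r) / real m ^ r * (real m ^ r * W (real m) / h (real m)))
        = \<bar>visit_prob q r m - real (m choose r) * W (real m)\<bar> / h (real m)"
        using elim by (simp add: diff_divide_distrib[symmetric])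
      also have "\<dots> \<le> real (m choose r) * (K / real m * W (real m / 2)) / h (real m)"
        unfolding K_def W_def using elim by (intro divide_right_mono visit_prob_laplace_diff) auto
      also have "\<dots> = real (m choose r) / real m ^ r *
      (2 ^ r * ((1 / 2 * real m) ^ r * W (1 / 2 * real m) / h (1 / 2 * real m)) * (h (1 / 2 * real m) / h (real m)) * (K / real m))"
        using elim by (simp add: field_simps)
      finally show ?case .
    qed
  qed
  from tendsto_add[OF this main] show ?thesis by simp
qed

section \<open>Joint limits in the time and the visit count\<close>

text \<open>Encodes \<open>n\<close> tending to infinity together with \<open>m / n\<close> tending
  to \<open>z\<close>. Time and visit count form such a pair \<open>(n, m)\<close>, and limits in
  two variables can then be multiplied and composed by the usual rules.\<close>

definition ratio_filter :: "real \<Rightarrow> (nat \<times> nat) filter" where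
  "ratio_filter z = inf (filtercomap fst sequentially) (filtercomap (\<lambda>(n, m). real m / real n) (nhds z))"

lemma filterlim_fst_ratio_filter: "filterlim fst sequentially (ratio_filter z)"
  unfolding ratio_filter_def by (rule filterlim_mono[OF filterlim_filtercomap order_refl inf_le1])

lemma ratio_filter_tendsto: "((\<lambda>(n, m). real m / real n) \<longlongrightarrow> z) (ratio_filter z)"
  unfolding ratio_filter_def by (rule filterlim_mono[OF filterlim_filtercomap order_refl inf_le2])

lemma eventually_ratio_filter_pos: "eventually (\<lambda>(n, m). n > 0) (ratio_filter z)"
  using eventually_compose_filterlim[OF eventually_gt_at_top[of 0] filterlim_fst_ratio_filter[of z]]
  by (simp add: case_prod_unfold)

lemma filterlim_real_fst_ratio_filter: "filterlim (\<lambda>(n, m). real n) at_top (ratio_filter z)"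
  using filterlim_compose[OF filterlim_real_sequentially filterlim_fst_ratio_filter[of z]]
  by (simp add: case_prod_unfold)

lemma filterlim_snd_ratio_filter:
  assumes "z > 0"
  shows "filterlim (\<lambda>(n, m). real m) at_top (ratio_filter z)" "filterlim snd sequentially (ratio_filter z)"
proof -
  have "filterlim (\<lambda>x. (case x of (n, m) \<Rightarrow> real m / real n) * (case x of (n, m) \<Rightarrow> real n)) at_top (ratio_filter z)"
    by (rule filterlim_tendsto_pos_mult_at_top[OF ratio_filter_tendsto assms filterlim_real_fst_ratio_filter])
  moreover have "\<forall>\<^sub>F x in ratio_filter z. (case x of (n, m) \<Rightarrow> real m / real n) * (case x of (n, m) \<Rightarrow> real n) = (case x of (n, m) \<Rightarrow> real m)"
    using eventually_ratio_filter_pos[of z] by eventually_elim (auto simp: case_prod_beta)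
  ultimately show *: "filterlim (\<lambda>(n, m). real m) at_top (ratio_filter z)"
    by (simp add: filterlim_cong[OF refl refl])
  show "filterlim snd sequentially (ratio_filter z)"
    unfolding filterlim_at_top
  proof
    fix N
    show "\<forall>\<^sub>F x in ratio_filter z. N \<le> snd x"
      using filterlim_at_top[THEN iffD1, OF *, rule_format, of "real N"] by eventually_elim auto
  qed
qed

text \<open>Returns from the filter to an explicit window of width \<open>\<delta> * n\<close>, the
  form in which the concentration bound is stated.\<close>

lemma eventually_ratio_filterD:
  assumes "eventually (\<lambda>(n, m). P n m) (ratio_filter z)"
  shows "\<exists>\<delta>>0. eventually (\<lambda>n. \<forall>m. \<bar>real m - z * real n\<bar> < \<delta> * real n \<longrightarrow> P n m) sequentially"
proof -
  obtain A B where A: "eventually A (filtercomap fst sequentially)"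
    and B: "eventually B (filtercomap (\<lambda>(n, m). real m / real n) (nhds z))"
    and AB: "\<And>n m. A (n, m) \<Longrightarrow> B (n, m) \<Longrightarrow> P n m"
    using assms unfolding ratio_filter_def eventually_inf by auto
  obtain A' where A': "eventually A' sequentially" "\<And>x. A' (fst x) \<Longrightarrow> A x"
    using A unfolding eventually_filtercomap by blast
  obtain B' where B': "eventually B' (nhds z)" "\<And>n m. B' (real m / real n) \<Longrightarrow> B (n, m)"
    using B unfolding eventually_filtercomap by auto
  obtain \<delta> where \<delta>: "\<delta> > 0" "\<And>y. dist y z < \<delta> \<Longrightarrow> B' y"
    using B'(1) unfolding eventually_nhds_metric by blast
  have "eventually (\<lambda>n. \<forall>m. \<bar>real m - z * real n\<bar> < \<delta> * real n \<longrightarrow> P n m) sequentially"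
    using A'(1) eventually_gt_at_top[of 0]
  proof eventually_elim
    case (elim n)
    show ?case
    proof (intro allI impI)
      fix m assume "\<bar>real m - z * real n\<bar> < \<delta> * real n"
      moreover have "\<bar>real m / real n - z\<bar> * real n = \<bar>real m - z * real n\<bar>"
        using elim by (simp add: abs_mult[symmetric, of _ "real n"] field_simps abs_mult_pos)
      ultimately have "\<bar>real m / real n - z\<bar> * real n < \<delta> * real n" by simp
      hence "dist (real m / real n) z < \<delta>"
        unfolding dist_real_def by (rule mult_right_less_imp_less) simp
      thus "P n m" using A'(2)[of "(n, m)"] B'(2) \<delta>(2) AB elim by auto
    qed
  qed
  thus ?thesis using \<delta>(1) by blast
qed

text \<open>
  Monotonicity replaces the uniform convergence theorem: the decreasing factor \<open>W\<close> of \<open>h\<close> is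
  squeezed between its values at two fixed ratios.
\<close>

lemma regular_ratio_tendsto:
  fixes h W :: "real \<Rightarrow> real"
  assumes pos: "eventually (\<lambda>x. h x > 0) at_top"
    and scale: "\<And>z. z > 0 \<Longrightarrow> ((\<lambda>x. h (z * x) / h x) \<longlongrightarrow> z powr \<gamma>) at_top"
    and W: "((\<lambda>x. x ^ r * W x / h x) \<longlongrightarrow> L) at_top" and L: "L > 0"
    and anti: "\<And>x y. 0 < x \<Longrightarrow> x \<le> y \<Longrightarrow> W y \<le> W x" and Wpos: "\<And>x. x > 0 \<Longrightarrow> W x > 0"
    and z: "z > 0"
  shows "((\<lambda>(n, m). h (real m) / h (real n)) \<longlongrightarrow> z powr \<gamma>) (ratio_filter z)"
proof -
  \<comment> \<open>Since \<open>W x\<close> behaves like \<open>h x / x ^ r\<close>, this is its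
    index of regular variation.\<close>
  define \<tau> where "\<tau> = \<gamma> - real r"
  have fl: "filterlim (\<lambda>x. s * x) at_top (at_top :: real filter)" if "s > 0" for s
    using that by (intro filterlim_tendsto_pos_mult_at_top[OF tendsto_const]) (auto simp: filterlim_ident)
  have Wscale: "((\<lambda>x. W (s * x) / W x) \<longlongrightarrow> s powr \<tau>) at_top" if s: "s > 0" for s
  proof (rule Lim_transform_eventually)
    show "((\<lambda>x. ((s * x) ^ r * W (s * x) / h (s * x)) * (h (s * x) / h x) / (x ^ r * W x / h x) / s ^ r) \<longlongrightarrow> s powr \<tau>) at_top"
    proof -
      have "((\<lambda>x. ((s * x) ^ r * W (s * x) / h (s * x)) * (h (s * x) / h x) / (x ^ r * W x / h x) / s ^ r) \<longlongrightarrow> L * s powr \<gamma> / L / s ^ r) at_top"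
        using L s by (intro tendsto_intros filterlim_compose[OF W fl] scale W) auto
      moreover have "L * s powr \<gamma> / L / s ^ r = s powr \<tau>"
        using L s by (simp add: \<tau>_def powr_diff powr_realpow)
      ultimately show ?thesis by simp
    qed
    show "\<forall>\<^sub>F x in at_top. ((s * x) ^ r * W (s * x) / h (s * x)) * (h (s * x) / h x) / (x ^ r * W x / h x) / s ^ r = W (s * x) / W x"
      using pos eventually_compose_filterlim[OF pos fl[OF s]] eventually_gt_at_top[of 0]
    proof eventually_elim
      case (elim x)
      show ?case using elim s Wpos[of x] by (simp add: field_simps)
    qed
  qed
  have Wn: "((\<lambda>(n, m). W (s * real n) / W (real n)) \<longlongrightarrow> s powr \<tau>) (ratio_filter z)" if "s > 0" for s
    using filterlim_compose[OF Wscale[OF that] filterlim_real_fst_ratio_filter[of z]] by (simp add: case_prod_unfold)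
  have cont: "((\<lambda>s. s powr \<tau>) \<longlongrightarrow> z powr \<tau>) (at z within S)" for S
    using z by (intro tendsto_intros) auto
  have Wratio: "((\<lambda>(n, m). W (real m) / W (real n)) \<longlongrightarrow> z powr \<tau>) (ratio_filter z)"
  proof (rule order_tendstoI)
    fix b assume b: "b < z powr \<tau>"
    have "eventually (\<lambda>s. b < s powr \<tau>) (at_right z)" by (rule order_tendstoD(1)[OF cont b])
    then obtain t where t: "t > z" "b < t powr \<tau>"
      by (metis (mono_tags, lifting) dense eventually_at_right_field gt_ex)
    have "\<forall>\<^sub>F x in ratio_filter z. (case x of (n, m) \<Rightarrow> W (t * real n) / W (real n)) > b"
      using t z by (intro order_tendstoD(1)[OF Wn]) auto
    moreover have "\<forall>\<^sub>F x in ratio_filter z. (case x of (n, m) \<Rightarrow> real m / real n) < t"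
      by (rule order_tendstoD(2)[OF ratio_filter_tendsto t(1)])
    moreover have "\<forall>\<^sub>F x in ratio_filter z. (case x of (n, m) \<Rightarrow> real m / real n) > 0"
      by (rule order_tendstoD(1)[OF ratio_filter_tendsto z])
    ultimately show "\<forall>\<^sub>F x in ratio_filter z. b < (case x of (n, m) \<Rightarrow> W (real m) / W (real n))"
    proof eventually_elim
      case (elim x)
      obtain n m where x: "x = (n, m)" by (cases x)
      have nm: "real m > 0" "real n > 0" using elim(3) by (auto simp: x zero_less_divide_iff)
      have "W (t * real n) \<le> W (real m)" using elim nm by (intro anti) (auto simp: x field_simps)
      hence "W (t * real n) / W (real n) \<le> W (real m) / W (real n)"
        using Wpos[OF nm(2)] by (intro divide_right_mono) auto
      thus ?case using elim by (simp add: x)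
    qed
  next
    fix b assume b: "z powr \<tau> < b"
    have "eventually (\<lambda>s. s powr \<tau> < b) (at_left z)" by (rule order_tendstoD(2)[OF cont b])
    then obtain y where y: "y < z" "\<And>s. y < s \<Longrightarrow> s < z \<Longrightarrow> s powr \<tau> < b"
      by (auto simp: eventually_at_left_field)
    \<comment> \<open>The maximum with 0 keeps \<open>t\<close> positive, which the scaling limit of
      \<open>W\<close> demands.\<close>
    define t where "t = (max y 0 + z) / 2"
    have t: "0 < t" "t < z" "t powr \<tau> < b" using y z by (auto simp: t_def intro!: y(2))
    have "\<forall>\<^sub>F x in ratio_filter z. (case x of (n, m) \<Rightarrow> W (t * real n) / W (real n)) < b"
      using t by (intro order_tendstoD(2)[OF Wn]) auto
    moreover have "\<forall>\<^sub>F x in ratio_filter z. (case x of (n, m) \<Rightarrow> real m / real n) > t"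
      by (rule order_tendstoD(1)[OF ratio_filter_tendsto t(2)])
    ultimately show "\<forall>\<^sub>F x in ratio_filter z. (case x of (n, m) \<Rightarrow> W (real m) / W (real n)) < b"
      using eventually_ratio_filter_pos
    proof eventually_elim
      case (elim x)
      obtain n m where x: "x = (n, m)" by (cases x)
      have nm: "real n > 0" using elim by (auto simp: x)
      have "W (real m) \<le> W (t * real n)" using elim nm t by (intro anti) (auto simp: x field_simps)
      hence "W (real m) / W (real n) \<le> W (t * real n) / W (real n)"
        using Wpos[OF nm] by (intro divide_right_mono) auto
      thus ?case using elim by (simp add: x)
    qed
  qed
  define R where "R x = x ^ r * W x / h x" for x
  have Rm: "((\<lambda>(n, m). R (real m)) \<longlongrightarrow> L) (ratio_filter z)"
    using filterlim_compose[OF W filterlim_snd_ratio_filter(1)[OF z]] by (simp add: case_prod_unfold R_def)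
  have Rn: "((\<lambda>(n, m). R (real n)) \<longlongrightarrow> L) (ratio_filter z)"
    using filterlim_compose[OF W filterlim_real_fst_ratio_filter[of z]] by (simp add: case_prod_unfold R_def)
  have "((\<lambda>x. (case x of (n, m) \<Rightarrow> R (real n)) / (case x of (n, m) \<Rightarrow> R (real m)) *
      (case x of (n, m) \<Rightarrow> real m / real n) ^ r * (case x of (n, m) \<Rightarrow> W (real m) / W (real n))) \<longlongrightarrow> L / L * z ^ r * z powr \<tau>) (ratio_filter z)"
    using L by (intro tendsto_intros Rm Rn ratio_filter_tendsto Wratio) auto
  moreover have "L / L * z ^ r * z powr \<tau> = z powr \<gamma>"
    using L z by (simp add: \<tau>_def powr_diff powr_realpow)
  moreover have "\<forall>\<^sub>F x in ratio_filter z. (case x of (n, m) \<Rightarrow> R (real n)) / (case x of (n, m) \<Rightarrow> R (real m)) *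
      (case x of (n, m) \<Rightarrow> real m / real n) ^ r * (case x of (n, m) \<Rightarrow> W (real m) / W (real n))
      = (case x of (n, m) \<Rightarrow> h (real m) / h (real n))"
  proof -
    have "\<forall>\<^sub>F x in ratio_filter z. (case x of (n, m) \<Rightarrow> h (real m) > 0 \<and> real m > 0)"
      using eventually_compose_filterlim[OF pos filterlim_snd_ratio_filter(1)[OF z]]
        eventually_compose_filterlim[OF eventually_gt_at_top[of 0] filterlim_snd_ratio_filter(1)[OF z]]
      by eventually_elim (auto simp: case_prod_beta)
    moreover have "\<forall>\<^sub>F x in ratio_filter z. (case x of (n, m) \<Rightarrow> h (real n) > 0)"
      using eventually_compose_filterlim[OF pos filterlim_real_fst_ratio_filter[of z]]
      by eventually_elim (auto simp: case_prod_beta)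
    ultimately show ?thesis using eventually_ratio_filter_pos
    proof eventually_elim
      case (elim x)
      obtain n m where x: "x = (n, m)" by (cases x)
      show ?case using elim Wpos[of "real n"] Wpos[of "real m"] by (simp add: x R_def field_simps)
    qed
  qed
  ultimately show ?thesis by (auto dest: Lim_transform_eventually)
qed

text \<open>The ratio of consecutive values of \<open>h\<close> tends to 1, so the ratio test
  applies with a factor \<open>s\<close> between \<open>q\<close> and 1; the terms of a convergent
  series tend to 0.\<close>

lemma geometric_over_regular_tendsto_0:
  fixes h :: "real \<Rightarrow> real"
  assumes pos: "eventually (\<lambda>x. h x > 0) at_top"
    and ratio: "((\<lambda>(n, m). h (real m) / h (real n)) \<longlongrightarrow> 1) (ratio_filter 1)"
    and q: "0 < q" "q < 1"
  shows "(\<lambda>n. q ^ n / h (real n)) \<longlonglongrightarrow> 0"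
proof -
  have fl: "filterlim (\<lambda>n. (n, Suc n)) (ratio_filter 1) sequentially"
    unfolding ratio_filter_def filterlim_inf filterlim_filtercomap_iff
  proof
    show "filterlim (fst \<circ> (\<lambda>n. (n, Suc n))) sequentially sequentially" by (simp add: o_def filterlim_ident)
    have "(\<lambda>n. 1 + 1 / real n) \<longlonglongrightarrow> 1 + 0" by (intro tendsto_intros lim_1_over_n)
    moreover have "\<forall>\<^sub>F n in sequentially. 1 + 1 / real n = real (Suc n) / real n"
      using eventually_gt_at_top[of 0] by eventually_elim (simp add: field_simps)
    ultimately show "filterlim ((\<lambda>(n, m). real m / real n) \<circ> (\<lambda>n. (n, Suc n))) (nhds 1) sequentially"
      by (auto simp: o_def dest: Lim_transform_eventually)
  qed
  have "(\<lambda>n. h (real (Suc n)) / h (real n)) \<longlonglongrightarrow> 1"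
    using filterlim_compose[OF ratio fl] by simp
  moreover define s where "s = (1 + q) / 2"
  have s: "q < s" "s < 1" using q by (auto simp: s_def)
  ultimately have "eventually (\<lambda>n. q / s < h (real (Suc n)) / h (real n)) sequentially"
    using q by (intro order_tendstoD(1)[of _ 1]) auto
  moreover have hpos: "eventually (\<lambda>n. h (real n) > 0) sequentially"
    by (rule eventually_compose_filterlim[OF pos filterlim_real_sequentially])
  moreover have "eventually (\<lambda>n. h (real (Suc n)) > 0) sequentially"
    using hpos by (subst eventually_sequentially_Suc)
  ultimately have "eventually (\<lambda>n. norm (q ^ Suc n / h (real (Suc n))) \<le> s * norm (q ^ n / h (real n))) sequentially"
  proof eventually_elim
    case (elim n)
    hence "q * h (real n) \<le> s * h (real (Suc n))" using q s by (simp add: field_simps)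
    hence "q ^ n * (q * h (real n)) \<le> q ^ n * (s * h (real (Suc n)))" using q by (intro mult_left_mono) auto
    thus ?case using elim q by (simp add: field_simps)
  qed
  then obtain N where "\<And>n. n \<ge> N \<Longrightarrow> norm (q ^ Suc n / h (real (Suc n))) \<le> s * norm (q ^ n / h (real n))"
    by (auto simp: eventually_sequentially)
  hence "summable (\<lambda>n. q ^ n / h (real n))" using s by (intro summable_ratio_test[of s N]) auto
  thus ?thesis by (rule summable_LIMSEQ_zero)
qed

text \<open>No independence of the last state and the visit count is at hand. Because the count
  concentrates, the normalized \<open>\<psi>\<close> may be replaced by the constant
  \<open>c\<close>, after which only the law of the last state remains.\<close>

lemma expectation_visits_tendsto:
  fixes Q :: "'a::finite \<Rightarrow> 'a pmf" and h :: "real \<Rightarrow> real"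
  assumes irr: "irreducible_chain Q" and aper: "aperiodic_chain Q" and stat: "stationary_distribution Q \<pi>"
    and pos: "eventually (\<lambda>x. h x > 0) at_top"
    and ratio: "\<And>z. z > 0 \<Longrightarrow> ((\<lambda>(n, m). h (real m) / h (real n)) \<longlongrightarrow> z powr (\<alpha> - 1)) (ratio_filter z)"
    and \<psi>: "(\<lambda>m. \<psi> m / h (real m)) \<longlonglongrightarrow> F" and bdd: "Bseq \<psi>"
  shows "(\<lambda>n. measure_pmf.expectation (path_pmf \<eta> Q n)
      (\<lambda>xs. of_bool (hd xs = a) * \<psi> (count_list (tl xs) a)) / h (real n)) \<longlonglongrightarrow> pmf \<pi> a powr \<alpha> * F"
proof -
  define z where "z = pmf \<pi> a"
  have z: "z > 0" unfolding z_def by (rule stationary_pos[OF irr aper stat])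
  define c where "c = F * z powr (\<alpha> - 1)"
  define E where "E n f = measure_pmf.expectation (path_pmf \<eta> Q n) f" for n and f :: "'a list \<Rightarrow> real"
  define D where "D n xs = of_bool (hd xs = a) * (\<psi> (count_list (tl xs) a) / h (real n) - c)" for n xs
  have int: "integrable (path_pmf \<eta> Q n) f" for n and f :: "'a list \<Rightarrow> real"
    by (rule integrable_measure_pmf_finite[OF finite_set_path_pmf])
  obtain B where B: "\<And>m. \<bar>\<psi> m\<bar> \<le> B" using bdd by (auto simp: Bseq_def)
  have B0: "B \<ge> 0" using B[of 0] by linarith
  have lim: "((\<lambda>(n, m). \<psi> m / h (real n)) \<longlongrightarrow> c) (ratio_filter z)"
  proof -
    have "((\<lambda>x. (\<psi> (snd x) / h (real (snd x))) * (case x of (n, m) \<Rightarrow> h (real m) / h (real n))) \<longlongrightarrow> F * z powr (\<alpha> - 1)) (ratio_filter z)"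
      by (intro tendsto_mult ratio z filterlim_compose[OF \<psi> filterlim_snd_ratio_filter(2)])
    moreover have "\<forall>\<^sub>F x in ratio_filter z. (\<psi> (snd x) / h (real (snd x))) * (case x of (n, m) \<Rightarrow> h (real m) / h (real n))
        = (case x of (n, m) \<Rightarrow> \<psi> m / h (real n))"
      using eventually_compose_filterlim[OF pos filterlim_snd_ratio_filter(1)[OF z]]
      by eventually_elim (auto simp: case_prod_beta)
    ultimately show ?thesis unfolding c_def by (rule Lim_transform_eventually)
  qed
  have "(\<lambda>n. E n (D n)) \<longlonglongrightarrow> 0"
  proof (rule tendstoI)
    fix e :: real assume e: "e > 0"
    have "\<forall>\<^sub>F x in ratio_filter z. dist (case x of (n, m) \<Rightarrow> \<psi> m / h (real n)) c < e / 2"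
      using e by (intro tendstoD[OF lim]) auto
    hence "\<forall>\<^sub>F (n, m) in ratio_filter z. \<bar>\<psi> m / h (real n) - c\<bar> < e / 2"
      by eventually_elim (auto simp: dist_real_def case_prod_beta)
    from eventually_ratio_filterD[OF this] obtain \<delta> where \<delta>: "\<delta> > 0"
      "eventually (\<lambda>n. \<forall>m. \<bar>real m - z * real n\<bar> < \<delta> * real n \<longrightarrow> \<bar>\<psi> m / h (real n) - c\<bar> < e / 2) sequentially"
      by auto
    define bad where "bad n = {xs. \<bar>real (count_list (tl xs) a) - z * real n\<bar> \<ge> \<delta> * real n}" for n
    obtain A q where q: "0 < q" "q < 1"
      and A: "\<And>n. measure_pmf.prob (path_pmf \<eta> Q n) (bad n) \<le> A * q ^ n"
      using count_list_concentration[OF irr aper stat \<delta>(1), of \<eta> a] unfolding z_def bad_def by blast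
    have "(\<lambda>n. q ^ n / h (real n)) \<longlonglongrightarrow> 0"
      using ratio[of 1] by (intro geometric_over_regular_tendsto_0 pos q) auto
    moreover have "(\<lambda>n. q ^ n) \<longlonglongrightarrow> 0" using q by (intro LIMSEQ_power_zero) auto
    ultimately have "(\<lambda>n. A * (B * (q ^ n / h (real n)) + \<bar>c\<bar> * q ^ n)) \<longlonglongrightarrow> A * (B * 0 + \<bar>c\<bar> * 0)"
      by (intro tendsto_mult tendsto_add tendsto_const)
    hence "eventually (\<lambda>n. A * (B * (q ^ n / h (real n)) + \<bar>c\<bar> * q ^ n) < e / 2) sequentially"
      using e by (intro order_tendstoD(2)[of _ 0]) auto
    thus "eventually (\<lambda>n. dist (E n (D n)) 0 < e) sequentially"
      using \<delta>(2) eventually_compose_filterlim[OF pos filterlim_real_sequentially]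
    proof eventually_elim
      case (elim n)
      \<comment> \<open>Bound for the difference on the bad event. The count may be small there,
        where the asymptotics of \<open>\<psi>\<close> say nothing; boundedness of
        \<open>\<psi>\<close> and the geometrically small probability take over.\<close>
      define M where "M = B / h (real n) + \<bar>c\<bar>"
      have M: "M \<ge> 0" using elim B0 by (simp add: M_def)
      have "norm (E n (D n)) \<le> E n (\<lambda>xs. norm (D n xs))"
        unfolding E_def by (rule integral_norm_bound)
      also have "\<dots> \<le> E n (\<lambda>xs. e / 2 + M * indicator (bad n) xs)"
        unfolding E_def
      proof (intro integral_mono int)
        fix xs
        show "norm (D n xs) \<le> e / 2 + M * indicator (bad n) xs"
        proof (cases "xs \<in> bad n")
          case True
          have "norm (D n xs) \<le> \<bar>\<psi> (count_list (tl xs) a) / h (real n) - c\<bar>" by (simp add: D_def)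
          also have "\<dots> \<le> \<bar>\<psi> (count_list (tl xs) a)\<bar> / h (real n) + \<bar>c\<bar>"
            using elim by (intro order_trans[OF abs_triangle_ineq4]) simp
          also have "\<dots> \<le> M" unfolding M_def using elim B by (intro add_mono divide_right_mono) auto
          finally show ?thesis using True e by simp
        next
          case False
          hence "\<bar>\<psi> (count_list (tl xs) a) / h (real n) - c\<bar> < e / 2" using elim by (auto simp: bad_def)
          thus ?thesis using False e by (simp add: D_def)
        qed
      qed
      also have "\<dots> = e / 2 + M * measure_pmf.prob (path_pmf \<eta> Q n) (bad n)"
        unfolding E_def by (subst Bochner_Integration.integral_add) (auto intro: int)
      also have "\<dots> \<le> e / 2 + M * (A * q ^ n)"
        using M A by (intro add_left_mono mult_left_mono) auto
      also have "M * (A * q ^ n) = A * (B * (q ^ n / h (real n)) + \<bar>c\<bar> * q ^ n)"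
        by (simp add: M_def algebra_simps)
      also have "e / 2 + \<dots> < e" using elim(1) by linarith
      finally show ?case by simp
    qed
  qed
  moreover have "(\<lambda>n. c * measure_pmf.prob (path_pmf \<eta> Q n) {xs. hd xs = a}) \<longlonglongrightarrow> c * z"
    unfolding z_def by (intro tendsto_intros path_pmf_hd_tendsto irr aper stat)
  ultimately have "(\<lambda>n. E n (D n) + c * measure_pmf.prob (path_pmf \<eta> Q n) {xs. hd xs = a}) \<longlonglongrightarrow> 0 + c * z"
    by (rule tendsto_add)
  moreover have "E n (D n) + c * measure_pmf.prob (path_pmf \<eta> Q n) {xs. hd xs = a}
      = E n (\<lambda>xs. of_bool (hd xs = a) * \<psi> (count_list (tl xs) a)) / h (real n)" for n
  proof -
    have "E n (D n) + c * measure_pmf.prob (path_pmf \<eta> Q n) {xs. hd xs = a}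
        = E n (D n) + E n (\<lambda>xs. c * indicator {xs. hd xs = a} xs)"
      by (simp add: E_def)
    also have "\<dots> = E n (\<lambda>xs. D n xs + c * indicator {xs. hd xs = a} xs)"
      unfolding E_def by (subst Bochner_Integration.integral_add) (auto intro: int)
    also have "\<dots> = E n (\<lambda>xs. of_bool (hd xs = a) * \<psi> (count_list (tl xs) a) / h (real n))"
      by (rule arg_cong[of _ _ "E n"]) (auto simp: D_def fun_eq_iff)
    finally show ?thesis by (simp add: E_def)
  qed
  moreover have "0 + c * z = z powr \<alpha> * F" using z by (simp add: c_def powr_diff)
  ultimately show ?thesis by (simp add: E_def z_def)
qed

theorem theorem5p1:
  fixes M :: "'w measure"
    and Z :: "nat \<Rightarrow> 'w \<Rightarrow> 'a::finite \<times> nat"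
    and \<eta> \<pi> :: "'a pmf"
    and Q :: "'a \<Rightarrow> 'a pmf"
    and p :: "'a \<Rightarrow> nat pmf"
    and \<alpha> :: real
    and l l0 :: "real \<Rightarrow> real"
    and C D :: "'a \<Rightarrow> real"
    and r :: nat
  assumes "regime_switching_process M Z \<eta> Q p"
    and "irreducible_chain Q"
    and "aperiodic_chain Q"
    and "stationary_distribution Q \<pi>"
    and "0 \<le> \<alpha>" and "\<alpha> \<le> 1"
    and "RV \<alpha> C l p"
    and "\<alpha> = 0 \<Longrightarrow> RV_zero_tail D l0 p"
    and "\<alpha> \<noteq> 0 \<Longrightarrow> locally_bounded_away l"
    and "\<alpha> = 0 \<Longrightarrow> locally_bounded_away l0"
  shows "((\<lambda>n. \<P>(\<omega> in M. previous_visits Z n \<omega> = r) / norm_fun l l0 \<alpha> r (real n))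
           \<longlonglongrightarrow> (\<Sum>a\<in>UNIV. pmf \<pi> a powr \<alpha> * limit_coeff C D \<alpha> a r)) \<and>
         ((\<lambda>n. \<P>(\<omega> in M. previous_visits Z n \<omega> = r) /
              (\<integral>\<omega>. of_bool (previous_visits (\<lambda>i \<omega>. fst (Z i \<omega>)) n \<omega> > r)
                     * norm_fun l l0 \<alpha> r (real (previous_visits (\<lambda>i \<omega>. fst (Z i \<omega>)) n \<omega>)) \<partial>M))
           \<longlonglongrightarrow> (\<Sum>a\<in>UNIV. pmf \<pi> a powr \<alpha> * limit_coeff C D \<alpha> a r)
                / (\<Sum>a\<in>UNIV. pmf \<pi> a powr \<alpha>))"
proof -
  note irr = assms(2) and aper = assms(3) and stat = assms(4)
  define h where "h = norm_fun l l0 \<alpha> r"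
  define F where "F a = limit_coeff C D \<alpha> a r" for a
  have supp: "set_pmf (p a) \<subseteq> {1..}" for a
    using assms(1) by (simp add: regime_switching_process_def)
  note asym = norm_fun_asymptotics[OF supp assms(5-8), where r = r, folded h_def F_def]
  \<comment> \<open>A state with positive coefficient: its Laplace transform becomes the decreasing
    comparison function for \<open>h\<close>.\<close>
  obtain b where b: "F b > 0" using asym(5) by blast
  define W where "W = laplace (p b) (Suc r)"
  have anti: "W y \<le> W x" if "0 < x" "x \<le> y" for x y
    unfolding W_def laplace_def
    using that by (intro suminf_le summable_laplace) (auto intro!: mult_left_mono mult_right_mono)
  have ratio: "((\<lambda>(n, m). h (real m) / h (real n)) \<longlongrightarrow> z powr (\<alpha> - 1)) (ratio_filter z)" if "z > 0" for z
  proof (rule regular_ratio_tendsto[where W = W and r = r and L = "fact r * F b"])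
    show "((\<lambda>x. x ^ r * W x / h x) \<longlongrightarrow> fact r * F b) at_top" unfolding W_def by (rule asym(3))
    show "W x > 0" if "x > 0" for x unfolding W_def using that by (intro laplace_pos) auto
  qed (use asym(1,2) anti b that in auto)
  have vp: "(\<lambda>m. visit_prob (p a) r m / h (real m)) \<longlonglongrightarrow> F a" for a
    by (rule visit_prob_tendsto[OF asym(1) asym(2) asym(3)]) auto
  have hpos: "eventually (\<lambda>m. h (real m) > 0) sequentially"
    by (rule eventually_compose_filterlim[OF asym(1) filterlim_real_sequentially])
  have by_state: "measure_pmf.expectation (path_pmf \<eta> Q n) (\<lambda>xs. \<psi> (hd xs) (count_list (tl xs) (hd xs)))
      = (\<Sum>a\<in>UNIV. measure_pmf.expectation (path_pmf \<eta> Q n) (\<lambda>xs. of_bool (hd xs = a) * \<psi> a (count_list (tl xs) a)))"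
    for n and \<psi> :: "'a \<Rightarrow> nat \<Rightarrow> real"
  proof -
    have "measure_pmf.expectation (path_pmf \<eta> Q n) (\<lambda>xs. \<psi> (hd xs) (count_list (tl xs) (hd xs)))
        = measure_pmf.expectation (path_pmf \<eta> Q n) (\<lambda>xs. \<Sum>a\<in>UNIV. of_bool (hd xs = a) * \<psi> a (count_list (tl xs) a))"
      by (simp add: of_bool_def if_distrib[of "\<lambda>x. x * _"] cong: if_cong)
    also have "\<dots> = (\<Sum>a\<in>UNIV. measure_pmf.expectation (path_pmf \<eta> Q n) (\<lambda>xs. of_bool (hd xs = a) * \<psi> a (count_list (tl xs) a)))"
      by (intro Bochner_Integration.integral_sum integrable_measure_pmf_finite[OF finite_set_path_pmf])
    finally show ?thesis .
  qed
  have lim1: "(\<lambda>n. \<P>(\<omega> in M. previous_visits Z n \<omega> = r) / h (real n)) \<longlonglongrightarrow> (\<Sum>a\<in>UNIV. pmf \<pi> a powr \<alpha> * F a)"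
    unfolding regime_switching_laws(1)[OF assms(1)] by_state[of _ "\<lambda>a. visit_prob (p a) r"] sum_divide_distrib
    by (intro tendsto_sum expectation_visits_tendsto irr aper stat asym(1) ratio vp BseqI'[of _ 1])
       (auto simp: visit_prob_nonneg visit_prob_le_1)
  define \<psi> where "\<psi> m = of_bool (m > r) * h (real m)" for m
  have \<psi>_h: "eventually (\<lambda>m. \<psi> m = h (real m)) sequentially"
    using eventually_gt_at_top[of r] by eventually_elim (simp add: \<psi>_def)
  have "eventually (\<lambda>m. \<psi> m / h (real m) = 1) sequentially"
    using \<psi>_h hpos by eventually_elim simp
  hence \<psi>_lim: "(\<lambda>m. \<psi> m / h (real m)) \<longlonglongrightarrow> 1" by (rule tendsto_eventually)
  \<comment> \<open>Boundedness of \<open>h\<close> at infinity is inferred from visit probabilities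
    being at most 1: eventually \<open>h (real m)\<close> stays below
    \<open>2 / F b\<close>.\<close>
  have "Bseq \<psi>"
  proof (rule Bseq_eventually_mono)
    have "eventually (\<lambda>m. F b / 2 < visit_prob (p b) r m / h (real m)) sequentially"
      using b by (intro order_tendstoD(1)[OF vp]) simp
    thus "eventually (\<lambda>m. norm (\<psi> m) \<le> norm (2 / F b)) sequentially"
      using \<psi>_h hpos
    proof eventually_elim
      case (elim m)
      have "F b / 2 * h (real m) < visit_prob (p b) r m" using elim by (simp add: field_simps)
      also have "\<dots> \<le> 1" by (rule visit_prob_le_1)
      finally show ?case using elim b by (simp add: field_simps)
    qed
  qed (rule BseqI'[of _ "\<bar>2 / F b\<bar>"], simp)
  hence "(\<lambda>n. measure_pmf.expectation (path_pmf \<eta> Q n) (\<lambda>xs. \<psi> (count_list (tl xs) (hd xs))) / h (real n))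
      \<longlonglongrightarrow> (\<Sum>a\<in>UNIV. pmf \<pi> a powr \<alpha> * 1)"
    unfolding by_state[of _ "\<lambda>_. \<psi>"] sum_divide_distrib
    by (intro tendsto_sum expectation_visits_tendsto irr aper stat asym(1) ratio \<psi>_lim)
  hence lim2: "(\<lambda>n. (\<integral>\<omega>. \<psi> (previous_visits (\<lambda>i \<omega>. fst (Z i \<omega>)) n \<omega>) \<partial>M) / h (real n))
      \<longlonglongrightarrow> (\<Sum>a\<in>UNIV. pmf \<pi> a powr \<alpha>)"
    unfolding regime_switching_laws(2)[OF assms(1)] by simp
  have "(\<Sum>a\<in>UNIV. pmf \<pi> a powr \<alpha>) > 0"
    using stationary_pos[OF irr aper stat] by (intro sum_pos) (auto simp: less_le)
  hence "(\<lambda>n. (\<P>(\<omega> in M. previous_visits Z n \<omega> = r) / h (real n)) /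
      ((\<integral>\<omega>. \<psi> (previous_visits (\<lambda>i \<omega>. fst (Z i \<omega>)) n \<omega>) \<partial>M) / h (real n)))
      \<longlonglongrightarrow> (\<Sum>a\<in>UNIV. pmf \<pi> a powr \<alpha> * F a) / (\<Sum>a\<in>UNIV. pmf \<pi> a powr \<alpha>)"
    by (intro tendsto_divide lim1 lim2) simp
  moreover have "\<forall>\<^sub>F n in sequentially. (\<P>(\<omega> in M. previous_visits Z n \<omega> = r) / h (real n)) /
      ((\<integral>\<omega>. \<psi> (previous_visits (\<lambda>i \<omega>. fst (Z i \<omega>)) n \<omega>) \<partial>M) / h (real n))
      = \<P>(\<omega> in M. previous_visits Z n \<omega> = r) / (\<integral>\<omega>. \<psi> (previous_visits (\<lambda>i \<omega>. fst (Z i \<omega>)) n \<omega>) \<partial>M)"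
    using hpos by eventually_elim simp
  ultimately have "(\<lambda>n. \<P>(\<omega> in M. previous_visits Z n \<omega> = r) / (\<integral>\<omega>. \<psi> (previous_visits (\<lambda>i \<omega>. fst (Z i \<omega>)) n \<omega>) \<partial>M))
      \<longlonglongrightarrow> (\<Sum>a\<in>UNIV. pmf \<pi> a powr \<alpha> * F a) / (\<Sum>a\<in>UNIV. pmf \<pi> a powr \<alpha>)"
    by (rule Lim_transform_eventually)
  with lim1 show ?thesis unfolding h_def F_def \<psi>_def by blast
qed

end
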